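(* Let $V:f=0$ be a hypersurface in $\mathbb{P}^n$ (over $\mathbb{C}$) of degree $N>1$ having only isolated singularities, with local analytic equations $g_p=0$ for $p \in V_{sing}$, where $V_{sing}$ is the set of singular points of $V$. Then $$ER(f)_m=0 \quad\text{for any } m \leq n(N-2)-\sum_{p \in V_{sing}} a(g_p).$$
   Context: $S=\mathbb{C}[x_0,\dots,x_n]=\oplus_k S_k$ with the standard grading, and $f_{x_j}=\partial f/\partial x_j$. $AR(f)$ is the graded $S$-module with $AR(f)_m$ the space of $(a_0,\dots,a_n)\in S_m^{n+1}$ such that $a_0f_{x_0}+\dots+a_nf_{x_n}=0$. $KR(f)\subset AR(f)$ is the graded submodule generated by the Koszul relations (the tuples with $f_{x_j}$ in position $i$, $-f_{x_i}$ in position $j$, and $0$ elsewhere, $i<j$). $ER(f)=AR(f)/KR(f)$. Let $\mathcal{O}_n$ be the ring of holomorphic function germs at the origin of $\mathbb{C}^n$ and $m_n$ its maximal ideal. For $g\in\mathcal{O}_n$ defining an isolated hypersurface singularity at the origin, $$a(g)=\min\{a\in\mathbb{N} : m_n^a\subset J_g+(g)\},$$ where $J_g$ is the Jacobian ideal of $g$ (generated by its first partial derivatives). It depends only on the isomorphism class of the analytic germ $(\{g=0\},0)$. *)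

theory Defs
  imports "HOL-Analysis.Analysis" "HOL-Library.Poly_Mapping"
begin

section \<open>Polynomials and graded syzygies\<close>

text \<open>
  The polynomial ring over \<open>\<complex>\<close> in finitely many variables indexed by \<open>'k\<close>. A monomial is
  a finitely supported exponent vector; the ring structure is the convolution product of
  \<^type>\<open>poly_mapping\<close>.
\<close>

type_synonym 'k mpoly = "('k \<Rightarrow>\<^sub>0 nat) \<Rightarrow>\<^sub>0 complex"

definition poly_eval :: "'k::finite mpoly \<Rightarrow> complex^'k \<Rightarrow> complex" where
  "poly_eval f v = (\<Sum>\<mu>\<in>Poly_Mapping.keys f.
     Poly_Mapping.lookup f \<mu> * (\<Prod>j\<in>UNIV. (v $ j) ^ Poly_Mapping.lookup \<mu> j))"

text \<open>
  The truncated exponent in \<open>\<mu> - single j 1\<close> is harmless: if \<open>x\<^sub>j\<close> does not occur in \<open>\<mu>\<close>,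
  the coefficient is \<open>0\<close>.
\<close>

definition poly_partial :: "'k \<Rightarrow> 'k::finite mpoly \<Rightarrow> 'k mpoly" where
  "poly_partial j f = (\<Sum>\<mu>\<in>Poly_Mapping.keys f.
     Poly_Mapping.single (\<mu> - Poly_Mapping.single j 1)
       (of_nat (Poly_Mapping.lookup \<mu> j) * Poly_Mapping.lookup f \<mu>))"

text \<open>\<open>S\<^sub>m\<close> for the standard grading; it is \<open>0\<close> for negative \<open>m\<close>.\<close>

definition homog_part :: "int \<Rightarrow> 'k::finite mpoly set" where
  "homog_part m = {p. \<forall>\<mu>\<in>Poly_Mapping.keys p. int (\<Sum>j\<in>UNIV. Poly_Mapping.lookup \<mu> j) = m}"

definition AR :: "'k::finite mpoly \<Rightarrow> int \<Rightarrow> ('k mpoly^'k) set" where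
  "AR f m = {a. (\<forall>j. a $ j \<in> homog_part m) \<and> (\<Sum>j\<in>UNIV. a $ j * poly_partial j f) = 0}"

definition koszul :: "'k::finite mpoly \<Rightarrow> 'k \<Rightarrow> 'k \<Rightarrow> 'k mpoly^'k" where
  "koszul f i j = axis i (poly_partial j f) - axis j (poly_partial i f)"

text \<open>
  The relations for \<open>(i, j)\<close> and \<open>(j, i)\<close> differ only by sign, so no order on the index type
  is needed.
\<close>

definition KR :: "'k::finite mpoly \<Rightarrow> ('k mpoly^'k) set" where
  "KR f = module.span (*s) {koszul f i j | i j. i \<noteq> j}"

text \<open>
  The degree \<open>m\<close> piece of the quotient module: the set of cosets \<open>a + KR f\<close> with
  \<open>a \<in> AR f m\<close>. Its zero element is the coset \<open>KR f\<close>.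
\<close>

definition ER :: "'k::finite mpoly \<Rightarrow> int \<Rightarrow> ('k mpoly^'k) set set" where
  "ER f m = AR f m // {(a, b). a - b \<in> KR f}"


section \<open>Projective space\<close>

typedef ('k::finite) proj = "{L :: (complex^'k) set. \<exists>v. v \<noteq> 0 \<and> L = vec.span {v}}"
  morphisms line_of Proj
proof -
  have "\<exists>v :: complex^'k. v \<noteq> 0"
    by (rule exI[of _ "axis undefined 1"]) (simp add: axis_eq_0_iff)
  then show ?thesis by blast
qed

definition proj_pt :: "complex^'k \<Rightarrow> 'k::finite proj" where
  "proj_pt v = Proj (vec.span {v})"

text \<open>The quotient topology from the space of nonzero vectors.\<close>

instantiation proj :: (finite) topological_space
begin

definition open_proj :: "'a proj set \<Rightarrow> bool" where
  "open_proj U \<longleftrightarrow> open {v :: complex^'a. v \<noteq> 0 \<and> proj_pt v \<in> U}"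

instance
proof
  have "{v :: complex^'a. v \<noteq> 0} = - {0}" by auto
  then show "open (UNIV :: 'a proj set)"
    by (simp add: open_proj_def open_Compl)
next
  fix S T :: "'a proj set"
  assume "open S" "open T"
  then have "open ({v :: complex^'a. v \<noteq> 0 \<and> proj_pt v \<in> S} \<inter> {v. v \<noteq> 0 \<and> proj_pt v \<in> T})"
    unfolding open_proj_def by (rule open_Int)
  also have "{v :: complex^'a. v \<noteq> 0 \<and> proj_pt v \<in> S} \<inter> {v. v \<noteq> 0 \<and> proj_pt v \<in> T}
      = {v. v \<noteq> 0 \<and> proj_pt v \<in> S \<inter> T}" by auto
  finally show "open (S \<inter> T)" unfolding open_proj_def .
next
  fix K :: "'a proj set set"
  assume "\<forall>S\<in>K. open S"
  then have "open (\<Union>S\<in>K. {v :: complex^'a. v \<noteq> 0 \<and> proj_pt v \<in> S})"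
    unfolding open_proj_def by (intro open_UN) auto
  also have "(\<Union>S\<in>K. {v :: complex^'a. v \<noteq> 0 \<and> proj_pt v \<in> S}) = {v. v \<noteq> 0 \<and> proj_pt v \<in> \<Union>K}"
    by auto
  finally show "open (\<Union>K)" unfolding open_proj_def .
qed

end

definition sing_points :: "'k::finite mpoly \<Rightarrow> 'k proj set" where
  "sing_points f = {p. \<forall>v\<in>line_of p. poly_eval f v = 0 \<and> (\<forall>j. poly_eval (poly_partial j f) v = 0)}"


section \<open>Germs of holomorphic functions at the origin\<close>

text \<open>
  Holomorphy in several variables: Frechet differentiability with complex linear derivative at
  all points of a neighbourhood.
\<close>

definition cdifferentiable :: "(complex^'n::finite \<Rightarrow> complex) \<Rightarrow> complex^'n \<Rightarrow> bool" where
  "cdifferentiable F x \<longleftrightarrow> (\<exists>D. (F has_derivative D) (at x) \<and> (\<forall>c v. D (c *s v) = c * D v))"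

definition holo_near :: "(complex^'n::finite \<Rightarrow> complex) \<Rightarrow> complex^'n \<Rightarrow> bool" where
  "holo_near F x \<longleftrightarrow> eventually (cdifferentiable F) (nhds x)"

lemma cdifferentiable_const: "cdifferentiable (\<lambda>_. c) x"
  unfolding cdifferentiable_def by (intro exI[of _ "\<lambda>_. 0"]) auto

lemma cdifferentiable_add:
  assumes "cdifferentiable F x" "cdifferentiable G x"
  shows "cdifferentiable (\<lambda>x. F x + G x) x"
proof -
  obtain D E where "(F has_derivative D) (at x)" "\<forall>c v. D (c *s v) = c * D v"
    "(G has_derivative E) (at x)" "\<forall>c v. E (c *s v) = c * E v"
    using assms unfolding cdifferentiable_def by blast
  then show ?thesis unfolding cdifferentiable_def
    by (intro exI[of _ "\<lambda>v. D v + E v"]) (auto intro: has_derivative_add simp: algebra_simps)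
qed

lemma cdifferentiable_mult:
  assumes "cdifferentiable F x" "cdifferentiable G x"
  shows "cdifferentiable (\<lambda>x. F x * G x) x"
proof -
  obtain D E where "(F has_derivative D) (at x)" "\<forall>c v. D (c *s v) = c * D v"
    "(G has_derivative E) (at x)" "\<forall>c v. E (c *s v) = c * E v"
    using assms unfolding cdifferentiable_def by blast
  then have "((\<lambda>x. F x * G x) has_derivative (\<lambda>v. F x * E v + D v * G x)) (at x)"
    and "\<forall>c v. F x * E (c *s v) + D (c *s v) * G x = c * (F x * E v + D v * G x)"
    by (auto intro!: has_derivative_mult simp only: distrib_left mult.left_commute mult.assoc)
  then show ?thesis unfolding cdifferentiable_def by blast
qed

lemma cdifferentiable_uminus: "cdifferentiable F x \<Longrightarrow> cdifferentiable (\<lambda>x. - F x) x"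
  using cdifferentiable_mult[OF cdifferentiable_const[of "-1"], of F x] by simp

lemma cdifferentiable_diff:
  "cdifferentiable F x \<Longrightarrow> cdifferentiable G x \<Longrightarrow> cdifferentiable (\<lambda>x. F x - G x) x"
  using cdifferentiable_add[OF _ cdifferentiable_uminus, of F x G] by simp

definition germ_rel ::
  "(complex^'n::finite \<Rightarrow> complex) \<Rightarrow> (complex^'n \<Rightarrow> complex) \<Rightarrow> bool" where
  "germ_rel F G \<longleftrightarrow> holo_near F 0 \<and> holo_near G 0 \<and> (\<forall>\<^sub>F x in nhds 0. F x = G x)"

quotient_type 'n hol_germ = "complex^'n::finite \<Rightarrow> complex" / partial: germ_rel
proof (rule part_equivpI)
  show "\<exists>F :: complex^'n \<Rightarrow> complex. germ_rel F F"
    unfolding germ_rel_def holo_near_def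
    by (intro exI[of _ "\<lambda>_. 0"] conjI always_eventually allI cdifferentiable_const refl)
  show "symp (germ_rel :: (complex^'n \<Rightarrow> complex) \<Rightarrow> _)"
    by (rule sympI) (auto simp: germ_rel_def eq_commute)
  show "transp (germ_rel :: (complex^'n \<Rightarrow> complex) \<Rightarrow> _)"
    by (rule transpI) (auto simp: germ_rel_def elim: eventually_elim2)
qed

lemma holo_near_add: "holo_near F x \<Longrightarrow> holo_near G x \<Longrightarrow> holo_near (\<lambda>x. F x + G x) x"
  unfolding holo_near_def by (erule (1) eventually_elim2) (rule cdifferentiable_add)

lemma holo_near_mult: "holo_near F x \<Longrightarrow> holo_near G x \<Longrightarrow> holo_near (\<lambda>x. F x * G x) x"
  unfolding holo_near_def by (erule (1) eventually_elim2) (rule cdifferentiable_mult)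

lemma holo_near_uminus: "holo_near F x \<Longrightarrow> holo_near (\<lambda>x. - F x) x"
  unfolding holo_near_def by (erule eventually_mono) (rule cdifferentiable_uminus)

lemma holo_near_diff: "holo_near F x \<Longrightarrow> holo_near G x \<Longrightarrow> holo_near (\<lambda>x. F x - G x) x"
  unfolding holo_near_def by (erule (1) eventually_elim2) (rule cdifferentiable_diff)

lemma holo_near_const: "holo_near (\<lambda>_. c) x"
  unfolding holo_near_def by (intro always_eventually allI cdifferentiable_const)

lemmas holo_near_intros =
  holo_near_add holo_near_mult holo_near_uminus holo_near_diff holo_near_const

lemma germ_rel_same: "holo_near F 0 \<Longrightarrow> F = G \<Longrightarrow> germ_rel F G"
  by (simp add: germ_rel_def)

lemma germ_rel_holo: "germ_rel F G \<Longrightarrow> holo_near F 0"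
  by (simp add: germ_rel_def)

instantiation hol_germ :: (finite) comm_ring_1
begin

lift_definition zero_hol_germ :: "'a hol_germ" is "\<lambda>_. 0"
  by (simp add: germ_rel_def holo_near_const)

lift_definition one_hol_germ :: "'a hol_germ" is "\<lambda>_. 1"
  by (simp add: germ_rel_def holo_near_const)

lift_definition plus_hol_germ :: "'a hol_germ \<Rightarrow> 'a hol_germ \<Rightarrow> 'a hol_germ"
  is "\<lambda>F G x. F x + G x"
  unfolding germ_rel_def by (auto intro: holo_near_intros elim: eventually_elim2)

lift_definition times_hol_germ :: "'a hol_germ \<Rightarrow> 'a hol_germ \<Rightarrow> 'a hol_germ"
  is "\<lambda>F G x. F x * G x"
  unfolding germ_rel_def by (auto intro: holo_near_intros elim: eventually_elim2)

lift_definition minus_hol_germ :: "'a hol_germ \<Rightarrow> 'a hol_germ \<Rightarrow> 'a hol_germ"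
  is "\<lambda>F G x. F x - G x"
  unfolding germ_rel_def by (auto intro: holo_near_intros elim: eventually_elim2)

lift_definition uminus_hol_germ :: "'a hol_germ \<Rightarrow> 'a hol_germ"
  is "\<lambda>F x. - F x"
  unfolding germ_rel_def by (auto intro: holo_near_intros elim: eventually_mono)

instance
proof
  fix a b c :: "'a hol_germ"
  show "a * b * c = a * (b * c)"
    by transfer (intro germ_rel_same holo_near_intros; (simp add: germ_rel_holo algebra_simps)?)
  show "a * b = b * a"
    by transfer (intro germ_rel_same holo_near_intros; (simp add: germ_rel_holo algebra_simps)?)
  show "1 * a = a"
    by transfer (intro germ_rel_same holo_near_intros; (simp add: germ_rel_holo)?)
  show "a + b + c = a + (b + c)"
    by transfer (intro germ_rel_same holo_near_intros; (simp add: germ_rel_holo algebra_simps)?)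
  show "a + b = b + a"
    by transfer (intro germ_rel_same holo_near_intros; (simp add: germ_rel_holo algebra_simps)?)
  show "0 + a = a"
    by transfer (intro germ_rel_same holo_near_intros; (simp add: germ_rel_holo)?)
  show "- a + a = 0"
    by transfer (intro germ_rel_same holo_near_intros; (simp add: germ_rel_holo)?)
  show "a - b = a + - b"
    by transfer (intro germ_rel_same holo_near_intros; (simp add: germ_rel_holo)?)
  show "(a + b) * c = a * c + b * c"
    by transfer (intro germ_rel_same holo_near_intros; (simp add: germ_rel_holo algebra_simps)?)
  show "(0 :: 'a hol_germ) \<noteq> 1"
    by transfer (auto simp: germ_rel_def dest: eventually_nhds_x_imp_x)
qed

end

lift_definition germ_value :: "'n::finite hol_germ \<Rightarrow> complex" is "\<lambda>F. F 0"
  by (auto simp: germ_rel_def dest: eventually_nhds_x_imp_x)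

text \<open>
  The partial derivative of a holomorphic function is again holomorphic and its germ does not
  depend on the representative, so passing through \<^const>\<open>rep_hol_germ\<close> and
  \<^const>\<open>abs_hol_germ\<close> is meaningful.
\<close>

definition germ_partial :: "'n \<Rightarrow> 'n::finite hol_germ \<Rightarrow> 'n hol_germ" where
  "germ_partial i g = abs_hol_germ (\<lambda>x. deriv (\<lambda>t. rep_hol_germ g (x + t *s axis i 1)) 0)"

definition germ_ideal :: "'n::finite hol_germ set \<Rightarrow> 'n hol_germ set" where
  "germ_ideal = module.span (*)"

definition max_ideal :: "'n::finite hol_germ set" where
  "max_ideal = {g. germ_value g = 0}"

definition ideal_power :: "'n::finite hol_germ set \<Rightarrow> nat \<Rightarrow> 'n hol_germ set" where
  "ideal_power I a = germ_ideal {\<Prod>k<a. h k | h. \<forall>k<a. h k \<in> I}"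

text \<open>The ideal \<open>J\<^sub>g + (g)\<close>.\<close>

definition tjurina_ideal :: "'n::finite hol_germ \<Rightarrow> 'n hol_germ set" where
  "tjurina_ideal g = germ_ideal (insert g (range (\<lambda>i. germ_partial i g)))"

definition a_inv :: "'n::finite hol_germ \<Rightarrow> nat" where
  "a_inv g = (LEAST a. ideal_power max_ideal a \<subseteq> tjurina_ideal g)"


section \<open>Local analytic equations of a projective hypersurface\<close>

text \<open>A biholomorphic map from a neighbourhood of \<open>0\<close> onto a neighbourhood of \<open>\<Phi> 0\<close>.\<close>

definition biholo_at_0 :: "(complex^'n::finite \<Rightarrow> complex^'n) \<Rightarrow> bool" where
  "biholo_at_0 \<Phi> \<longleftrightarrow> (\<forall>l. holo_near (\<lambda>y. \<Phi> y $ l) 0) \<and>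
     (\<exists>\<Psi>. (\<forall>l. holo_near (\<lambda>z. \<Psi> z $ l) (\<Phi> 0)) \<and>
       (\<forall>\<^sub>F y in nhds 0. \<Psi> (\<Phi> y) = y) \<and> (\<forall>\<^sub>F z in nhds (\<Phi> 0). \<Phi> (\<Psi> z) = z))"

text \<open>
  The affine chart \<open>x\<^sub>i = 1\<close>, the remaining homogeneous coordinates being labelled by the
  coordinates of \<open>\<complex>\<^sup>n\<close> through \<open>\<sigma>\<close>.
\<close>

definition affine_chart :: "'k \<Rightarrow> ('n \<Rightarrow> 'k) \<Rightarrow> complex^'n::finite \<Rightarrow> complex^'k::finite" where
  "affine_chart i \<sigma> y = axis i 1 + (\<Sum>l\<in>UNIV. y $ l *s axis (\<sigma> l) 1)"

text \<open>
  \<open>g = 0\<close> is a local analytic equation at \<open>p\<close> of the hypersurface \<open>f = 0\<close>: in suitable local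
  analytic coordinates centred at \<open>p\<close>, the dehomogenization of \<open>f\<close> is a unit times \<open>g\<close>.
\<close>

definition local_equation :: "'k::finite mpoly \<Rightarrow> 'k proj \<Rightarrow> 'n::finite hol_germ \<Rightarrow> bool" where
  "local_equation f p g \<longleftrightarrow> (\<exists>i \<sigma> \<Phi> u.
     bij_betw \<sigma> (UNIV :: 'n set) (UNIV - {i}) \<and>
     biholo_at_0 \<Phi> \<and> proj_pt (affine_chart i \<sigma> (\<Phi> 0)) = p \<and> u dvd 1 \<and>
     (\<forall>\<^sub>F y in nhds 0. poly_eval f (affine_chart i \<sigma> (\<Phi> y)) = rep_hol_germ (u * g) y))"

end

theory Submission
  imports Defs "HOL-Complex_Analysis.Cauchy_Integral_Formula"
    "HOL-Computational_Algebra.Fundamental_Theorem_Algebra"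
begin

text \<open>
  Choose a linear form \<open>l\<close> that vanishes at no singular point and \<open>n\<close> general linear combinations of the
  partial derivatives of \<open>f\<close>, such that together with \<open>l\<close> they form a regular system of parameters. Let
  \<open>G\<close> be the ideal of the \<open>n\<close> combinations. Modulo Koszul relations a syzygy amounts to a form \<open>h\<close> modulo
  \<open>G\<close> with \<open>h J\<^sub>f \<subseteq> G\<close>. The quotient by \<open>G + (l)\<close> has its socle in degree \<open>n(N - 2)\<close>, and modulo \<open>l\<close>
  the linear forms vanishing at a given singular point span all linear forms. Hence, if \<open>h\<close> is nonzero
  modulo \<open>G + (l)\<close> and of degree at most \<open>n(N - 2) - \<Sum>\<^sub>p a(g\<^sub>p)\<close>, it stays nonzero after multiplication by
  a product \<open>L\<close> of \<open>a(g\<^sub>p)\<close> suitable linear forms through each singular point \<open>p\<close>. But \<open>L\<close> lies in \<open>J\<^sub>f\<close>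
  locally at every \<open>p\<close>, so \<open>l\<^sup>k L \<in> J\<^sub>f\<close> for some \<open>k\<close>, and \<open>L h \<in> G\<close> because \<open>l\<close> is regular modulo \<open>G\<close>.
\<close>

text \<open>\<open>h\<close> is the coefficient of one extra combination that completes the
  \<open>n\<close> chosen ones to an invertible constant matrix. Once \<open>h\<close> lies in
  \<open>G\<close>, the syzygy splits into Koszul relations although the extra combination need not
  be regular. If \<open>h\<close> vanishes modulo \<open>G + (l)\<close>, it is divided by
  \<open>l\<close>, and the quotient inherits its properties in lower degree. The number
  \<open>n(N - 2)\<close> comes from exchanging variables for forms of degree \<open>N - 1\<close>:
  \<open>n + 1\<close> independent linear forms leave the socle in degree 0, and each of
  \<open>n\<close> exchanges raises it by \<open>N - 2\<close>. The exchange also preserves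
  regularity, which takes the place of dimension theory. The obstacle is that
  \<open>a_inv (g p)\<close> speaks of germs and \<open>J\<^sub>f\<close> of polynomials. An
  analytic expression of \<open>L\<close> by the partial derivatives is truncated to Taylor
  polynomials; the remainder lies in a high power of the ideal of \<open>p\<close>, and a form that
  does not vanish at \<open>p\<close> multiplies this power into the Jacobian ideal of the chart.
  The Nullstellensatz, applied to all such multipliers at once, turns them into a power of
  \<open>l\<close>.\<close>

interpretation ideal: module "(*) :: 'a::comm_ring_1 \<Rightarrow> 'a \<Rightarrow> 'a"
  by standard (simp_all add: algebra_simps)

text \<open>For this interpretation \<open>scale_scale\<close> is the reverse of \<open>mult.assoc\<close> and makes the simplifier loop.\<close>

declare ideal.scale_scale [simp del]

interpretation vmod: module "(*s) :: 'a::comm_ring_1 \<Rightarrow> 'a^'n \<Rightarrow> 'a^'n"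
  by standard (simp_all add: vec_eq_iff algebra_simps)

section \<open>Polynomials\<close>

abbreviation Cst :: "complex \<Rightarrow> 'k::finite mpoly" where
  "Cst c \<equiv> Poly_Mapping.single 0 c"

definition X :: "'k \<Rightarrow> 'k::finite mpoly" where
  "X j = Poly_Mapping.single (Poly_Mapping.single j 1) 1"

definition mdeg :: "('k::finite \<Rightarrow>\<^sub>0 nat) \<Rightarrow> nat" where
  "mdeg \<mu> = (\<Sum>j\<in>UNIV. Poly_Mapping.lookup \<mu> j)"

lemma mdeg_zero [simp]: "mdeg 0 = 0"
  by (simp add: mdeg_def)

lemma mdeg_add [simp]: "mdeg (\<mu> + \<nu>) = mdeg \<mu> + mdeg \<nu>"
  by (simp add: mdeg_def lookup_add sum.distrib)

lemma mdeg_single [simp]: "mdeg (Poly_Mapping.single j n) = n"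
  by (simp add: mdeg_def lookup_single when_def)

lemma lookup_le_mdeg: "Poly_Mapping.lookup \<mu> j \<le> mdeg \<mu>"
  unfolding mdeg_def by (rule member_le_sum) auto

lemma mdeg_eq_0_iff: "mdeg \<mu> = 0 \<longleftrightarrow> \<mu> = 0"
  by (auto simp: mdeg_def intro!: poly_mapping_eqI)

lemma mono_minus_single:
  assumes "Poly_Mapping.lookup \<mu> j \<noteq> 0"
  shows "\<mu> - Poly_Mapping.single j 1 + Poly_Mapping.single j (1::nat) = \<mu>"
  using assms by (intro poly_mapping_eqI) (auto simp: lookup_add lookup_minus lookup_single when_def)

lemma poly_as_sum: "(\<Sum>\<mu>\<in>Poly_Mapping.keys f. Poly_Mapping.single \<mu> (Poly_Mapping.lookup f \<mu>)) = f"
  by (intro poly_mapping_eqI)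
    (auto simp: lookup_sum lookup_single when_def in_keys_iff sum.delta)

lemma poly_induct [case_names single add]:
  fixes f :: "'a \<Rightarrow>\<^sub>0 'b::comm_monoid_add"
  assumes "\<And>\<mu> c. P (Poly_Mapping.single \<mu> c)" and "\<And>p q. P p \<Longrightarrow> P q \<Longrightarrow> P (p + q)"
  shows "P f"
proof -
  have "P (\<Sum>\<mu>\<in>A. Poly_Mapping.single \<mu> (Poly_Mapping.lookup f \<mu>))" if "finite A" for A
    using that
  proof induction
    case empty
    show ?case using assms(1)[of undefined 0] by simp
  qed (auto intro: assms)
  from this[of "Poly_Mapping.keys f"] show ?thesis by (simp add: poly_as_sum)
qed

subsection \<open>Evaluation\<close>

lemma poly_eval_single [simp]:
  "poly_eval (Poly_Mapping.single \<mu> c) v = c * (\<Prod>j\<in>UNIV. (v $ j) ^ Poly_Mapping.lookup \<mu> j)"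
  by (cases "c = 0") (simp_all add: poly_eval_def)

lemma poly_eval_add [simp]: "poly_eval (f + g) v = poly_eval f v + poly_eval g v"
  unfolding poly_eval_def by (rule setsum_keys_plus_distrib) (simp_all add: algebra_simps)

lemma poly_eval_zero [simp]: "poly_eval 0 v = 0"
  by (simp add: poly_eval_def)

lemma poly_eval_sum [simp]: "poly_eval (\<Sum>i\<in>A. f i) v = (\<Sum>i\<in>A. poly_eval (f i) v)"
  by (induction A rule: infinite_finite_induct) auto

lemma poly_eval_Cst: "poly_eval (Cst c) v = c"
  by simp

lemma poly_eval_one [simp]: "poly_eval 1 v = 1"
  by (simp flip: single_one)

lemma poly_eval_X [simp]: "poly_eval (X j) v = v $ j"
proof -
  have "(\<Prod>i\<in>UNIV. (v $ i) ^ Poly_Mapping.lookup (Poly_Mapping.single j (1::nat)) i)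
      = (\<Prod>i\<in>UNIV. if i = j then v $ j else 1)"
    by (rule prod.cong) (auto simp: lookup_single when_def)
  then show ?thesis by (simp add: X_def)
qed

lemma poly_eval_mult [simp]: "poly_eval (f * g) v = poly_eval f v * poly_eval g v"
proof (induction f rule: poly_induct)
  case (single \<mu> c)
  show ?case
  proof (induction g rule: poly_induct)
    case (single \<nu> d)
    show ?case by (simp add: mult_single lookup_add power_add prod.distrib)
  qed (simp add: distrib_left del: poly_eval_single)
qed (simp add: distrib_right)

lemma poly_eval_uminus [simp]: "poly_eval (- f) v = - poly_eval f v"
  using poly_eval_add[of f "- f" v] by (simp add: eq_neg_iff_add_eq_0 add.commute)

lemma poly_eval_diff [simp]: "poly_eval (f - g) v = poly_eval f v - poly_eval g v"
  using poly_eval_add[of f "- g" v] by simp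

lemma poly_eval_prod [simp]: "poly_eval (\<Prod>i\<in>A. f i) v = (\<Prod>i\<in>A. poly_eval (f i) v)"
  by (induction A rule: infinite_finite_induct) auto

lemma poly_eval_power [simp]: "poly_eval (f ^ n) v = poly_eval f v ^ n"
  by (induction n) auto

lemma X_power: "X j ^ n = Poly_Mapping.single (Poly_Mapping.single j n) 1"
  by (induction n) (simp_all add: X_def mult_single flip: single_add)

lemma single_mono_eq: "Poly_Mapping.single \<mu> c = Cst c * (\<Prod>j\<in>UNIV. X j ^ Poly_Mapping.lookup \<mu> j)"
proof -
  have "(\<Prod>j\<in>A. X j ^ Poly_Mapping.lookup \<mu> j)
      = Poly_Mapping.single (\<Sum>j\<in>A. Poly_Mapping.single j (Poly_Mapping.lookup \<mu> j)) 1"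
    if "finite A" for A
    using that by induction (auto simp: X_power mult_single)
  moreover have "(\<Sum>j\<in>UNIV. Poly_Mapping.single j (Poly_Mapping.lookup \<mu> j)) = \<mu>"
    by (intro poly_mapping_eqI) (simp add: lookup_sum lookup_single when_def)
  ultimately show ?thesis by (simp add: mult_single)
qed

subsection \<open>Partial derivatives\<close>

text \<open>Free of truncated subtraction, so that additivity and the drop of the degree can be read
  off coefficient by coefficient.\<close>

lemma lookup_poly_partial:
  "Poly_Mapping.lookup (poly_partial j f) \<nu>
    = of_nat (Suc (Poly_Mapping.lookup \<nu> j)) * Poly_Mapping.lookup f (\<nu> + Poly_Mapping.single j 1)"
proof -
  have "Poly_Mapping.lookup (poly_partial j f) \<nu>
      = (\<Sum>\<mu>\<in>Poly_Mapping.keys f. if \<mu> = \<nu> + Poly_Mapping.single j 1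
           then of_nat (Poly_Mapping.lookup \<mu> j) * Poly_Mapping.lookup f \<mu> else 0)"
    unfolding poly_partial_def lookup_sum
  proof (rule sum.cong)
    fix \<mu>
    show "Poly_Mapping.lookup (Poly_Mapping.single (\<mu> - Poly_Mapping.single j 1)
        (of_nat (Poly_Mapping.lookup \<mu> j) * Poly_Mapping.lookup f \<mu>)) \<nu>
      = (if \<mu> = \<nu> + Poly_Mapping.single j 1
           then of_nat (Poly_Mapping.lookup \<mu> j) * Poly_Mapping.lookup f \<mu> else 0)"
      using mono_minus_single[of \<mu> j]
      by (cases "Poly_Mapping.lookup \<mu> j = 0") (auto simp: lookup_single when_def lookup_add)
  qed simp
  then show ?thesis by (simp add: in_keys_iff lookup_add)
qed

lemma poly_partial_add: "poly_partial j (f + g) = poly_partial j f + poly_partial j g"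
  by (intro poly_mapping_eqI) (simp add: lookup_poly_partial lookup_add algebra_simps)

lemma poly_partial_single:
  "poly_partial j (Poly_Mapping.single \<mu> c)
    = Poly_Mapping.single (\<mu> - Poly_Mapping.single j 1) (of_nat (Poly_Mapping.lookup \<mu> j) * c)"
  by (cases "c = 0") (simp_all add: poly_partial_def)

text \<open>Ties the formal derivative to the analytic one; the uniqueness of coefficients and the
  chain rule in charts both rest on it.\<close>

lemma poly_eval_has_derivative:
  "(poly_eval f has_derivative (\<lambda>h. \<Sum>j\<in>UNIV. poly_eval (poly_partial j f) v * h $ j)) (at v)"
proof (induction f rule: poly_induct)
  case (single \<mu> c)
  have nth: "((\<lambda>v::complex^'a. v $ j) has_derivative (\<lambda>h. h $ j)) (at v)" for j
    by (rule bounded_linear.has_derivative[OF bounded_linear_vec_nth]) (rule has_derivative_ident)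
  have *: "((\<lambda>v. \<Prod>j\<in>UNIV. (v $ j) ^ Poly_Mapping.lookup \<mu> j) has_derivative
     (\<lambda>h. \<Sum>i\<in>UNIV. (of_nat (Poly_Mapping.lookup \<mu> i) * (h $ i) * (v $ i) ^ (Poly_Mapping.lookup \<mu> i - 1)) *
        (\<Prod>j\<in>UNIV - {i}. (v $ j) ^ Poly_Mapping.lookup \<mu> j))) (at v)"
    by (intro has_derivative_prod has_derivative_power nth)
  have "((\<lambda>v. c * (\<Prod>j\<in>UNIV. (v $ j) ^ Poly_Mapping.lookup \<mu> j)) has_derivative
     (\<lambda>h. c * (\<Sum>i\<in>UNIV. (of_nat (Poly_Mapping.lookup \<mu> i) * (h $ i) * (v $ i) ^ (Poly_Mapping.lookup \<mu> i - 1)) *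
        (\<Prod>j\<in>UNIV - {i}. (v $ j) ^ Poly_Mapping.lookup \<mu> j)))) (at v)"
    by (rule has_derivative_mult_right[OF *])
  moreover have "c * (\<Sum>i\<in>UNIV. (of_nat (Poly_Mapping.lookup \<mu> i) * (h $ i) * (v $ i) ^ (Poly_Mapping.lookup \<mu> i - 1)) *
        (\<Prod>j\<in>UNIV - {i}. (v $ j) ^ Poly_Mapping.lookup \<mu> j))
     = (\<Sum>j\<in>UNIV. poly_eval (poly_partial j (Poly_Mapping.single \<mu> c)) v * h $ j)" for h
    unfolding sum_distrib_left
  proof (rule sum.cong)
    fix i
    have "(\<Prod>j\<in>UNIV. (v $ j) ^ Poly_Mapping.lookup (\<mu> - Poly_Mapping.single i 1) j)
      = (v $ i) ^ (Poly_Mapping.lookup \<mu> i - 1) * (\<Prod>j\<in>UNIV - {i}. (v $ j) ^ Poly_Mapping.lookup \<mu> j)"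
      by (subst prod.remove[of _ i]) (auto simp: lookup_minus lookup_single intro!: prod.cong)
    note P = this
    show "c * ((of_nat (Poly_Mapping.lookup \<mu> i) * (h $ i) * (v $ i) ^ (Poly_Mapping.lookup \<mu> i - 1)) *
        (\<Prod>j\<in>UNIV - {i}. (v $ j) ^ Poly_Mapping.lookup \<mu> j))
      = poly_eval (poly_partial i (Poly_Mapping.single \<mu> c)) v * h $ i"
      unfolding poly_partial_single poly_eval_single P by (simp only: mult_ac)
  qed simp
  moreover have "poly_eval (Poly_Mapping.single \<mu> c) = (\<lambda>v. c * (\<Prod>j\<in>UNIV. (v $ j) ^ Poly_Mapping.lookup \<mu> j))"
    by (simp add: fun_eq_iff)
  ultimately show ?case by simp
next
  case (add p q)
  have "poly_eval (p + q) = (\<lambda>v. poly_eval p v + poly_eval q v)" by (simp add: fun_eq_iff)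
  then show ?case using has_derivative_add[OF add]
    by (simp add: poly_partial_add distrib_right sum.distrib)
qed

lemma continuous_on_poly_eval: "continuous_on A (poly_eval f)"
  using poly_eval_has_derivative by (meson continuous_at_imp_continuous_on has_derivative_continuous)

lemma poly_eval_partial_of_vanishing:
  assumes "\<And>v. poly_eval f v = 0"
  shows "poly_eval (poly_partial j f) v = 0"
proof -
  have "poly_eval f = (\<lambda>_. 0)" using assms by auto
  then have "((\<lambda>_. 0) has_derivative (\<lambda>h. \<Sum>j\<in>UNIV. poly_eval (poly_partial j f) v * h $ j)) (at v)"
    using poly_eval_has_derivative[of f v] by simp
  then have "(\<lambda>h. \<Sum>j\<in>UNIV. poly_eval (poly_partial j f) v * h $ j) = (\<lambda>h. 0)"
    by (rule has_derivative_unique[OF _ has_derivative_const])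
  then have "(\<Sum>i\<in>UNIV. poly_eval (poly_partial i f) v * axis j 1 $ i) = 0"
    by (rule fun_cong)
  then show ?thesis by (simp add: axis_def if_distrib cong: if_cong)
qed

text \<open>Induction on the degree of the monomial: the constant coefficient is the value at 0, and
  any other coefficient is, up to a nonzero factor, a coefficient of a partial derivative, which
  vanishes everywhere as well.\<close>

lemma poly_eval_eq_0_imp:
  fixes f :: "'k::finite mpoly"
  assumes "\<And>v. poly_eval f v = 0"
  shows "f = 0"
proof (rule poly_mapping_eqI)
  fix \<mu> :: "'k \<Rightarrow>\<^sub>0 nat"
  have "\<forall>f. (\<forall>v. poly_eval f v = 0) \<longrightarrow> Poly_Mapping.lookup f \<mu> = 0"
  proof (induction "mdeg \<mu>" arbitrary: \<mu>)
    case 0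
    then have "\<mu> = 0" by (simp add: mdeg_eq_0_iff)
    have "Poly_Mapping.lookup f 0 = poly_eval f 0" for f :: "'k mpoly"
    proof (induction f rule: poly_induct)
      case (single \<mu> c)
      have "(\<Prod>j\<in>UNIV. ((0::complex^'k) $ j) ^ Poly_Mapping.lookup \<mu> j) = (if \<mu> = 0 then 1 else 0)"
        by (auto simp: zero_power_eq prod_zero_iff intro!: poly_mapping_eqI)
      then show ?case by (simp add: lookup_single when_def)
    qed (simp add: lookup_add)
    then show ?case using \<open>\<mu> = 0\<close> by simp
  next
    case (Suc n)
    then obtain j where j: "Poly_Mapping.lookup \<mu> j \<noteq> 0"
      by (metis mdeg_eq_0_iff lookup_zero poly_mapping_eqI nat.simps(3))
    have eq: "\<mu> - Poly_Mapping.single j 1 + Poly_Mapping.single j 1 = \<mu>"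
      by (rule mono_minus_single[OF j])
    have "mdeg (\<mu> - Poly_Mapping.single j 1) = n"
      using Suc(2) arg_cong[OF eq, of mdeg] by simp
    show ?case
    proof (intro allI impI)
      fix f :: "'k mpoly" assume "\<forall>v. poly_eval f v = 0"
      then have "\<forall>v. poly_eval (poly_partial j f) v = 0"
        using poly_eval_partial_of_vanishing by blast
      then have "Poly_Mapping.lookup (poly_partial j f) (\<mu> - Poly_Mapping.single j 1) = 0"
        using Suc(1) \<open>mdeg (\<mu> - Poly_Mapping.single j 1) = n\<close> by blast
      then show "Poly_Mapping.lookup f \<mu> = 0"
        by (simp add: lookup_poly_partial eq[simplified] del: of_nat_Suc)
    qed
  qed
  then show "Poly_Mapping.lookup f \<mu> = Poly_Mapping.lookup 0 \<mu>" using assms by simp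
qed

subsection \<open>The grading\<close>

lemma homog_part_iff: "p \<in> homog_part m \<longleftrightarrow> (\<forall>\<mu>. Poly_Mapping.lookup p \<mu> \<noteq> 0 \<longrightarrow> int (mdeg \<mu>) = m)"
  by (auto simp: homog_part_def mdeg_def in_keys_iff)

lemma homog_zero [simp]: "0 \<in> homog_part m"
  by (simp add: homog_part_iff)

lemma homog_add: "p \<in> homog_part m \<Longrightarrow> q \<in> homog_part m \<Longrightarrow> p + q \<in> homog_part m"
  unfolding homog_part_iff lookup_add by (metis add_0)

lemma homog_uminus: "p \<in> homog_part m \<Longrightarrow> - p \<in> homog_part m"
  by (simp add: homog_part_iff)

lemma homog_diff: "p \<in> homog_part m \<Longrightarrow> q \<in> homog_part m \<Longrightarrow> p - q \<in> homog_part m"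
  using homog_add[of p m "- q"] homog_uminus[of q m] by simp

lemma homog_sum: "(\<And>i. i \<in> A \<Longrightarrow> p i \<in> homog_part m) \<Longrightarrow> (\<Sum>i\<in>A. p i) \<in> homog_part m"
  by (induction A rule: infinite_finite_induct) (auto intro: homog_add)

lemma homog_single: "c = 0 \<or> int (mdeg \<mu>) = m \<Longrightarrow> Poly_Mapping.single \<mu> c \<in> homog_part m"
  by (auto simp: homog_part_iff lookup_single when_def)

lemma homog_Cst: "Cst c \<in> homog_part 0"
  by (rule homog_single) simp

lemma homog_one: "1 \<in> homog_part 0"
  using homog_Cst[of 1] by simp

lemma homog_X: "X j \<in> homog_part 1"
  unfolding X_def by (rule homog_single) simp

lemma homog_mult:
  assumes "p \<in> homog_part m" "q \<in> homog_part k"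
  shows "p * q \<in> homog_part (m + k)"
proof -
  have "int (mdeg \<mu>) = m + k" if "\<mu> \<in> Poly_Mapping.keys (p * q)" for \<mu>
    using that keys_mult[of p q] assms by (fastforce simp: homog_part_def mdeg_def lookup_add sum.distrib)
  then show ?thesis by (simp add: homog_part_iff in_keys_iff)
qed

lemma homog_Cst_mult: "p \<in> homog_part m \<Longrightarrow> Cst c * p \<in> homog_part m"
  using homog_mult[OF homog_Cst] by fastforce

lemma homog_power: "p \<in> homog_part m \<Longrightarrow> p ^ n \<in> homog_part (int n * m)"
  by (induction n) (auto simp: homog_one algebra_simps intro: homog_mult)

lemma homog_prod:
  "(\<And>i. i \<in> A \<Longrightarrow> p i \<in> homog_part (m i)) \<Longrightarrow> (\<Prod>i\<in>A. p i) \<in> homog_part (\<Sum>i\<in>A. m i)"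
  by (induction A rule: infinite_finite_induct) (auto simp: homog_one intro: homog_mult)

lemma homog_neg: "p \<in> homog_part m \<Longrightarrow> m < 0 \<Longrightarrow> p = 0"
  by (intro poly_mapping_eqI) (auto simp: homog_part_iff)

lemma homog_partial: "f \<in> homog_part m \<Longrightarrow> poly_partial j f \<in> homog_part (m - 1)"
  unfolding homog_part_iff lookup_poly_partial
  by (metis mult_zero_right mdeg_add mdeg_single of_nat_add of_nat_1 add_diff_cancel_right')

lemma poly_eval_homog_scale:
  assumes "p \<in> homog_part (int m)"
  shows "poly_eval p (c *s v) = c ^ m * poly_eval p v"
proof -
  have "(\<Prod>j\<in>UNIV. ((c *s v) $ j) ^ Poly_Mapping.lookup \<mu> j)
    = c ^ m * (\<Prod>j\<in>UNIV. (v $ j) ^ Poly_Mapping.lookup \<mu> j)" if "\<mu> \<in> Poly_Mapping.keys p" for \<mu>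
  proof -
    have "mdeg \<mu> = m" using assms that by (simp add: homog_part_iff in_keys_iff)
    then show ?thesis by (simp add: power_mult_distrib prod.distrib mdeg_def flip: power_sum)
  qed
  then show ?thesis unfolding poly_eval_def sum_distrib_left
    by (intro sum.cong) (simp_all add: mult.left_commute)
qed

lemma poly_eval_homog_zero: "p \<in> homog_part m \<Longrightarrow> m \<noteq> 0 \<Longrightarrow> poly_eval p 0 = 0"
  using poly_eval_homog_scale[of p "nat m" 0 0] homog_neg[of p m]
  by (cases "m < 0") (auto simp: zero_power_eq)

lemma Euler_identity:
  assumes "f \<in> homog_part (int N)"
  shows "(\<Sum>j\<in>UNIV. X j * poly_partial j f) = Cst (of_nat N) * f"
proof -
  have 1: "X j * poly_partial j (Poly_Mapping.single \<mu> c)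
      = Poly_Mapping.single \<mu> (of_nat (Poly_Mapping.lookup \<mu> j) * c)" for j \<mu> and c :: complex
    using mono_minus_single[of \<mu> j]
    by (cases "Poly_Mapping.lookup \<mu> j = 0") (auto simp: X_def poly_partial_single mult_single add.commute)
  have sum1: "(\<Sum>j\<in>A. Poly_Mapping.single \<mu> (of_nat (Poly_Mapping.lookup \<mu> j) * c))
     = Poly_Mapping.single \<mu> (of_nat (\<Sum>j\<in>A. Poly_Mapping.lookup \<mu> j) * c)" if "finite A" for A \<mu> and c :: complex
    using that by induction (auto simp: algebra_simps single_add)
  have 2: "(\<Sum>j\<in>UNIV. X j * poly_partial j (Poly_Mapping.single \<mu> c)) = Cst (of_nat (mdeg \<mu>)) * Poly_Mapping.single \<mu> c"
    for \<mu> and c :: complex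
    by (simp only: 1) (simp add: sum1 mult_single mdeg_def)
  have part_sum: "poly_partial j (sum g A) = (\<Sum>a\<in>A. poly_partial j (g a))" if "finite A"
    for j A and g :: "('a \<Rightarrow>\<^sub>0 nat) \<Rightarrow> 'a mpoly"
    using that by induction (auto simp: poly_partial_add, simp add: poly_partial_def)
  let ?s = "\<lambda>\<mu>. Poly_Mapping.single \<mu> (Poly_Mapping.lookup f \<mu>)"
  have "(\<Sum>j\<in>UNIV. X j * poly_partial j f) = (\<Sum>j\<in>UNIV. X j * poly_partial j (\<Sum>\<mu>\<in>Poly_Mapping.keys f. ?s \<mu>))"
    by (simp add: poly_as_sum)
  also have "\<dots> = (\<Sum>j\<in>UNIV. \<Sum>\<mu>\<in>Poly_Mapping.keys f. X j * poly_partial j (?s \<mu>))"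
    by (simp add: part_sum sum_distrib_left)
  also have "\<dots> = (\<Sum>\<mu>\<in>Poly_Mapping.keys f. \<Sum>j\<in>UNIV. X j * poly_partial j (?s \<mu>))"
    by (rule sum.swap)
  also have "\<dots> = (\<Sum>\<mu>\<in>Poly_Mapping.keys f. Cst (of_nat N) * ?s \<mu>)"
    using assms by (intro sum.cong) (auto simp only: 2 homog_part_iff in_keys_iff of_nat_eq_iff)
  also have "\<dots> = Cst (of_nat N) * f"
    by (simp only: poly_as_sum flip: sum_distrib_left)
  finally show ?thesis .
qed

definition homog_comp :: "int \<Rightarrow> 'k::finite mpoly \<Rightarrow> 'k mpoly" where
  "homog_comp m p = (\<Sum>\<mu>\<in>{\<mu>\<in>Poly_Mapping.keys p. int (mdeg \<mu>) = m}. Poly_Mapping.single \<mu> (Poly_Mapping.lookup p \<mu>))"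

lemma lookup_homog_comp: "Poly_Mapping.lookup (homog_comp m p) \<mu> = (if int (mdeg \<mu>) = m then Poly_Mapping.lookup p \<mu> else 0)"
  by (auto simp: homog_comp_def lookup_sum lookup_single when_def in_keys_iff sum.delta)

lemma homog_comp_homog: "homog_comp m p \<in> homog_part m"
  by (simp add: homog_part_iff lookup_homog_comp)

lemma homog_comp_add: "homog_comp m (p + q) = homog_comp m p + homog_comp m q"
  by (intro poly_mapping_eqI) (simp add: lookup_homog_comp lookup_add)

lemma homog_comp_zero [simp]: "homog_comp m 0 = 0"
  by (intro poly_mapping_eqI) (simp add: lookup_homog_comp)

lemma homog_comp_diff: "homog_comp m (p - q) = homog_comp m p - homog_comp m q"
  by (intro poly_mapping_eqI) (simp add: lookup_homog_comp lookup_minus)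

lemma homog_comp_sum: "homog_comp m (\<Sum>i\<in>A. p i) = (\<Sum>i\<in>A. homog_comp m (p i))"
  by (induction A rule: infinite_finite_induct) (auto simp: homog_comp_add)

lemma homog_comp_single: "homog_comp m (Poly_Mapping.single \<mu> c) = (if int (mdeg \<mu>) = m then Poly_Mapping.single \<mu> c else 0)"
  by (intro poly_mapping_eqI) (auto simp: lookup_homog_comp lookup_single when_def)

lemma homog_comp_of_homog: "p \<in> homog_part k \<Longrightarrow> homog_comp m p = (if m = k then p else 0)"
  by (intro poly_mapping_eqI) (auto simp: lookup_homog_comp homog_part_iff)

lemma homog_comp_mult_homog:
  assumes "q \<in> homog_part d"
  shows "homog_comp m (p * q) = homog_comp (m - d) p * q"
proof (induction p rule: poly_induct)
  case (single \<mu> c)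
  have "homog_comp m (Poly_Mapping.single \<mu> c * Poly_Mapping.single \<nu> (Poly_Mapping.lookup q \<nu>))
      = homog_comp (m - d) (Poly_Mapping.single \<mu> c) * Poly_Mapping.single \<nu> (Poly_Mapping.lookup q \<nu>)"
    if "\<nu> \<in> Poly_Mapping.keys q" for \<nu>
  proof -
    have "int (mdeg \<nu>) = d" using assms that by (simp add: homog_part_iff in_keys_iff)
    then show ?thesis by (auto simp: mult_single homog_comp_single)
  qed
  then have "homog_comp m (Poly_Mapping.single \<mu> c * (\<Sum>\<nu>\<in>Poly_Mapping.keys q. Poly_Mapping.single \<nu> (Poly_Mapping.lookup q \<nu>)))
      = homog_comp (m - d) (Poly_Mapping.single \<mu> c) * (\<Sum>\<nu>\<in>Poly_Mapping.keys q. Poly_Mapping.single \<nu> (Poly_Mapping.lookup q \<nu>))"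
    by (simp add: sum_distrib_left homog_comp_sum)
  then show ?case by (simp only: poly_as_sum)
qed (simp add: homog_comp_add distrib_right)

lemma homog_comp_eventually_zero: "\<exists>K. \<forall>m\<ge>K. homog_comp m p = 0"
proof (induction p rule: poly_induct)
  case (single \<mu> c)
  show ?case by (rule exI[of _ "int (mdeg \<mu>) + 1"]) (auto simp: homog_comp_single)
next
  case (add p q)
  then obtain K L where "\<forall>m\<ge>K. homog_comp m p = 0" "\<forall>m\<ge>L. homog_comp m q = 0" by blast
  then show ?case by (intro exI[of _ "max K L"]) (auto simp: homog_comp_add)
qed

lemma homog_comp_neg: "m < 0 \<Longrightarrow> homog_comp m p = 0"
  using homog_comp_homog homog_neg by blast

section \<open>The Nullstellensatz over the complex numbers\<close>

text \<open>Gaussian elimination: a pivot \<open>c0\<close> clears the coordinate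
  \<open>\<mu>0\<close> from the other vectors, and a relation among those determines the
  coefficient of \<open>c0\<close>. The vectors form an indexed family because some of them may
  coincide.\<close>

lemma nontrivial_relation:
  fixes w :: "'c \<Rightarrow> 'm \<Rightarrow> 'a::field"
  assumes "finite M" "finite Y" "card M < card Y"
  shows "\<exists>\<alpha>. (\<exists>c\<in>Y. \<alpha> c \<noteq> 0) \<and> (\<forall>\<mu>\<in>M. (\<Sum>c\<in>Y. \<alpha> c * w c \<mu>) = 0)"
  using assms
proof (induction M arbitrary: Y w rule: finite_induct)
  case empty
  then have "Y \<noteq> {}" by auto
  then show ?case by (intro exI[of _ "\<lambda>_. 1"]) auto
next
  case (insert \<mu>0 M)
  show ?case
  proof (cases "\<forall>c\<in>Y. w c \<mu>0 = 0")
    case True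
    have "card M < card Y" using insert by simp
    then obtain \<alpha> where "\<exists>c\<in>Y. \<alpha> c \<noteq> 0" "\<forall>\<mu>\<in>M. (\<Sum>c\<in>Y. \<alpha> c * w c \<mu>) = 0"
      using insert.IH[OF insert.prems(1), of w] by blast
    then show ?thesis using True by (intro exI[of _ \<alpha>]) auto
  next
    case False
    then obtain c0 where c0: "c0 \<in> Y" "w c0 \<mu>0 \<noteq> 0" by blast
    let ?w = "\<lambda>c \<mu>. w c \<mu> - w c \<mu>0 / w c0 \<mu>0 * w c0 \<mu>"
    have "card M < card (Y - {c0})" using insert c0 by simp
    then obtain \<alpha> where \<alpha>: "\<exists>c\<in>Y-{c0}. \<alpha> c \<noteq> 0" "\<forall>\<mu>\<in>M. (\<Sum>c\<in>Y-{c0}. \<alpha> c * ?w c \<mu>) = 0"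
      using insert.IH[of "Y - {c0}" ?w] insert.prems(1) by blast
    let ?s = "- (\<Sum>c\<in>Y-{c0}. \<alpha> c * (w c \<mu>0 / w c0 \<mu>0))"
    have *: "(\<Sum>c\<in>Y. (\<alpha>(c0 := ?s)) c * w c \<mu>) = (\<Sum>c\<in>Y-{c0}. \<alpha> c * ?w c \<mu>)" for \<mu>
    proof -
      have "(\<Sum>c\<in>Y. (\<alpha>(c0 := ?s)) c * w c \<mu>)
          = ?s * w c0 \<mu> + (\<Sum>c\<in>Y-{c0}. (\<alpha>(c0 := ?s)) c * w c \<mu>)"
        using insert.prems(1) c0(1) by (subst sum.remove[of _ c0]) auto
      also have "(\<Sum>c\<in>Y-{c0}. (\<alpha>(c0 := ?s)) c * w c \<mu>) = (\<Sum>c\<in>Y-{c0}. \<alpha> c * w c \<mu>)"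
        by (rule sum.cong) auto
      also have "?s * w c0 \<mu> = - (\<Sum>c\<in>Y-{c0}. \<alpha> c * (w c \<mu>0 / w c0 \<mu>0 * w c0 \<mu>))"
        by (simp only: mult_minus_left sum_distrib_right mult.assoc)
      also have "\<dots> + (\<Sum>c\<in>Y-{c0}. \<alpha> c * w c \<mu>) = (\<Sum>c\<in>Y-{c0}. \<alpha> c * ?w c \<mu>)"
        by (simp add: right_diff_distrib sum_subtractf)
      finally show ?thesis .
    qed
    have "(\<Sum>c\<in>Y. (\<alpha>(c0 := ?s)) c * w c \<mu>) = 0" if "\<mu> \<in> insert \<mu>0 M" for \<mu>
      unfolding * using that \<alpha>(2) c0(2) by auto
    then show ?thesis using \<alpha>(1) by (intro exI[of _ "\<alpha>(c0 := ?s)"]) auto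
  qed
qed

lemma lookup_Cst_mult: "Poly_Mapping.lookup (Cst a * p) \<mu> = a * Poly_Mapping.lookup p \<mu>"
proof (induction p rule: poly_induct)
  case (single \<nu> c)
  show ?case by (simp add: mult_single lookup_single when_def)
qed (simp add: lookup_add distrib_left)

lemma poly_nontrivial_relation:
  fixes w :: "'c \<Rightarrow> 'k::finite mpoly"
  assumes "finite M" "finite Y" "card M < card Y" "\<And>c. c \<in> Y \<Longrightarrow> Poly_Mapping.keys (w c) \<subseteq> M"
  shows "\<exists>\<alpha>. (\<exists>c\<in>Y. \<alpha> c \<noteq> 0) \<and> (\<Sum>c\<in>Y. Cst (\<alpha> c) * w c) = 0"
proof -
  obtain \<alpha> where \<alpha>: "\<exists>c\<in>Y. \<alpha> c \<noteq> 0" "\<forall>\<mu>\<in>M. (\<Sum>c\<in>Y. \<alpha> c * Poly_Mapping.lookup (w c) \<mu>) = 0"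
    using nontrivial_relation[OF assms(1-3), of "\<lambda>c. Poly_Mapping.lookup (w c)"] by blast
  have "(\<Sum>c\<in>Y. \<alpha> c * Poly_Mapping.lookup (w c) \<mu>) = 0" for \<mu>
  proof (cases "\<mu> \<in> M")
    case False
    then have "Poly_Mapping.lookup (w c) \<mu> = 0" if "c \<in> Y" for c
      using assms(4)[OF that] by (auto simp: in_keys_iff)
    then show ?thesis by simp
  qed (use \<alpha> in blast)
  then have "(\<Sum>c\<in>Y. Cst (\<alpha> c) * w c) = 0"
    by (intro poly_mapping_eqI) (simp add: lookup_sum lookup_Cst_mult)
  then show ?thesis using \<alpha>(1) by blast
qed

lemma finite_mdeg_le: "finite {\<mu> :: 'k::finite \<Rightarrow>\<^sub>0 nat. mdeg \<mu> \<le> D}"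
proof (rule finite_imageD)
  have "Poly_Mapping.lookup ` {\<mu> :: 'k \<Rightarrow>\<^sub>0 nat. mdeg \<mu> \<le> D} \<subseteq> UNIV \<rightarrow>\<^sub>E {..D}"
    using lookup_le_mdeg by (auto intro: le_trans)
  then show "finite (Poly_Mapping.lookup ` {\<mu> :: 'k \<Rightarrow>\<^sub>0 nat. mdeg \<mu> \<le> D})"
    by (rule finite_subset) (simp add: finite_PiE)
  show "inj_on Poly_Mapping.lookup {\<mu> :: 'k \<Rightarrow>\<^sub>0 nat. mdeg \<mu> \<le> D}"
    by (rule inj_onI) (simp only: poly_mapping_eq_iff)
qed

lemma ex_degree_bound: "\<exists>D. Poly_Mapping.keys (p :: 'k::finite mpoly) \<subseteq> {\<mu>. mdeg \<mu> \<le> D}"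
  by (rule exI[of _ "Max (mdeg ` Poly_Mapping.keys p)"]) auto

lemma subspace_mult_left: "ideal.subspace I \<Longrightarrow> p \<in> I \<Longrightarrow> q * p \<in> I"
  by (rule ideal.subspace_scale)

lemma subspace_mult_right: "ideal.subspace I \<Longrightarrow> p \<in> I \<Longrightarrow> p * q \<in> I"
  by (subst mult.commute) (rule ideal.subspace_scale)

text \<open>Serves twice: for the maximal ideal found in the Nullstellensatz and for the ideal of
  the base point of an affine chart.\<close>

lemma congruent_value:
  fixes I :: "'k::finite mpoly set"
  assumes I: "ideal.subspace I" and X: "\<And>j. X j - Cst (v $ j) \<in> I"
  shows "p - Cst (poly_eval p v) \<in> I"
proof (induction p rule: poly_induct)
  case (single \<mu> c)
  let ?E = "\<lambda>p. p - Cst (poly_eval p v) \<in> I"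
  have mult: "?E (p * q)" if "?E p" "?E q" for p q
  proof -
    have "p * q - Cst (poly_eval (p * q) v)
        = (p - Cst (poly_eval p v)) * q + Cst (poly_eval p v) * (q - Cst (poly_eval q v))"
      by (simp add: mult_single algebra_simps)
    then show ?thesis
      using that ideal.subspace_add[OF I] subspace_mult_left[OF I] subspace_mult_right[OF I] by metis
  qed
  have one: "?E 1" using ideal.subspace_0[OF I] by simp
  have EX: "?E (X j)" for j using X[of j] by simp
  have power: "?E (X j ^ n)" for j n
    by (induction n) (use one mult EX in \<open>auto simp del: poly_eval_mult poly_eval_power poly_eval_X poly_eval_single\<close>)
  have "?E (\<Prod>j\<in>A. X j ^ Poly_Mapping.lookup \<mu> j)" if "finite A" for A
    using that by induction (use one mult power in \<open>auto simp del: poly_eval_mult poly_eval_power poly_eval_prod poly_eval_single\<close>)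
  then have "?E (Cst c * (\<Prod>j\<in>UNIV. X j ^ Poly_Mapping.lookup \<mu> j))"
    by (intro mult) (simp_all add: ideal.subspace_0[OF I])
  then show ?case by (simp only: single_mono_eq[of \<mu> c])
next
  case (add p q)
  have *: "p + q - Cst (poly_eval (p + q) v) = (p - Cst (poly_eval p v)) + (q - Cst (poly_eval q v))"
    by (simp add: single_add)
  show ?case unfolding * by (rule ideal.subspace_add[OF I add])
qed

section \<open>One-variable polynomials in a variable \<open>X i\<close>\<close>

definition subst_X :: "'k \<Rightarrow> complex poly \<Rightarrow> 'k::finite mpoly" where
  "subst_X i r = poly (map_poly Cst r) (X i)"

lemma subst_X_0 [simp]: "subst_X i 0 = 0"
  by (simp add: subst_X_def)

lemma subst_X_pCons [simp]: "subst_X i (pCons a r) = Cst a + X i * subst_X i r"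
  by (simp add: subst_X_def map_poly_pCons)

lemma subst_X_add: "subst_X i (r + s) = subst_X i r + subst_X i s"
  by (induction r s rule: poly_induct2) (simp_all add: single_add algebra_simps)

lemma subst_X_smult: "subst_X i (smult a r) = Cst a * subst_X i r"
  by (induction r) (simp_all add: mult_single algebra_simps)

lemma subst_X_mult: "subst_X i (r * s) = subst_X i r * subst_X i s"
  by (induction r) (simp_all add: subst_X_add subst_X_smult algebra_simps)

lemma subst_X_1 [simp]: "subst_X i 1 = 1"
  by (simp add: one_pCons)

lemma subst_X_sum: "subst_X i (\<Sum>c\<in>A. r c) = (\<Sum>c\<in>A. subst_X i (r c))"
  by (induction A rule: infinite_finite_induct) (auto simp: subst_X_add)

lemma subst_X_prod: "subst_X i (\<Prod>c\<in>A. r c) = (\<Prod>c\<in>A. subst_X i (r c))"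
  by (induction A rule: infinite_finite_induct) (auto simp: subst_X_mult)

text \<open>\<open>r\<close> splits over the complex numbers, so the prime ideal \<open>P\<close>
  contains one of its linear factors or else a nonzero constant, which would put 1 into
  \<open>P\<close>.\<close>

lemma prime_contains_linear_factor:
  fixes P :: "'k::finite mpoly set"
  assumes P: "ideal.subspace P" "1 \<notin> P" and prime: "\<And>a b. a * b \<in> P \<Longrightarrow> a \<in> P \<or> b \<in> P"
    and "r \<noteq> 0" "subst_X i r \<in> P"
  shows "\<exists>c. X i - Cst c \<in> P"
  using assms(4,5)
proof (induction "degree r" arbitrary: r)
  case 0
  obtain a where r: "r = [:a:]" using degree_eq_zeroE[OF 0(1)[symmetric]] by blast
  then have "Cst (1 / a) * Cst a \<in> P" using 0 P(1) by (auto intro: subspace_mult_left)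
  then show ?case using 0 r P(2) by (simp add: mult_single)
next
  case (Suc n)
  have "\<not> constant (poly r)" using Suc(2) by (simp add: constant_degree)
  then obtain z where "poly r z = 0" using fundamental_theorem_of_algebra by blast
  then obtain s where s: "r = [:-z, 1:] * s" by (metis dvdE poly_eq_0_iff_dvd)
  then have "s \<noteq> 0" using Suc(3) by auto
  moreover have "degree r = degree [:-z, 1:] + degree s"
    unfolding s using \<open>s \<noteq> 0\<close> by (intro degree_mult_eq) auto
  ultimately have "s \<noteq> 0" "n = degree s" using Suc(2) by auto
  have "subst_X i [:-z, 1:] = X i - Cst z" by (simp add: single_uminus)
  then have "(X i - Cst z) * subst_X i s \<in> P" using Suc(4) unfolding s subst_X_mult by simp
  then show ?case using prime Suc(1)[OF \<open>n = degree s\<close> \<open>s \<noteq> 0\<close>] by blast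
qed

text \<open>
  A prime \<open>P\<close> maximal among the ideals that avoid all powers of \<open>h\<close> is the ideal of a point: otherwise
  some \<open>X\<^sub>i - c\<close> would be invertible modulo \<open>P\<close> up to a power of \<open>h\<close> for each of the uncountably many
  \<open>c\<close>, and infinitely many of these inverses would lie in one finite-dimensional space.
\<close>

theorem nullstellensatz:
  fixes I :: "'k::finite mpoly set"
  assumes I: "ideal.subspace I"
    and h: "\<And>v. (\<And>p. p \<in> I \<Longrightarrow> poly_eval p v = 0) \<Longrightarrow> poly_eval h v = 0"
  shows "\<exists>k. h ^ k \<in> I"
proof (rule ccontr)
  assume neg: "\<nexists>k. h ^ k \<in> I"
  define \<A> where "\<A> = {P. ideal.subspace P \<and> I \<subseteq> P \<and> (\<forall>k. h ^ k \<notin> P)}"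
  have "\<exists>P\<in>\<A>. \<forall>Q\<in>\<A>. P \<subseteq> Q \<longrightarrow> Q = P"
  proof (rule subset_Zorn_nonempty)
    show "\<A> \<noteq> {}" using I neg unfolding \<A>_def by blast
    fix \<C> assume \<C>: "\<C> \<noteq> {}" "subset.chain \<A> \<C>"
    have sub: "ideal.subspace A" "I \<subseteq> A" "h ^ k \<notin> A" if "A \<in> \<C>" for A k
      using \<C>(2) that unfolding \<A>_def subset_chain_def by auto
    have "ideal.subspace (\<Union>\<C>)"
    proof (rule ideal.subspaceI)
      show "0 \<in> \<Union>\<C>" using \<C>(1) ideal.subspace_0[OF sub(1)] by blast
    next
      fix x y assume "x \<in> \<Union>\<C>" "y \<in> \<Union>\<C>"
      then obtain A B where AB: "A \<in> \<C>" "x \<in> A" "B \<in> \<C>" "y \<in> B" by blast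
      then have "A \<subseteq> B \<or> B \<subseteq> A" using \<C>(2) unfolding subset_chain_def by blast
      then obtain D where "D \<in> \<C>" "x \<in> D" "y \<in> D" using AB by blast
      then show "x + y \<in> \<Union>\<C>" using ideal.subspace_add[OF sub(1)] by blast
    next
      fix c x assume "x \<in> \<Union>\<C>"
      then show "c * x \<in> \<Union>\<C>" using subspace_mult_left[OF sub(1)] by blast
    qed
    moreover have "I \<subseteq> \<Union>\<C>" using \<C>(1) sub(2) by blast
    ultimately show "\<Union>\<C> \<in> \<A>" using sub(3) unfolding \<A>_def by blast
  qed
  then obtain P where "P \<in> \<A>" and Pmax: "\<And>Q. Q \<in> \<A> \<Longrightarrow> P \<subseteq> Q \<Longrightarrow> Q = P" by blast
  then have P: "ideal.subspace P" "I \<subseteq> P" and hP: "\<And>k. h ^ k \<notin> P" unfolding \<A>_def by auto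
  \<comment> \<open>The set \<open>?Q\<close> below is the ideal \<open>P + (a)\<close>. By
    maximality of \<open>P\<close> it contains a power of \<open>h\<close> as soon as it is larger
    than \<open>P\<close>.\<close>
  have adj: "\<exists>k q. h ^ k - q * a \<in> P" if "a \<notin> P" for a
  proof (rule ccontr)
    assume neg: "\<nexists>k q. h ^ k - q * a \<in> P"
    let ?Q = "{x. \<exists>q. x - q * a \<in> P}"
    have "ideal.subspace ?Q"
    proof (rule ideal.subspaceI)
      show "0 \<in> ?Q" using ideal.subspace_0[OF P(1)] by (auto intro!: exI[of _ 0])
    next
      fix x y assume "x \<in> ?Q" "y \<in> ?Q"
      then obtain q r where qr: "x - q * a \<in> P" "y - r * a \<in> P" by blast
      have "x + y - (q + r) * a = (x - q * a) + (y - r * a)" by (simp add: algebra_simps)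
      then have "x + y - (q + r) * a \<in> P" using ideal.subspace_add[OF P(1) qr] by (simp only:)
      then show "x + y \<in> ?Q" by blast
    next
      fix c x assume "x \<in> ?Q"
      then obtain q where "x - q * a \<in> P" by blast
      then have "c * x - (c * q) * a \<in> P"
        using subspace_mult_left[OF P(1), of "x - q * a" c] by (simp add: algebra_simps)
      then show "c * x \<in> ?Q" by blast
    qed
    moreover have "P \<subseteq> ?Q" by (auto intro!: exI[of _ 0])
    ultimately have "?Q = P" using neg P(2) by (intro Pmax) (auto simp: \<A>_def)
    moreover have "a \<in> ?Q" using ideal.subspace_0[OF P(1)] by (auto intro!: exI[of _ 1])
    ultimately show False using that by blast
  qed
  have prime: "a \<in> P \<or> b \<in> P" if "a * b \<in> P" for a b
  proof (rule ccontr)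
    assume "\<not> ?thesis"
    then obtain k q l r where *: "h ^ k - q * a \<in> P" "h ^ l - r * b \<in> P" using adj by metis
    have "h ^ (k + l) = h ^ l * (h ^ k - q * a) + q * a * (h ^ l - r * b) + q * r * (a * b)"
      by (simp add: power_add algebra_simps)
    also have "\<dots> \<in> P"
      by (intro ideal.subspace_add[OF P(1)] subspace_mult_left[OF P(1) *(1)]
          subspace_mult_left[OF P(1) *(2)] subspace_mult_left[OF P(1) that])
    finally have "h ^ (k + l) \<in> P" .
    then show False using hP by blast
  qed
  have oneP: "1 \<notin> P" using hP[of 0] by simp
  have "\<exists>c. X i - Cst c \<in> P" for i
  proof (rule ccontr)
    assume none: "\<nexists>c. X i - Cst c \<in> P"
    then have "\<forall>c. \<exists>k q. h ^ k - q * (X i - Cst c) \<in> P" using adj by blast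
    then obtain k q where kq: "\<And>c. h ^ k c - q c * (X i - Cst c) \<in> P" by metis
    have "\<forall>c. \<exists>D. Poly_Mapping.keys (q c) \<subseteq> {\<mu>. mdeg \<mu> \<le> D}"
      using ex_degree_bound by blast
    then obtain D where D: "\<And>c. Poly_Mapping.keys (q c) \<subseteq> {\<mu>. mdeg \<mu> \<le> D c}"
      using choice[of "\<lambda>c D. Poly_Mapping.keys (q c) \<subseteq> {\<mu>. mdeg \<mu> \<le> D}"] by blast
    have "\<exists>z. infinite ((\<lambda>c. (k c, D c)) -` {z})"
    proof (rule ccontr)
      assume "\<nexists>z. infinite ((\<lambda>c. (k c, D c)) -` {z})"
      then have "countable (\<Union>z. (\<lambda>c. (k c, D c)) -` {z})"
        by (intro countable_UN) (auto intro: countable_finite)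
      moreover have "(\<Union>z. (\<lambda>c. (k c, D c)) -` {z}) = UNIV" by auto
      ultimately show False using uncountable_UNIV_complex by simp
    qed
    then obtain K E where inf: "infinite ((\<lambda>c. (k c, D c)) -` {(K, E)})" by auto
    let ?M = "{\<mu> :: 'k \<Rightarrow>\<^sub>0 nat. mdeg \<mu> \<le> E}"
    obtain Y where Y: "finite Y" "card Y = Suc (card ?M)" "Y \<subseteq> (\<lambda>c. (k c, D c)) -` {(K, E)}"
      using infinite_arbitrarily_large[OF inf] by metis
    have kY: "k c = K" "D c = E" if "c \<in> Y" for c using Y(3) that by auto
    have "Poly_Mapping.keys (q c) \<subseteq> ?M" if "c \<in> Y" for c using D[of c] kY[OF that] by simp
    then obtain \<alpha> c0 where c0: "c0 \<in> Y" "\<alpha> c0 \<noteq> 0" and rel: "(\<Sum>c\<in>Y. Cst (\<alpha> c) * q c) = 0"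
      using poly_nontrivial_relation[OF finite_mdeg_le Y(1), of E q] Y(2) by auto
    \<comment> \<open>This clears denominators in \<open>rel\<close>: modulo \<open>P\<close>,
      \<open>q c\<close> behaves like \<open>h ^ K / (X i - c)\<close>, and \<open>r\<close> is the
      numerator of the resulting sum. At \<open>c0\<close> all summands but one vanish, so
      \<open>r\<close> is not zero.\<close>
    define r where "r = (\<Sum>c\<in>Y. smult (\<alpha> c) (\<Prod>c'\<in>Y-{c}. [:-c', 1:]))"
    have lin: "subst_X i [:-c, 1:] = X i - Cst c" for c by (simp add: single_uminus)
    have sr: "subst_X i r = (\<Sum>c\<in>Y. Cst (\<alpha> c) * (\<Prod>c'\<in>Y-{c}. X i - Cst c'))"
      unfolding r_def subst_X_sum subst_X_smult subst_X_prod lin ..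
    have "poly r c0 = (\<Sum>c\<in>Y. \<alpha> c * (\<Prod>c'\<in>Y-{c}. c0 - c'))"
      by (simp add: r_def poly_sum poly_prod)
    also have "\<dots> = \<alpha> c0 * (\<Prod>c'\<in>Y-{c0}. c0 - c')"
    proof (subst sum.remove[OF Y(1) c0(1)])
      have "(\<Prod>c'\<in>Y-{c}. c0 - c') = 0" if "c \<in> Y - {c0}" for c
        using that c0 Y(1) by (intro prod_zero) auto
      then show "\<alpha> c0 * (\<Prod>c'\<in>Y-{c0}. c0 - c') + (\<Sum>c\<in>Y-{c0}. \<alpha> c * (\<Prod>c'\<in>Y-{c}. c0 - c'))
        = \<alpha> c0 * (\<Prod>c'\<in>Y-{c0}. c0 - c')" by simp
    qed
    also have "\<dots> \<noteq> 0" using c0(2) Y(1) by auto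
    finally have "r \<noteq> 0" by auto
    have "h ^ K * subst_X i r - (\<Prod>c\<in>Y. X i - Cst c) * (\<Sum>c\<in>Y. Cst (\<alpha> c) * q c)
      = (\<Sum>c\<in>Y. Cst (\<alpha> c) * (\<Prod>c'\<in>Y-{c}. X i - Cst c') * (h ^ K - q c * (X i - Cst c)))"
      unfolding sr sum_distrib_left sum_subtractf[symmetric]
    proof (rule sum.cong)
      fix c assume "c \<in> Y"
      then have "(\<Prod>c\<in>Y. X i - Cst c) = (X i - Cst c) * (\<Prod>c'\<in>Y-{c}. X i - Cst c')"
        using Y(1) by (subst prod.remove[of _ c]) auto
      then show "h ^ K * (Cst (\<alpha> c) * (\<Prod>c'\<in>Y-{c}. X i - Cst c'))
          - (\<Prod>c\<in>Y. X i - Cst c) * (Cst (\<alpha> c) * q c)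
        = Cst (\<alpha> c) * (\<Prod>c'\<in>Y-{c}. X i - Cst c') * (h ^ K - q c * (X i - Cst c))"
        by (simp only:) (simp only: algebra_simps)
    qed simp
    also have "\<dots> \<in> P"
      using kq kY by (intro ideal.subspace_sum[OF P(1)] subspace_mult_left[OF P(1)]) metis
    finally have "h ^ K * subst_X i r \<in> P" using rel by simp
    then have "subst_X i r \<in> P" using prime hP by blast
    then show False using prime_contains_linear_factor[OF P(1) oneP prime \<open>r \<noteq> 0\<close>] none by blast
  qed
  then obtain c where c: "\<And>i. X i - Cst (c i) \<in> P" by metis
  define v where "v = (\<chi> i. c i)"
  have val: "p - Cst (poly_eval p v) \<in> P" for p
    by (rule congruent_value[OF P(1)]) (simp add: v_def c)
  have "poly_eval p v = 0" if "p \<in> I" for p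
  proof (rule ccontr)
    assume nz: "poly_eval p v \<noteq> 0"
    have "Cst (poly_eval p v) \<in> P" using ideal.subspace_diff[OF P(1) _ val[of p], of p] that P(2) by auto
    then have "Cst (1 / poly_eval p v) * Cst (poly_eval p v) \<in> P" by (rule subspace_mult_left[OF P(1)])
    then show False using nz oneP by (simp add: mult_single)
  qed
  then have "poly_eval h v = 0" by (rule h)
  then have "h \<in> P" using val[of h] by simp
  then show False using hP[of 1] by simp
qed

section \<open>Homogeneous generators and ideals with no nonzero common zero\<close>

lemma in_span_image_iff:
  assumes "finite A"
  shows "p \<in> ideal.span (\<theta> ` A) \<longleftrightarrow> (\<exists>c. p = (\<Sum>i\<in>A. c i * \<theta> i))"
proof
  assume "p \<in> ideal.span (\<theta> ` A)"
  then show "\<exists>c. p = (\<Sum>i\<in>A. c i * \<theta> i)"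
  proof (induction rule: ideal.span_induct_alt)
    case base
    show ?case by (rule exI[of _ "\<lambda>_. 0"]) simp
  next
    case (step a x y)
    then obtain i c where i: "i \<in> A" "x = \<theta> i" and c: "y = (\<Sum>i\<in>A. c i * \<theta> i)" by blast
    have "a * x + y = (\<Sum>j\<in>A. (if j = i then a * \<theta> i else 0) + c j * \<theta> j)"
      using i assms by (simp add: c sum.distrib sum.delta)
    also have "\<dots> = (\<Sum>j\<in>A. ((if j = i then a else 0) + c j) * \<theta> j)"
      by (rule sum.cong) (auto simp: distrib_right)
    finally show ?case by (intro exI[of _ "\<lambda>j. (if j = i then a else 0) + c j"])
  qed
next
  assume "\<exists>c. p = (\<Sum>i\<in>A. c i * \<theta> i)"
  then show "p \<in> ideal.span (\<theta> ` A)"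
    by (auto intro: ideal.span_sum ideal.span_scale ideal.span_base)
qed

lemma homog_in_span_image:
  fixes \<theta> :: "'i \<Rightarrow> 'k::finite mpoly"
  assumes "finite A" "\<And>i. i \<in> A \<Longrightarrow> \<theta> i \<in> homog_part (d i)" "p \<in> homog_part m"
    and "p \<in> ideal.span (\<theta> ` A)"
  obtains c where "\<And>i. c i \<in> homog_part (m - d i)" "p = (\<Sum>i\<in>A. c i * \<theta> i)"
proof -
  obtain c where c: "p = (\<Sum>i\<in>A. c i * \<theta> i)"
    using assms in_span_image_iff by metis
  have "p = homog_comp m p" using assms(3) by (simp add: homog_comp_of_homog)
  also have "\<dots> = (\<Sum>i\<in>A. homog_comp (m - d i) (c i) * \<theta> i)"
    unfolding c homog_comp_sum using assms(2) by (intro sum.cong) (auto simp: homog_comp_mult_homog)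
  finally show ?thesis using homog_comp_homog by (intro that[of "\<lambda>i. homog_comp (m - d i) (c i)"]) auto
qed

text \<open>For a proper homogeneous ideal this means being primary to the irrelevant ideal.\<close>

definition primary :: "'k::finite mpoly set \<Rightarrow> bool" where
  "primary I \<longleftrightarrow> (\<exists>K. \<forall>k\<ge>K. homog_part (int k) \<subseteq> I)"

text \<open>Pigeonhole: a monomial of degree at least \<open>CARD('k) * K\<close> has an exponent of
  at least \<open>K\<close>, and \<open>K\<close> is chosen so large that every
  \<open>X j ^ K\<close> lies in \<open>I\<close>.\<close>

lemma primary_of_X_powers:
  fixes I :: "'k::finite mpoly set"
  assumes I: "ideal.subspace I" and "\<And>j. \<exists>k. X j ^ k \<in> I"
  shows "primary I"
proof -
  obtain e where e: "\<And>j. X j ^ e j \<in> I" using assms(2) by metis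
  define K where "K = (\<Sum>j\<in>UNIV. e j)"
  have "e j \<le> K" for j unfolding K_def by (rule member_le_sum) auto
  then have XK: "X j ^ K \<in> I" for j
    using subspace_mult_left[OF I e[of j], of "X j ^ (K - e j)"] by (simp flip: power_add)
  have mono: "Poly_Mapping.single \<mu> c \<in> I" if "mdeg \<mu> \<ge> CARD('k) * K" for \<mu> and c :: complex
  proof -
    have "\<exists>j. Poly_Mapping.lookup \<mu> j \<ge> K"
    proof (rule ccontr)
      assume "\<not> ?thesis"
      then have "mdeg \<mu> < (\<Sum>j\<in>(UNIV::'k set). K)"
        unfolding mdeg_def by (intro sum_strict_mono) (auto simp: not_le)
      then show False using that by simp
    qed
    then obtain j where j: "Poly_Mapping.lookup \<mu> j \<ge> K" by blast
    have "\<mu> - Poly_Mapping.single j K + Poly_Mapping.single j K = \<mu>"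
      using j by (intro poly_mapping_eqI) (auto simp: lookup_add lookup_minus lookup_single when_def)
    then have "Poly_Mapping.single \<mu> c = Poly_Mapping.single (\<mu> - Poly_Mapping.single j K) c * X j ^ K"
      by (simp add: X_power mult_single)
    then show ?thesis using subspace_mult_left[OF I XK[of j]] by simp
  qed
  have "p \<in> I" if "k \<ge> CARD('k) * K" "p \<in> homog_part (int k)" for k p
  proof -
    have "(\<Sum>\<mu>\<in>Poly_Mapping.keys p. Poly_Mapping.single \<mu> (Poly_Mapping.lookup p \<mu>)) \<in> I"
      using that by (intro ideal.subspace_sum[OF I] mono) (auto simp: homog_part_iff in_keys_iff)
    then show ?thesis by (simp add: poly_as_sum)
  qed
  then show ?thesis unfolding primary_def by blast
qed

lemma zeros_of_span: "(\<forall>p\<in>ideal.span B. poly_eval p v = 0) \<longleftrightarrow> (\<forall>p\<in>B. poly_eval p v = 0)"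
proof
  assume B: "\<forall>p\<in>B. poly_eval p v = 0"
  have "poly_eval p v = 0" if "p \<in> ideal.span B" for p
    using that by (induction rule: ideal.span_induct_alt) (use B in auto)
  then show "\<forall>p\<in>ideal.span B. poly_eval p v = 0" by blast
qed (auto intro: ideal.span_base)

lemma power_in_span_of_zeros:
  fixes B :: "'k::finite mpoly set"
  assumes "\<And>v. (\<And>p. p \<in> B \<Longrightarrow> poly_eval p v = 0) \<Longrightarrow> poly_eval h v = 0"
  shows "\<exists>k. h ^ k \<in> ideal.span B"
  by (rule nullstellensatz[OF ideal.subspace_span]) (use assms zeros_of_span[of B] in blast)

lemma primary_of_no_zeros:
  fixes B :: "'k::finite mpoly set"
  assumes "\<And>v. (\<And>p. p \<in> B \<Longrightarrow> poly_eval p v = 0) \<Longrightarrow> v = 0"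
  shows "primary (ideal.span B)"
proof (rule primary_of_X_powers[OF ideal.subspace_span])
  fix j show "\<exists>k. X j ^ k \<in> ideal.span B"
    by (rule power_in_span_of_zeros) (use assms in \<open>simp only: poly_eval_X\<close>, fastforce)
qed

section \<open>Regular systems of parameters\<close>

lemma homog_comp_in_span:
  assumes B: "\<And>p. p \<in> B \<Longrightarrow> \<exists>d. p \<in> homog_part d" and "x \<in> ideal.span B"
  shows "homog_comp m x \<in> ideal.span B"
  using assms(2)
proof (induction rule: ideal.span_induct_alt)
  case base
  show ?case by (simp add: ideal.span_zero)
next
  case (step c x y)
  then obtain d where "x \<in> homog_part d" using B by blast
  then have "homog_comp m (c * x + y) = homog_comp (m - d) c * x + homog_comp m y" by (simp add: homog_comp_add homog_comp_mult_homog)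
  then show ?case using step by (auto intro: ideal.span_add ideal.span_scale ideal.span_base)
qed

text \<open>The coefficient of \<open>u\<close> can be taken homogeneous, because homogeneous
  generators allow passing to a single component. The later descents on the degree depend on
  this.\<close>

lemma homog_breakdown:
  assumes B: "\<And>p. p \<in> B \<Longrightarrow> \<exists>d. p \<in> homog_part d" and u: "u \<in> homog_part e"
    and p: "p \<in> homog_part m" "p \<in> ideal.span (insert u B)"
  obtains c where "c \<in> homog_part (m - e)" "p - c * u \<in> ideal.span B"
proof -
  obtain k where "p - k * u \<in> ideal.span B" using p(2) by (auto simp: ideal.span_breakdown_eq)
  then have "homog_comp m (p - k * u) \<in> ideal.span B" by (rule homog_comp_in_span[rotated]) (rule B)
  then have "p - homog_comp (m - e) k * u \<in> ideal.span B"
    using p(1) u by (simp add: homog_comp_diff homog_comp_mult_homog homog_comp_of_homog)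
  then show ?thesis using homog_comp_homog that by blast
qed

lemma homog_in_insert_span:
  assumes "p - c * u \<in> ideal.span B"
  shows "p \<in> ideal.span (insert u B)"
  using assms by (auto simp: ideal.span_breakdown_eq)

definition regular :: "('i \<Rightarrow> 'k::finite mpoly) \<Rightarrow> bool" where
  "regular \<theta> \<longleftrightarrow> (\<forall>A i m b. i \<notin> A \<longrightarrow> b \<in> homog_part m \<longrightarrow>
     \<theta> i * b \<in> ideal.span (\<theta> ` A) \<longrightarrow> b \<in> ideal.span (\<theta> ` A))"

lemma regularD:
  "regular \<theta> \<Longrightarrow> i \<notin> A \<Longrightarrow> b \<in> homog_part m \<Longrightarrow> \<theta> i * b \<in> ideal.span (\<theta> ` A) \<Longrightarrow> b \<in> ideal.span (\<theta> ` A)"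
  unfolding regular_def by blast

lemma lookup_X_mult:
  "Poly_Mapping.lookup (X i * b) (\<mu> + Poly_Mapping.single i 1) = Poly_Mapping.lookup b \<mu>"
proof (induction b rule: poly_induct)
  case (single \<nu> c)
  have "Poly_Mapping.single i 1 + \<nu> = \<mu> + Poly_Mapping.single i 1 \<longleftrightarrow> \<nu> = \<mu>"
    by (metis add.commute add_right_cancel)
  then show ?case by (simp add: X_def mult_single lookup_single)
qed (simp add: lookup_add distrib_left)

lemma in_span_X_iff:
  "p \<in> ideal.span (X ` A) \<longleftrightarrow> (\<forall>\<mu>\<in>Poly_Mapping.keys p. \<exists>j\<in>A. Poly_Mapping.lookup \<mu> j \<noteq> 0)"
proof
  assume "p \<in> ideal.span (X ` A)"
  then show "\<forall>\<mu>\<in>Poly_Mapping.keys p. \<exists>j\<in>A. Poly_Mapping.lookup \<mu> j \<noteq> 0"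
  proof (induction rule: ideal.span_induct_alt)
    case (step c x y)
    then obtain j where j: "j \<in> A" "x = X j" by blast
    have "\<exists>j\<in>A. Poly_Mapping.lookup \<mu> j \<noteq> 0" if "\<mu> \<in> Poly_Mapping.keys (c * x)" for \<mu>
    proof -
      have "\<mu> \<in> {a + b |a b. a \<in> Poly_Mapping.keys c \<and> b \<in> Poly_Mapping.keys (X j)}"
        using keys_mult[of c "X j"] that j(2) by blast
      then have "Poly_Mapping.lookup \<mu> j \<noteq> 0" by (auto simp: X_def lookup_add)
      then show ?thesis using j(1) by blast
    qed
    then show ?case using step keys_add[of "c * x" y] by blast
  qed auto
next
  assume r: "\<forall>\<mu>\<in>Poly_Mapping.keys p. \<exists>j\<in>A. Poly_Mapping.lookup \<mu> j \<noteq> 0"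
  have "Poly_Mapping.single \<mu> (Poly_Mapping.lookup p \<mu>) \<in> ideal.span (X ` A)"
    if \<mu>: "\<mu> \<in> Poly_Mapping.keys p" for \<mu>
  proof -
    obtain j where j: "j \<in> A" "Poly_Mapping.lookup \<mu> j \<noteq> 0" using r \<mu> by blast
    have eq: "Poly_Mapping.single \<mu> (Poly_Mapping.lookup p \<mu>)
       = Poly_Mapping.single (\<mu> - Poly_Mapping.single j 1) (Poly_Mapping.lookup p \<mu>) * X j"
      unfolding X_def mult_single by (simp only: mono_minus_single[OF j(2)] mult_1_right)
    show ?thesis unfolding eq using j(1) by (intro ideal.span_scale ideal.span_base) simp
  qed
  then have "(\<Sum>\<mu>\<in>Poly_Mapping.keys p. Poly_Mapping.single \<mu> (Poly_Mapping.lookup p \<mu>)) \<in> ideal.span (X ` A)"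
    by (rule ideal.span_sum)
  then show "p \<in> ideal.span (X ` A)" by (simp add: poly_as_sum)
qed

lemma regular_X: "regular (X :: 'k::finite \<Rightarrow> 'k mpoly)"
  unfolding regular_def
proof (intro allI impI)
  fix A and i :: 'k and b
  assume i: "i \<notin> A" and "X i * b \<in> ideal.span (X ` A)"
  then have *: "\<forall>\<mu>\<in>Poly_Mapping.keys (X i * b). \<exists>j\<in>A. Poly_Mapping.lookup \<mu> j \<noteq> 0"
    by (simp add: in_span_X_iff)
  have "\<exists>j\<in>A. Poly_Mapping.lookup \<mu> j \<noteq> 0" if "\<mu> \<in> Poly_Mapping.keys b" for \<mu>
  proof -
    have "\<mu> + Poly_Mapping.single i 1 \<in> Poly_Mapping.keys (X i * b)"
      using that lookup_X_mult[of i b \<mu>] by (simp add: in_keys_iff)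
    then obtain j where "j \<in> A" "Poly_Mapping.lookup (\<mu> + Poly_Mapping.single i 1) j \<noteq> 0" using * by blast
    then show ?thesis using i by (auto simp: lookup_add lookup_single when_def split: if_splits)
  qed
  then show "b \<in> ideal.span (X ` A)" by (simp add: in_span_X_iff)
qed

text \<open>Downward induction on \<open>A\<close>. For \<open>A = - {r}\<close>, a power of
  \<open>\<theta> r\<close> is a multiple of \<open>u\<close> modulo the ideal of \<open>A\<close>,
  and powers of \<open>\<theta> r\<close> can be cancelled. For smaller \<open>A\<close>, adjoin
  some \<open>\<theta> j\<close>: then \<open>b = c * \<theta> j\<close> modulo the ideal of
  \<open>A\<close>, cancelling \<open>\<theta> j\<close> puts \<open>u * c\<close> into that ideal,
  and \<open>c\<close> has smaller degree than \<open>b\<close>, so an inner induction on the degree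
  finishes.\<close>

lemma regular_exchange_aux:
  fixes \<theta> :: "'i::finite \<Rightarrow> 'k::finite mpoly"
  assumes reg: "regular \<theta>" and hom: "\<And>i. \<theta> i \<in> homog_part (d i)" and d: "\<And>i. d i > 0"
    and u: "u \<in> homog_part e"
    and pow: "\<theta> r ^ K \<in> ideal.span (insert u (\<theta> ` (- {r})))"
    and A: "r \<notin> A" and b: "b \<in> homog_part m" and ub: "u * b \<in> ideal.span (\<theta> ` A)"
  shows "b \<in> ideal.span (\<theta> ` A)"
  using A b ub
proof (induction "card (- {r} - A)" arbitrary: A b m)
  case 0
  then have A: "A = - {r}" by auto
  obtain w where w: "\<theta> r ^ K - w * u \<in> ideal.span (\<theta> ` A)"
    using pow by (auto simp: ideal.span_breakdown_eq A)
  have "\<theta> r ^ K * b = b * (\<theta> r ^ K - w * u) + w * (u * b)" by (simp add: algebra_simps)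
  also have "\<dots> \<in> ideal.span (\<theta> ` A)"
    by (intro ideal.span_add ideal.span_scale[OF w] ideal.span_scale[OF 0(4)])
  finally have "\<theta> r ^ K * b \<in> ideal.span (\<theta> ` A)" .
  then show ?case
  proof (induction K)
    case (Suc K)
    have *: "\<theta> r ^ K * b \<in> homog_part (int K * d r + m)" by (intro homog_mult homog_power hom 0(3))
    have "\<theta> r * (\<theta> r ^ K * b) \<in> ideal.span (\<theta> ` A)" using Suc(2) by (simp add: mult.assoc)
    then have "\<theta> r ^ K * b \<in> ideal.span (\<theta> ` A)" by (rule regularD[OF reg 0(2) *])
    then show ?case by (rule Suc.IH)
  qed simp
next
  case (Suc n)
  then obtain j where j: "j \<noteq> r" "j \<notin> A"
    by (metis Compl_iff DiffE Zero_not_Suc all_not_in_conv card.empty insertI1)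
  have "- {r} - A = insert j (- {r} - insert j A)" using j by auto
  then have "n = card (- {r} - insert j A)" using Suc(2)
    by (metis DiffE card_insert_disjoint diff_Suc_1 finite insertI1)
  note IH = Suc(1)[OF this]
  show ?case
    using Suc(4,5)
  proof (induction "nat (m + 1)" arbitrary: m b rule: less_induct)
    case less
    show ?case
    proof (cases "m < 0")
      case True
      then show ?thesis using less(2) homog_neg ideal.span_zero by metis
    next
      case False
      have "u * b \<in> ideal.span (\<theta> ` insert j A)"
        using less(3) ideal.span_mono[of "\<theta> ` A" "\<theta> ` insert j A"] by blast
      then have "b \<in> ideal.span (insert (\<theta> j) (\<theta> ` A))"
        using IH[of b m] less(2) Suc(3) j by auto
      then obtain c where c: "c \<in> homog_part (m - d j)" "b - c * \<theta> j \<in> ideal.span (\<theta> ` A)"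
        using homog_breakdown[of "\<theta> ` A" "\<theta> j" "d j" b m] hom less(2) by blast
      have "\<theta> j * (u * c) = u * b - u * (b - c * \<theta> j)" by (simp add: algebra_simps)
      also have "\<dots> \<in> ideal.span (\<theta> ` A)" by (intro ideal.span_diff less(3) ideal.span_scale c(2))
      finally have "u * c \<in> ideal.span (\<theta> ` A)"
        using regularD[OF reg j(2) homog_mult[OF u c(1)]] by blast
      then have "c \<in> ideal.span (\<theta> ` A)" using less(1)[OF _ c(1)] d[of j] False by auto
      then have "\<theta> j * c + (b - c * \<theta> j) \<in> ideal.span (\<theta> ` A)"
        by (intro ideal.span_add ideal.span_scale c(2))
      then show ?thesis by (simp add: mult.commute)
    qed
  qed
qed

text \<open>Beyond \<open>regular_exchange_aux\<close>, the new case has \<open>u\<close> among the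
  generators and some \<open>\<theta> i\<close> as multiplier. From
  \<open>\<theta> i * b = c * u\<close> modulo the other generators,
  \<open>regular_exchange_aux\<close> with \<open>\<theta> i\<close> adjoined makes \<open>c\<close>
  a multiple of \<open>\<theta> i\<close>, and then \<open>\<theta> i\<close> cancels.\<close>

lemma regular_exchange:
  fixes \<theta> :: "'i::finite \<Rightarrow> 'k::finite mpoly"
  assumes reg: "regular \<theta>" and hom: "\<And>i. \<theta> i \<in> homog_part (d i)" and d: "\<And>i. d i > 0"
    and u: "u \<in> homog_part e"
    and pow: "\<theta> r ^ K \<in> ideal.span (insert u (\<theta> ` (- {r})))"
  shows "regular (\<theta>(r := u))"
  unfolding regular_def
proof (intro allI impI)
  fix A i m b
  assume i: "i \<notin> A" and b: "b \<in> homog_part m"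
    and ib: "(\<theta>(r := u)) i * b \<in> ideal.span ((\<theta>(r := u)) ` A)"
  note nzd = regular_exchange_aux[OF reg hom d u pow]
  show "b \<in> ideal.span ((\<theta>(r := u)) ` A)"
  proof (cases "r \<in> A")
    case False
    then have A: "(\<theta>(r := u)) ` A = \<theta> ` A" by auto
    show ?thesis
    proof (cases "i = r")
      case True
      then show ?thesis using nzd[OF False b] ib A by simp
    next
      case neq: False
      then show ?thesis using regularD[OF reg i b] ib A by simp
    qed
  next
    case True
    define B where "B = A - {r}"
    have A: "(\<theta>(r := u)) ` A = insert u (\<theta> ` B)" using True by (auto simp: B_def)
    have "i \<noteq> r" "i \<notin> B" "r \<notin> B" using i True by (auto simp: B_def)
    have homB: "\<And>p. p \<in> \<theta> ` B \<Longrightarrow> \<exists>d. p \<in> homog_part d" using hom by blast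
    have "\<theta> i * b \<in> homog_part (d i + m)" by (rule homog_mult[OF hom b])
    moreover have "\<theta> i * b \<in> ideal.span (insert u (\<theta> ` B))" using ib \<open>i \<noteq> r\<close> A by simp
    ultimately obtain c where c: "c \<in> homog_part (d i + m - e)" "\<theta> i * b - c * u \<in> ideal.span (\<theta> ` B)"
      using homog_breakdown[OF homB u] by metis
    have "u * c - b * \<theta> i = - (\<theta> i * b - c * u)" by (simp add: algebra_simps)
    also have "\<dots> \<in> ideal.span (\<theta> ` B)" by (rule ideal.span_neg[OF c(2)])
    finally have "u * c \<in> ideal.span (\<theta> ` insert i B)" by (simp add: homog_in_insert_span)
    then have "c \<in> ideal.span (insert (\<theta> i) (\<theta> ` B))"
      using nzd[of "insert i B", OF _ c(1)] \<open>r \<notin> B\<close> \<open>i \<noteq> r\<close> by simp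
    then obtain q where q: "q \<in> homog_part (d i + m - e - d i)" "c - q * \<theta> i \<in> ideal.span (\<theta> ` B)"
      using homog_breakdown[OF homB hom[of i] c(1)] by metis
    have "\<theta> i * (b - q * u) = (\<theta> i * b - c * u) + u * (c - q * \<theta> i)" by (simp add: algebra_simps)
    also have "\<dots> \<in> ideal.span (\<theta> ` B)" by (intro ideal.span_add ideal.span_scale c q)
    finally have *: "\<theta> i * (b - q * u) \<in> ideal.span (\<theta> ` B)" .
    have "q * u \<in> homog_part m" using homog_mult[OF q(1) u] by simp
    then have "b - q * u \<in> homog_part m" by (rule homog_diff[OF b])
    then have "b - q * u \<in> ideal.span (\<theta> ` B)" using regularD[OF reg \<open>i \<notin> B\<close> _ *] by blast
    then show ?thesis unfolding A by (rule homog_in_insert_span)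
  qed
qed

text \<open>A lower bound for the degrees in which the quotient by the ideal of
  \<open>\<theta>\<close> has socle elements; nothing is said about the socle in degree
  \<open>s\<close> or above.\<close>

definition socle_from :: "int \<Rightarrow> ('i \<Rightarrow> 'k::finite mpoly) \<Rightarrow> bool" where
  "socle_from s \<theta> \<longleftrightarrow> (\<forall>k q. k < s \<longrightarrow> q \<in> homog_part k \<longrightarrow>
     (\<forall>j. X j * q \<in> ideal.span (range \<theta>)) \<longrightarrow> q \<in> ideal.span (range \<theta>))"

text \<open>For a socle element \<open>q\<close> of the new quotient write
  \<open>X j * q = v j * u\<close> modulo \<open>J\<close>. Cancelling \<open>u\<close> gives
  \<open>X j * v r = X r * v j\<close>, so \<open>v r\<close> is a socle element of the old
  quotient, of degree \<open>e - 1\<close> below that of \<open>q\<close>. Once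
  \<open>v r = w * X r\<close>, cancelling \<open>X r\<close> yields \<open>q = w * u\<close> modulo
  \<open>J\<close>.\<close>

lemma socle_exchange:
  fixes \<theta> :: "'k::finite \<Rightarrow> 'k mpoly"
  assumes reg: "regular \<theta>" and reg': "regular (\<theta>(r := u))"
    and hom: "\<And>i. \<theta> i \<in> homog_part (d i)" and u: "u \<in> homog_part e"
    and r: "\<theta> r = X r" and soc: "socle_from s \<theta>"
  shows "socle_from (s + e - 1) (\<theta>(r := u))"
  unfolding socle_from_def
proof (intro allI impI)
  fix k q
  assume k: "k < s + e - 1" and q: "q \<in> homog_part k"
    and Xq: "\<forall>j. X j * q \<in> ideal.span (range (\<theta>(r := u)))"
  define J where "J = ideal.span (\<theta> ` (- {r}))"
  have range\<theta>: "range \<theta> = insert (X r) (\<theta> ` (- {r}))" unfolding r[symmetric] by auto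
  have range\<theta>': "range (\<theta>(r := u)) = insert u (\<theta> ` (- {r}))" by auto
  have im: "(\<theta>(r := u)) ` (- {r}) = \<theta> ` (- {r})" by auto
  have homB: "\<And>p. p \<in> \<theta> ` (- {r}) \<Longrightarrow> \<exists>d. p \<in> homog_part d" using hom by blast
  have add: "x + y \<in> J" if "x \<in> J" "y \<in> J" for x y using that unfolding J_def by (rule ideal.span_add)
  have scale: "c * x \<in> J" if "x \<in> J" for c x using that unfolding J_def by (rule ideal.span_scale)
  have nzd_u: "b \<in> J" if "b \<in> homog_part m" "u * b \<in> J" for b m
    using regularD[OF reg', of r "- {r}" b m] that by (simp add: J_def im)
  have nzd_X: "b \<in> J" if "b \<in> homog_part m" "X r * b \<in> J" for b m
    using regularD[OF reg, of r "- {r}" b m] that r by (simp add: J_def)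
  have "\<exists>v. v \<in> homog_part (1 + k - e) \<and> X j * q - v * u \<in> J" for j
    using homog_breakdown[OF homB u homog_mult[OF homog_X q]] Xq unfolding range\<theta>' J_def by metis
  then obtain v where v: "\<And>j. v j \<in> homog_part (1 + k - e)" "\<And>j. X j * q - v j * u \<in> J" by metis
  have "X j * v r \<in> ideal.span (range \<theta>)" for j
  proof -
    have "u * (X j * v r - X r * v j) = X r * (X j * q - v j * u) + (- X j) * (X r * q - v r * u)"
      by (simp add: algebra_simps)
    also have "\<dots> \<in> J" by (intro add scale v)
    finally have "u * (X j * v r - X r * v j) \<in> J" .
    moreover have "X j * v r - X r * v j \<in> homog_part (1 + (1 + k - e))"
      by (intro homog_diff homog_mult homog_X v)
    ultimately have "X j * v r - v j * X r \<in> J" using nzd_u by (simp add: mult.commute)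
    then show ?thesis unfolding range\<theta> J_def by (rule homog_in_insert_span)
  qed
  moreover have "1 + k - e < s" using k by simp
  ultimately have "v r \<in> ideal.span (range \<theta>)"
    using soc v(1)[of r] unfolding socle_from_def by blast
  then obtain w where w: "w \<in> homog_part (1 + k - e - 1)" "v r - w * X r \<in> J"
    using homog_breakdown[OF homB homog_X v(1)] unfolding range\<theta> J_def by metis
  have "X r * (q - w * u) = (X r * q - v r * u) + u * (v r - w * X r)" by (simp add: algebra_simps)
  also have "\<dots> \<in> J" by (intro add scale v w)
  finally have *: "X r * (q - w * u) \<in> J" .
  have "w * u \<in> homog_part k" using homog_mult[OF w(1) u] by simp
  then have "q - w * u \<in> J" using nzd_X[OF homog_diff[OF q]] * by blast
  then show "q \<in> ideal.span (range (\<theta>(r := u)))"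
    unfolding range\<theta>' J_def by (rule homog_in_insert_span)
qed

text \<open>
  On the zero set \<open>Z\<close> of the \<open>\<theta> i\<close>, \<open>i \<noteq> r\<close>, every form of large degree is a power of \<open>\<theta> r\<close> times a form
  of a fixed degree. Hence \<open>F\<close> and \<open>G\<close> satisfy a binary form relation on \<open>Z\<close>.
\<close>

lemma generic_pair:
  fixes \<theta> :: "'i::finite \<Rightarrow> 'k::finite mpoly"
  assumes hom: "\<And>i. \<theta> i \<in> homog_part (d i)" and dr: "d r = 1" and prim: "primary (ideal.span (range \<theta>))"
    and F: "F \<in> homog_part (int e)" and G: "G \<in> homog_part (int e)" and "e > 0"
  shows "\<exists>t. \<forall>z. (\<forall>i. i \<noteq> r \<longrightarrow> poly_eval (\<theta> i) z = 0) \<longrightarrow> poly_eval F z + t * poly_eval G z = 0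
     \<longrightarrow> poly_eval F z = 0 \<and> poly_eval G z = 0"
proof -
  obtain K where K: "\<And>k. k \<ge> K \<Longrightarrow> homog_part (int k) \<subseteq> ideal.span (range \<theta>)"
    using prim unfolding primary_def by blast
  define Z where "Z = {z. \<forall>i. i \<noteq> r \<longrightarrow> poly_eval (\<theta> i) z = 0}"
  have range\<theta>: "range \<theta> = insert (\<theta> r) (\<theta> ` (- {r}))" by auto
  have homB: "\<And>p. p \<in> \<theta> ` (- {r}) \<Longrightarrow> \<exists>d. p \<in> homog_part d" using hom by blast
  have red: "\<exists>w\<in>homog_part (int K). \<forall>z\<in>Z. poly_eval p z = poly_eval (\<theta> r) z ^ n * poly_eval w z"
    if "p \<in> homog_part (int (K + n))" for n p
    using that
  proof (induction n arbitrary: p)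
    case 0
    then show ?case by auto
  next
    case (Suc n)
    have "p \<in> ideal.span (insert (\<theta> r) (\<theta> ` (- {r})))"
      using K[of "K + Suc n"] Suc(2) range\<theta> by auto
    then obtain c where c: "c \<in> homog_part (int (K + Suc n) - 1)" "p - c * \<theta> r \<in> ideal.span (\<theta> ` (- {r}))"
      using homog_breakdown[OF homB hom[of r] Suc(2)] dr by metis
    have "c \<in> homog_part (int (K + n))" using c(1) by simp
    then obtain w where w: "w \<in> homog_part (int K)"
      "\<forall>z\<in>Z. poly_eval c z = poly_eval (\<theta> r) z ^ n * poly_eval w z"
      using Suc.IH by blast
    have "poly_eval p z = poly_eval c z * poly_eval (\<theta> r) z" if "z \<in> Z" for z
    proof -
      have "poly_eval (p - c * \<theta> r) z = 0"
        using zeros_of_span[of "\<theta> ` (- {r})" z] c(2) that by (auto simp: Z_def)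
      then show ?thesis by simp
    qed
    then show ?case using w by (intro bexI[of _ w]) auto
  qed
  let ?M = "{\<mu> :: 'k \<Rightarrow>\<^sub>0 nat. mdeg \<mu> \<le> K}"
  \<comment> \<open>The summand \<open>card ?M\<close> makes the \<open>k + 1\<close> products
    \<open>F ^ i * G ^ (k - i)\<close> more numerous than the monomials of degree at most
    \<open>K\<close>; the summand \<open>K\<close> ensures \<open>k * e \<ge> K\<close>.\<close>
  define k where "k = K + card ?M"
  define n where "n = k * e - K"
  have "k * e \<ge> K" using \<open>e > 0\<close> unfolding k_def by (cases e) auto
  then have kn: "k * e = K + n" by (simp add: n_def)
  have "\<exists>w\<in>homog_part (int K). \<forall>z\<in>Z. poly_eval (F ^ i * G ^ (k - i)) z = poly_eval (\<theta> r) z ^ n * poly_eval w z"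
    if "i \<in> {..k}" for i
  proof (rule red)
    have "F ^ i * G ^ (k - i) \<in> homog_part (int i * int e + int (k - i) * int e)"
      by (intro homog_mult homog_power F G)
    also have "int i * int e + int (k - i) * int e = int (K + n)"
      using that by (simp add: kn[symmetric] of_nat_diff algebra_simps)
    finally show "F ^ i * G ^ (k - i) \<in> homog_part (int (K + n))" .
  qed
  then obtain w where w: "\<And>i. i \<in> {..k} \<Longrightarrow> w i \<in> homog_part (int K)"
    "\<And>i z. i \<in> {..k} \<Longrightarrow> z \<in> Z \<Longrightarrow> poly_eval (F ^ i * G ^ (k - i)) z = poly_eval (\<theta> r) z ^ n * poly_eval (w i) z"
    by metis
  have "Poly_Mapping.keys (w i) \<subseteq> ?M" if "i \<in> {..k}" for i
    using w(1)[OF that] by (auto simp: homog_part_iff in_keys_iff)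
  then have "\<exists>\<alpha>. (\<exists>i\<in>{..k}. \<alpha> i \<noteq> 0) \<and> (\<Sum>i\<in>{..k}. Cst (\<alpha> i) * w i) = 0"
    by (intro poly_nontrivial_relation[OF finite_mdeg_le[of K]]) (simp_all add: k_def)
  then obtain \<alpha> i0 where \<alpha>: "i0 \<in> {..k}" "\<alpha> i0 \<noteq> 0" "(\<Sum>i\<in>{..k}. Cst (\<alpha> i) * w i) = 0" by blast
  \<comment> \<open>\<open>R\<close> is the dehomogenized relation. At a point of \<open>Z\<close>
    with \<open>F = t * G\<close> the relation says that \<open>poly R t * G ^ k\<close> vanishes,
    so a \<open>t\<close> that is not a root forces \<open>G = 0\<close>. The lemma's parameter is
    \<open>- t\<close>.\<close>
  define R where "R = (\<Sum>i\<le>k. monom (\<alpha> i) i)"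
  have "coeff R i0 = \<alpha> i0" using \<alpha>(1) by (simp add: R_def coeff_sum sum.delta)
  then have "R \<noteq> 0" using \<alpha>(2) by auto
  then obtain t where t: "poly R t \<noteq> 0" by (metis poly_all_0_iff_0)
  have "poly_eval F z = 0 \<and> poly_eval G z = 0"
    if "z \<in> Z" "poly_eval F z + (- t) * poly_eval G z = 0" for z
  proof -
    have F: "poly_eval F z = t * poly_eval G z" using that(2) by (simp add: algebra_simps)
    have "poly R t * poly_eval G z ^ k = (\<Sum>i\<le>k. \<alpha> i * (t ^ i * poly_eval G z ^ k))"
      by (simp add: R_def poly_sum poly_monom sum_distrib_right mult.assoc)
    also have "\<dots> = (\<Sum>i\<le>k. \<alpha> i * poly_eval (F ^ i * G ^ (k - i)) z)"
      by (intro sum.cong) (auto simp: F power_mult_distrib mult.assoc simp flip: power_add)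
    also have "\<dots> = poly_eval (\<theta> r) z ^ n * poly_eval (\<Sum>i\<le>k. Cst (\<alpha> i) * w i) z"
      using that(1) w(2) by (simp add: sum_distrib_left mult.left_commute)
    also have "\<dots> = 0" using \<alpha>(3) by simp
    finally have "poly_eval G z = 0" using t by simp
    then show ?thesis using F by simp
  qed
  then show ?thesis unfolding Z_def by blast
qed

text \<open>One form is added at a time: by \<open>generic_pair\<close> the new combination vanishes
  on the zero set only where the old combination and the added form both vanish. The same
  \<open>\<theta>\<close> serves throughout.\<close>

lemma generic_combination:
  fixes \<theta> :: "'i::finite \<Rightarrow> 'k::finite mpoly" and F :: "'j::finite \<Rightarrow> 'k mpoly"
  assumes hom: "\<And>i. \<theta> i \<in> homog_part (d i)" and dr: "d r = 1" and prim: "primary (ideal.span (range \<theta>))"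
    and F: "\<And>j. F j \<in> homog_part (int e)" and "e > 0"
  shows "\<exists>c. \<forall>z. (\<forall>i. i \<noteq> r \<longrightarrow> poly_eval (\<theta> i) z = 0)
     \<longrightarrow> poly_eval (\<Sum>j\<in>UNIV. Cst (c j) * F j) z = 0 \<longrightarrow> (\<forall>j. poly_eval (F j) z = 0)"
proof -
  have "\<exists>c. \<forall>z. (\<forall>i. i \<noteq> r \<longrightarrow> poly_eval (\<theta> i) z = 0)
     \<longrightarrow> poly_eval (\<Sum>j\<in>B. Cst (c j) * F j) z = 0 \<longrightarrow> (\<forall>j\<in>B. poly_eval (F j) z = 0)"
    if "finite B" for B
    using that
  proof induction
    case (insert j B)
    then obtain c where c: "\<And>z. (\<forall>i. i \<noteq> r \<longrightarrow> poly_eval (\<theta> i) z = 0)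
       \<Longrightarrow> poly_eval (\<Sum>j\<in>B. Cst (c j) * F j) z = 0 \<Longrightarrow> (\<forall>j\<in>B. poly_eval (F j) z = 0)" by blast
    have "(\<Sum>j\<in>B. Cst (c j) * F j) \<in> homog_part (int e)" by (intro homog_sum homog_Cst_mult F)
    from generic_pair[OF hom dr prim this F[of j] \<open>e > 0\<close>]
    obtain t where t: "\<And>z. (\<forall>i. i \<noteq> r \<longrightarrow> poly_eval (\<theta> i) z = 0) \<Longrightarrow>
       poly_eval (\<Sum>j\<in>B. Cst (c j) * F j) z + t * poly_eval (F j) z = 0
       \<Longrightarrow> poly_eval (\<Sum>j\<in>B. Cst (c j) * F j) z = 0 \<and> poly_eval (F j) z = 0" by blast
    have "(\<Sum>i\<in>insert j B. Cst ((c(j := t)) i) * F i) = Cst t * F j + (\<Sum>j\<in>B. Cst (c j) * F j)"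
      using insert(1,2) by (simp add: sum.insert) (rule sum.cong, auto)
    then have eq: "poly_eval (\<Sum>i\<in>insert j B. Cst ((c(j := t)) i) * F i) z
      = poly_eval (\<Sum>j\<in>B. Cst (c j) * F j) z + t * poly_eval (F j) z" for z
      by (simp only: poly_eval_add poly_eval_mult poly_eval_Cst add.commute)
    show ?case
    proof (intro exI allI impI)
      fix z assume z: "\<forall>i. i \<noteq> r \<longrightarrow> poly_eval (\<theta> i) z = 0"
        and "poly_eval (\<Sum>i\<in>insert j B. Cst ((c(j := t)) i) * F i) z = 0"
      then show "\<forall>j\<in>insert j B. poly_eval (F j) z = 0" using t[OF z] c[OF z] unfolding eq by blast
    qed
  qed auto
  from this[of UNIV] show ?thesis by simp
qed

text \<open>Starting from the variables, \<open>X None\<close> is exchanged for \<open>l\<close>,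
  then each \<open>X (Some i)\<close> for a general combination. No nonzero common zero ever
  appears, at the start because of \<open>l_axis\<close>, so the Nullstellensatz gives the power of
  the outgoing variable that \<open>regular_exchange\<close> asks for. The first exchange keeps the
  socle bound 0; every later one adds \<open>d - 1\<close>.\<close>

lemma exists_parameters:
  fixes F :: "'j::finite \<Rightarrow> 'n::finite option mpoly"
  assumes F: "\<And>j. F j \<in> homog_part (int d)" and d: "d > 0" and l: "l \<in> homog_part 1"
    and lF: "\<And>z. poly_eval l z = 0 \<Longrightarrow> (\<And>j. poly_eval (F j) z = 0) \<Longrightarrow> z = 0"
    and l_axis: "poly_eval l (axis None 1) \<noteq> 0"
  obtains C :: "'n \<Rightarrow> 'j \<Rightarrow> complex" where "regular (case_option l (\<lambda>i. \<Sum>j\<in>UNIV. Cst (C i j) * F j))"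
    and "socle_from (int CARD('n) * (int d - 1)) (case_option l (\<lambda>i. \<Sum>j\<in>UNIV. Cst (C i j) * F j))"
proof -
  let ?\<theta> = "\<lambda>B C. case_option l (\<lambda>i. if i \<in> B then \<Sum>j\<in>UNIV. Cst (C i j) * F j else X (Some i))"
  let ?d = "\<lambda>B. case_option 1 (\<lambda>i. if i \<in> B then int d else 1)"
  have hom: "?\<theta> B C i \<in> homog_part (?d B i)" for B C and i :: "'n option"
    by (auto split: option.split intro: l homog_X homog_sum homog_Cst_mult F)
  have posd: "?d B i > 0" for B and i :: "'n option" using d by (auto split: option.split)
  have "\<exists>C. regular (?\<theta> B C) \<and> (\<forall>z. (\<forall>i. poly_eval (?\<theta> B C i) z = 0) \<longrightarrow> z = 0)
     \<and> socle_from (int (card B) * (int d - 1)) (?\<theta> B C)" if "finite B" for B :: "'n set"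
    using that
  proof induction
    case empty
    let ?X = "X :: 'n option \<Rightarrow> 'n option mpoly"
    let ?\<tau> = "?X(None := l)"
    have eq: "?\<theta> {} C = ?\<tau>" for C :: "'n \<Rightarrow> 'j \<Rightarrow> complex" by (auto simp: fun_eq_iff split: option.split)
    have zero: "z = 0" if "\<forall>i. poly_eval (?\<tau> i) z = 0" for z
    proof -
      have "z $ Some i = 0" for i using that[rule_format, of "Some i"] by simp
      then have z: "z = z $ None *s axis None 1"
        by (auto simp: vec_eq_iff axis_def)
      have "poly_eval l (z $ None *s axis None 1) = z $ None * poly_eval l (axis None 1)"
        using poly_eval_homog_scale[of l 1] l by simp
      moreover have "poly_eval l z = 0" using that[rule_format, of None] by simp
      ultimately have "z $ None * poly_eval l (axis None 1) = 0" by (simp flip: z)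
      then have "z $ None = 0" using l_axis by simp
      then show ?thesis using z by simp
    qed
    have "\<exists>K. X None ^ K \<in> ideal.span (insert l (X ` (- {None})))"
    proof (rule power_in_span_of_zeros)
      fix v assume v: "\<And>p. p \<in> insert l (X ` (- {None})) \<Longrightarrow> poly_eval p v = 0"
      have "poly_eval (?\<tau> i) v = 0" for i by (rule v) auto
      then have "v = 0" by (intro zero allI)
      then show "poly_eval (X None) v = 0" by simp
    qed
    then obtain K where K: "X None ^ K \<in> ideal.span (insert l (X ` (- {None})))" by blast
    have "regular ?\<tau>"
      by (rule regular_exchange[OF regular_X _ _ l K, of "\<lambda>_. 1"]) (auto intro: homog_X)
    moreover have "socle_from 0 ?\<tau>"
      unfolding socle_from_def using homog_neg ideal.span_zero by blast
    ultimately show ?case using zero unfolding eq card.empty of_nat_0 mult_zero_left by blast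
  next
    case (insert i B)
    then obtain C where "regular (?\<theta> B C)" "\<forall>z. (\<forall>i. poly_eval (?\<theta> B C i) z = 0) \<longrightarrow> z = 0"
      "socle_from (int (card B) * (int d - 1)) (?\<theta> B C)" by blast
    moreover define \<theta> where "\<theta> = ?\<theta> B C"
    ultimately have reg: "regular \<theta>" and zero: "\<And>z. (\<forall>i. poly_eval (\<theta> i) z = 0) \<Longrightarrow> z = 0"
      and soc: "socle_from (int (card B) * (int d - 1)) \<theta>" by blast+
    define e where "e = ?d B"
    have hom\<theta>: "\<theta> i \<in> homog_part (e i)" for i unfolding \<theta>_def e_def by (rule hom)
    have pose: "e i > 0" for i unfolding e_def by (rule posd)
    have prim: "primary (ideal.span (range \<theta>))"
      by (rule primary_of_no_zeros) (rule zero, blast)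
    have e1: "e (Some i) = 1" using insert by (simp add: e_def)
    obtain c where "\<forall>z. (\<forall>j. j \<noteq> Some i \<longrightarrow> poly_eval (\<theta> j) z = 0)
       \<longrightarrow> poly_eval (\<Sum>j\<in>UNIV. Cst (c j) * F j) z = 0 \<longrightarrow> (\<forall>j. poly_eval (F j) z = 0)"
      by (rule exE[OF generic_combination[where F = F, OF hom\<theta> e1 prim F d]])
    note c = this[rule_format]
    define u where "u = (\<Sum>j\<in>UNIV. Cst (c j) * F j)"
    have u: "u \<in> homog_part (int d)" unfolding u_def by (intro homog_sum homog_Cst_mult F)
    have eq: "?\<theta> (insert i B) (C(i := c)) = \<theta>(Some i := u)"
      using insert(2) by (auto simp: fun_eq_iff u_def \<theta>_def split: option.split)
    have ri: "\<theta> (Some i) = X (Some i)" using insert by (simp add: \<theta>_def)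
    \<comment> \<open>By the choice of \<open>c\<close>, a common zero of the new family annihilates
      every \<open>F j\<close>; it also annihilates \<open>l\<close>, so \<open>lF\<close>
      applies.\<close>
    have zero': "z = 0" if z: "\<And>j. j \<noteq> Some i \<Longrightarrow> poly_eval (\<theta> j) z = 0" "poly_eval u z = 0" for z
    proof (rule lF)
      show "poly_eval l z = 0" using z(1)[of None] by (simp add: \<theta>_def)
      show "poly_eval (F j) z = 0" for j 
        by (rule c) (use z in \<open>auto simp: u_def\<close>)
    qed
    have "\<exists>K. X (Some i) ^ K \<in> ideal.span (insert u (\<theta> ` (- {Some i})))"
    proof (rule power_in_span_of_zeros)
      fix v assume v: "\<And>p. p \<in> insert u (\<theta> ` (- {Some i})) \<Longrightarrow> poly_eval p v = 0"
      have "v = 0" by (rule zero') (blast intro: v)+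
      then show "poly_eval (X (Some i)) v = 0" by simp
    qed
    then obtain K where K: "\<theta> (Some i) ^ K \<in> ideal.span (insert u (\<theta> ` (- {Some i})))"
      unfolding ri by blast
    have reg': "regular (\<theta>(Some i := u))"
      by (rule regular_exchange[OF reg hom\<theta> pose u K])
    have soc': "socle_from (int (card B) * (int d - 1) + int d - 1) (\<theta>(Some i := u))"
      by (rule socle_exchange[OF reg reg' hom\<theta> u ri soc])
    have "int (card (insert i B)) * (int d - 1) = int (card B) * (int d - 1) + int d - 1"
      using insert(1,2) by (simp add: algebra_simps)
    moreover have "z = 0" if all: "\<forall>j. poly_eval ((\<theta>(Some i := u)) j) z = 0" for z
    proof (rule zero')
      show "poly_eval (\<theta> j) z = 0" if "j \<noteq> Some i" for j
        using all[rule_format, of j] that by simp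
      show "poly_eval u z = 0" using all[rule_format, of "Some i"] by simp
    qed
    ultimately show ?case using reg' soc' by (intro exI[of _ "C(i := c)"]) (simp only: eq, blast)
  qed
  from this[of UNIV] obtain C where
    "regular (?\<theta> UNIV C)" "socle_from (int CARD('n) * (int d - 1)) (?\<theta> UNIV C)" by auto
  then show ?thesis by (intro that[of C]) simp_all
qed

section \<open>Koszul syzygies\<close>

definition alternating :: "('i \<Rightarrow> 'i \<Rightarrow> 'a::ab_group_add) \<Rightarrow> bool" where
  "alternating s \<longleftrightarrow> (\<forall>i. s i i = 0) \<and> (\<forall>i j. s i j = - s j i)"

text \<open>Writing \<open>b r\<close> in terms of the other \<open>\<theta> i\<close> and removing
  the matching Koszul relations with \<open>\<theta> r\<close> leaves a syzygy without
  \<open>\<theta> r\<close>. The membership of \<open>b r\<close> is a hypothesis and not derived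
  from regularity, so that one generator that need not be regular can be added.\<close>

lemma koszul_insert:
  fixes \<theta> :: "'i \<Rightarrow> 'k::finite mpoly"
  assumes "finite A" "r \<notin> A" and hom: "\<And>i. i \<in> insert r A \<Longrightarrow> \<theta> i \<in> homog_part d"
    and b: "\<And>i. i \<in> insert r A \<Longrightarrow> b i \<in> homog_part m" and syz: "(\<Sum>i\<in>insert r A. b i * \<theta> i) = 0"
    and br: "b r \<in> ideal.span (\<theta> ` A)"
    and IH: "\<And>b. (\<And>i. i \<in> A \<Longrightarrow> b i \<in> homog_part m) \<Longrightarrow> (\<Sum>i\<in>A. b i * \<theta> i) = 0
       \<Longrightarrow> \<exists>s. alternating s \<and> (\<forall>i\<in>A. b i = (\<Sum>j\<in>A. s i j * \<theta> j))"
  shows "\<exists>s. alternating s \<and> (\<forall>i\<in>insert r A. b i = (\<Sum>j\<in>insert r A. s i j * \<theta> j))"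
proof -
  obtain c where c: "\<And>i. c i \<in> homog_part (m - d)" "b r = (\<Sum>i\<in>A. c i * \<theta> i)"
    using homog_in_span_image[of A \<theta> "\<lambda>_. d" "b r" m] assms(1) hom b br by auto
  define b' where "b' i = b i + c i * \<theta> r" for i
  have "b' i \<in> homog_part m" if "i \<in> A" for i
    unfolding b'_def using homog_mult[OF c(1)[of i] hom[of r]] that by (auto intro: homog_add b)
  moreover have "(\<Sum>i\<in>A. b' i * \<theta> i) = 0"
  proof -
    have "(\<Sum>i\<in>A. b' i * \<theta> i) = (\<Sum>i\<in>A. b i * \<theta> i) + b r * \<theta> r"
      unfolding b'_def c(2) by (simp add: algebra_simps sum.distrib sum_distrib_left)
    also have "\<dots> = 0" using syz assms(1,2) by (simp add: add.commute)
    finally show ?thesis .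
  qed
  ultimately obtain s where s: "alternating s" "\<And>i. i \<in> A \<Longrightarrow> b' i = (\<Sum>j\<in>A. s i j * \<theta> j)"
    using IH by blast
  define s' where "s' i j = (if i = r then (if j = r then 0 else c j) else if j = r then - c i else s i j)" for i j
  have "alternating s'"
    unfolding alternating_def
  proof (intro conjI allI)
    fix i j
    show "s' i i = 0" using s(1) by (simp add: alternating_def s'_def)
    have "s i j = - s j i" using s(1) unfolding alternating_def by blast
    then show "s' i j = - s' j i" by (simp add: s'_def)
  qed
  moreover have "b i = (\<Sum>j\<in>insert r A. s' i j * \<theta> j)" if "i \<in> insert r A" for i
  proof (cases "i = r")
    case True
    have "(\<Sum>j\<in>A. s' r j * \<theta> j) = (\<Sum>j\<in>A. c j * \<theta> j)"
      using assms(2) by (intro sum.cong) (auto simp: s'_def)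
    then show ?thesis using True assms(1,2) c(2) by (simp add: s'_def[of r r])
  next
    case False
    have "(\<Sum>j\<in>A. s' i j * \<theta> j) = (\<Sum>j\<in>A. s i j * \<theta> j)"
      using assms(2) False by (intro sum.cong) (auto simp: s'_def)
    also have "\<dots> = b' i" using s(2) that False by auto
    finally show ?thesis using False assms(1,2) by (simp add: s'_def[of i r] b'_def)
  qed
  ultimately show ?thesis by blast
qed

lemma koszul_of_regular:
  fixes \<theta> :: "'i \<Rightarrow> 'k::finite mpoly"
  assumes reg: "regular \<theta>" and "finite A" and hom: "\<And>i. i \<in> A \<Longrightarrow> \<theta> i \<in> homog_part d"
    and b: "\<And>i. i \<in> A \<Longrightarrow> b i \<in> homog_part m" and syz: "(\<Sum>i\<in>A. b i * \<theta> i) = 0"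
  shows "\<exists>s. alternating s \<and> (\<forall>i\<in>A. b i = (\<Sum>j\<in>A. s i j * \<theta> j))"
  using assms(2-5)
proof (induction A arbitrary: b rule: finite_induct)
  case empty
  show ?case by (rule exI[of _ "\<lambda>_ _. 0"]) (simp add: alternating_def)
next
  case (insert r A)
  have "\<theta> r * b r = (\<Sum>i\<in>A. (- b i) * \<theta> i)"
    using insert(1,2,6) by (simp add: sum_negf eq_neg_iff_add_eq_0 mult.commute)
  also have "\<dots> \<in> ideal.span (\<theta> ` A)" by (intro ideal.span_sum ideal.span_scale ideal.span_base) auto
  finally have "b r \<in> ideal.span (\<theta> ` A)" using regularD[OF reg insert(2)] insert(5) by blast
  then show ?case using insert by (intro koszul_insert[where m = m and d = d]) auto
qed

text \<open>The sum runs over all ordered pairs and so counts each Koszul relation twice, whence the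
  factor \<open>1/2\<close>.\<close>

lemma alternating_in_KR:
  fixes f :: "'k::finite mpoly"
  assumes t: "alternating t" and a: "\<And>j. a $ j = (\<Sum>j'\<in>UNIV. t j j' * poly_partial j' f)"
  shows "a \<in> KR f"
proof -
  have half: "Cst (1/2) * p + Cst (1/2) * p = p" for p :: "'k mpoly"
    by (simp flip: distrib_right single_add)
  have "a = (\<Sum>j\<in>UNIV. \<Sum>j'\<in>UNIV. (Cst (1/2) * t j j') *s koszul f j j')"
  proof (subst vec_eq_iff, rule allI)
    fix i
    have "(\<Sum>j\<in>UNIV. \<Sum>j'\<in>UNIV. (Cst (1/2) * t j j') *s koszul f j j') $ i
      = (\<Sum>j\<in>UNIV. \<Sum>j'\<in>UNIV. (if j = i then Cst (1/2) * t j j' * poly_partial j' f else 0)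
           - (if j' = i then Cst (1/2) * t j j' * poly_partial j f else 0))"
      unfolding sum_component
      by (intro sum.cong refl) (auto simp: koszul_def axis_def algebra_simps)
    also have "\<dots> = (\<Sum>j\<in>UNIV. \<Sum>j'\<in>UNIV. (if j = i then Cst (1/2) * t j j' * poly_partial j' f else 0))
       - (\<Sum>j\<in>UNIV. \<Sum>j'\<in>UNIV. (if j' = i then Cst (1/2) * t j j' * poly_partial j f else 0))"
      by (simp only: sum_subtractf)
    also have "(\<Sum>j\<in>UNIV. \<Sum>j'\<in>UNIV. (if j = i then Cst (1/2) * t j j' * poly_partial j' f else 0))
       = (\<Sum>j'\<in>UNIV. Cst (1/2) * t i j' * poly_partial j' f)"
      by (subst sum.swap) simp
    also have "(\<Sum>j\<in>UNIV. \<Sum>j'\<in>UNIV. (if j' = i then Cst (1/2) * t j j' * poly_partial j f else 0))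
       = (\<Sum>j\<in>UNIV. Cst (1/2) * t j i * poly_partial j f)"
      by simp
    also have "\<dots> = - (\<Sum>j\<in>UNIV. Cst (1/2) * t i j * poly_partial j f)"
      unfolding sum_negf[symmetric]
    proof (rule sum.cong)
      fix j
      have "t j i = - t i j" using t unfolding alternating_def by blast
      then show "Cst (1/2) * t j i * poly_partial j f = - (Cst (1/2) * t i j * poly_partial j f)" by simp
    qed simp
    also have "(\<Sum>j\<in>UNIV. Cst (1/2) * t i j * poly_partial j f) = Cst (1/2) * a $ i"
      by (simp add: a sum_distrib_left mult.assoc)
    finally show "a $ i = (\<Sum>j\<in>UNIV. \<Sum>j'\<in>UNIV. (Cst (1/2) * t j j') *s koszul f j j') $ i"
      by (simp add: half)
  qed
  also have "\<dots> \<in> KR f"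
    unfolding KR_def
  proof (intro vmod.span_sum)
    fix j j'
    show "(Cst (1/2) * t j j') *s koszul f j j' \<in> vmod.span {koszul f i j |i j. i \<noteq> j}"
    proof (cases "j = j'")
      case True
      then show ?thesis by (simp add: koszul_def vmod.span_zero)
    qed (auto intro: vmod.span_scale vmod.span_base)
  qed
  finally show ?thesis .
qed

section \<open>Holomorphic functions of several variables\<close>

lemma norm_smult_axis: "norm (t *s axis i (1::complex)) = norm t"
proof -
  have "t *s axis i (1::complex) = axis i t" by (auto simp: vec_eq_iff axis_def)
  moreover have "norm (axis i t) = norm t"
    by (simp add: norm_vec_def L2_set_def axis_def if_distrib if_distribR sum.delta cong: if_cong)
  ultimately show ?thesis by simp
qed

lemma axis_expansion: "v = (\<Sum>i\<in>UNIV. (v $ i) *s axis i (1::complex))"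
  by (auto simp: vec_eq_iff sum_component axis_def if_distrib sum.delta cong: if_cong)

text \<open>The expression inside \<open>germ_partial\<close>, for a function at an arbitrary point.
  Keeping it at the level of functions allows differentiation under an integral.\<close>

definition cpart :: "'n \<Rightarrow> (complex^'n::finite \<Rightarrow> complex) \<Rightarrow> complex^'n \<Rightarrow> complex" where
  "cpart i F x = deriv (\<lambda>t. F (x + t *s axis i 1)) 0"

lemma bounded_linear_smult_axis: "bounded_linear (\<lambda>t. t *s axis i (1::complex))"
  by (rule bounded_linear_intro[of _ 1])
    (auto simp: norm_smult_axis vec_eq_iff algebra_simps)

lemma slice_has_field_derivative:
  fixes F :: "complex^'n::finite \<Rightarrow> complex"
  assumes D: "(F has_derivative D) (at (x + t *s axis i 1))" and lin: "\<And>c v. D (c *s v) = c * D v"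
  shows "((\<lambda>t. F (x + t *s axis i 1)) has_field_derivative D (axis i 1)) (at t)"
proof -
  have "((\<lambda>t. t *s axis i (1::complex)) has_derivative (\<lambda>h. h *s axis i 1)) (at t)"
    by (rule bounded_linear_imp_has_derivative[OF bounded_linear_smult_axis])
  from has_derivative_add[OF has_derivative_const[of x] this]
  have 1: "((\<lambda>t. x + t *s axis i 1) has_derivative (\<lambda>h. h *s axis i 1)) (at t)" by simp
  have "((\<lambda>t. F (x + t *s axis i 1)) has_derivative (\<lambda>h. D (h *s axis i 1))) (at t)"
    using has_derivative_compose[OF 1 D] .
  moreover have "(\<lambda>h. D (h *s axis i 1)) = (*) (D (axis i 1))"
    by (auto simp: fun_eq_iff lin mult.commute)
  ultimately show ?thesis by (simp add: has_field_derivative_def)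
qed

lemma cpart_eq:
  assumes D: "(F has_derivative D) (at x)" and lin: "\<And>c v. D (c *s v) = c * D v"
  shows "cpart i F x = D (axis i 1)"
  unfolding cpart_def
  by (rule DERIV_imp_deriv) (use slice_has_field_derivative[of F D x 0 i] D lin in simp)

lemma cpartI:
  assumes "(F has_derivative (\<lambda>v. \<Sum>i\<in>UNIV. v $ i * p i)) (at x)"
  shows "cpart i F x = p i"
proof -
  have "cpart i F x = (\<Sum>j\<in>UNIV. axis i 1 $ j * p j)"
    by (rule cpart_eq[OF assms]) (simp add: sum_distrib_left mult.assoc)
  also have "\<dots> = p i" by (simp add: axis_def if_distrib if_distribR sum.delta cong: if_cong)
  finally show ?thesis .
qed

lemma cdifferentiable_has_derivative:
  assumes "cdifferentiable F x"
  shows "(F has_derivative (\<lambda>v. \<Sum>i\<in>UNIV. v $ i * cpart i F x)) (at x)"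
proof -
  obtain D where D: "(F has_derivative D) (at x)" and lin: "\<And>c v. D (c *s v) = c * D v"
    using assms unfolding cdifferentiable_def by blast
  have "D v = (\<Sum>i\<in>UNIV. v $ i * cpart i F x)" for v
  proof -
    have "D v = D (\<Sum>i\<in>UNIV. (v $ i) *s axis i 1)" by (simp flip: axis_expansion)
    also have "\<dots> = (\<Sum>i\<in>UNIV. D ((v $ i) *s axis i 1))"
      using has_derivative_linear[OF D] by (rule linear_sum)
    finally show ?thesis by (simp add: lin cpart_eq[OF D lin])
  qed
  then have "D = (\<lambda>v. \<Sum>i\<in>UNIV. v $ i * cpart i F x)" by auto
  then show ?thesis using D by simp
qed

lemma cdifferentiableI:
  "(F has_derivative (\<lambda>v. \<Sum>i\<in>UNIV. v $ i * p i)) (at x) \<Longrightarrow> cdifferentiable F x"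
  unfolding cdifferentiable_def
  by (intro exI conjI, assumption) (simp add: sum_distrib_left mult.assoc)

lemma cdifferentiable_imp_isCont: "cdifferentiable F x \<Longrightarrow> isCont F x"
  unfolding cdifferentiable_def using has_derivative_continuous by blast

text \<open>Cauchy's formula for the slice in direction \<open>i\<close>. The radius of the circle
  is independent of \<open>x\<close>, so \<open>x\<close> enters the integrand only through
  \<open>F\<close>, which makes continuity and differentiability in all variables
  accessible.\<close>

lemma cpart_integral:
  assumes F: "\<And>y. y \<in> ball 0 R \<Longrightarrow> cdifferentiable F y" and r: "r > 0" "norm x + r < R"
  shows "cpart i F x = integral (cbox 0 1)
    (\<lambda>s. F (x + (of_real r * exp (2 * of_real pi * \<i> * of_real s)) *s axis i 1)
       * (exp (- (2 * of_real pi * \<i> * of_real s)) / of_real r))"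
proof -
  let ?f = "\<lambda>t. F (x + t *s axis i 1)"
  let ?e = "\<lambda>s::real. exp (2 * of_real pi * \<i> * of_real s)"
  have inR: "x + t *s axis i 1 \<in> ball 0 R" if "t \<in> cball 0 r" for t
    using norm_triangle_ineq[of x "t *s axis i 1"] that r by (auto simp: norm_smult_axis)
  have "?f field_differentiable at t" if t: "t \<in> cball 0 r" for t
  proof -
    obtain D where "(F has_derivative D) (at (x + t *s axis i 1))" "\<And>c v. D (c *s v) = c * D v"
      using F[OF inR[OF t]] unfolding cdifferentiable_def by blast
    then show ?thesis using slice_has_field_derivative unfolding field_differentiable_def by blast
  qed
  then have "?f holomorphic_on cball 0 r"
    by (simp add: field_differentiable_at_within holomorphic_on_def)
  then have "continuous_on (cball 0 r) ?f" "?f holomorphic_on ball 0 r"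
    by (auto intro: holomorphic_on_imp_continuous_on holomorphic_on_subset)
  from Cauchy_has_contour_integral_higher_derivative_circlepath[OF this, of 0 1] r
  have "((\<lambda>u. ?f u / u ^ 2) has_contour_integral (2 * pi * \<i> * deriv ?f 0)) (circlepath 0 r)"
    by (simp add: numeral_2_eq_2)
  then have "((\<lambda>s. ?f (circlepath 0 r s) / circlepath 0 r s ^ 2 * (2 * pi * \<i> * r * ?e s))
      has_integral 2 * pi * \<i> * deriv ?f 0) {0..1}"
    unfolding has_contour_integral vector_derivative_circlepath .
  then have "((\<lambda>s. inverse (2 * pi * \<i>) * (?f (circlepath 0 r s) / circlepath 0 r s ^ 2 * (2 * pi * \<i> * r * ?e s)))
      has_integral inverse (2 * pi * \<i>) * (2 * pi * \<i> * deriv ?f 0)) {0..1}"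
    by (rule has_integral_mult_right)
  moreover have "inverse (2 * pi * \<i>) * (?f (circlepath 0 r s) / circlepath 0 r s ^ 2 * (2 * pi * \<i> * r * ?e s))
    = ?f (of_real r * ?e s) * (exp (- (2 * of_real pi * \<i> * of_real s)) / of_real r)" for s
    using r by (simp add: circlepath exp_minus field_simps power2_eq_square)
  moreover have "inverse (2 * pi * \<i>) * (2 * pi * \<i> * deriv ?f 0) = deriv ?f 0"
    by (simp add: field_simps)
  ultimately have "((\<lambda>s. ?f (of_real r * ?e s) * (exp (- (2 * of_real pi * \<i> * of_real s)) / of_real r))
      has_integral deriv ?f 0) (cbox 0 1)"
    by simp
  then show ?thesis unfolding cpart_def by (rule integral_unique[symmetric])
qed

lemma norm_circle_point:
  assumes "norm x < R" "r > 0"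
  shows "x + (of_real r * exp (2 * of_real pi * \<i> * of_real s)) *s axis i 1 \<in> ball 0 (R + r)"
proof -
  have "norm (of_real r * exp (2 * of_real pi * \<i> * of_real s)) = r"
    using assms by (simp add: norm_mult norm_exp_eq_Re)
  then show ?thesis
    using norm_triangle_ineq[of x "(of_real r * exp (2 * of_real pi * \<i> * of_real s)) *s axis i 1"] assms
    by (simp add: norm_smult_axis)
qed

lemma continuous_on_circle_point:
  "continuous_on A (\<lambda>p. fst p + (of_real r * exp (2 * of_real pi * \<i> * of_real (snd p))) *s axis i 1)"
proof -
  have "continuous_on A (\<lambda>p. (of_real r * exp (2 * of_real pi * \<i> * of_real (snd p))) *s axis i (1::complex))"
    by (rule bounded_linear.continuous_on[OF bounded_linear_smult_axis]) (intro continuous_intros)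
  then show ?thesis by (intro continuous_intros)
qed

lemma continuous_on_cpart:
  fixes F :: "complex^'n::finite \<Rightarrow> complex"
  assumes F: "\<And>y. y \<in> ball 0 R \<Longrightarrow> cdifferentiable F y" and r: "r > 0" "R' + r \<le> R"
  shows "continuous_on (ball 0 R') (cpart i F)"
proof -
  have cF: "continuous_on (ball 0 R) F"
    using F cdifferentiable_imp_isCont by (metis continuous_at_imp_continuous_on)
  have "continuous_on (ball 0 R' \<times> cbox 0 1) (\<lambda>p. F (fst p + (of_real r * exp (2 * of_real pi * \<i> * of_real (snd p))) *s axis i 1)
       * (exp (- (2 * of_real pi * \<i> * of_real (snd p))) / of_real r))"
  proof (rule continuous_on_mult)
    show "continuous_on (ball 0 R' \<times> cbox 0 1) (\<lambda>p. F (fst p + (of_real r * exp (2 * of_real pi * \<i> * of_real (snd p))) *s axis i 1))"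
    proof (rule continuous_on_compose2[OF cF continuous_on_circle_point])
      show "(\<lambda>p. fst p + (of_real r * exp (2 * of_real pi * \<i> * of_real (snd p))) *s axis i 1) ` (ball 0 R' \<times> cbox 0 1) \<subseteq> ball 0 R"
      proof (intro image_subsetI)
        fix p :: "(complex^'n) \<times> real" assume "p \<in> ball 0 R' \<times> cbox 0 1"
        then have "norm (fst p) < R'" by auto
        from norm_circle_point[OF this r(1), of "snd p" i]
        show "fst p + (of_real r * exp (2 * of_real pi * \<i> * of_real (snd p))) *s axis i 1 \<in> ball 0 R"
          using r(2) by simp
      qed
    qed
    show "continuous_on (ball 0 R' \<times> cbox 0 1) (\<lambda>p. exp (- (2 * of_real pi * \<i> * of_real (snd p))) / complex_of_real r)"
      using r by (intro continuous_intros) auto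
  qed
  then have "continuous_on (ball 0 R') (\<lambda>x. integral (cbox 0 1)
    (\<lambda>s. F (x + (of_real r * exp (2 * of_real pi * \<i> * of_real s)) *s axis i 1)
       * (exp (- (2 * of_real pi * \<i> * of_real s)) / of_real r)))"
    by (intro integral_continuous_on_param) (simp add: split_beta)
  then show ?thesis
  proof (rule continuous_on_eq)
    fix x :: "complex^'n" assume "x \<in> ball 0 R'"
    then have "norm x + r < R" using r by simp
    then show "integral (cbox 0 1) (\<lambda>s. F (x + (of_real r * exp (2 * of_real pi * \<i> * of_real s)) *s axis i 1)
       * (exp (- (2 * of_real pi * \<i> * of_real s)) / of_real r)) = cpart i F x"
      by (intro cpart_integral[where R = R, symmetric] F r(1))
  qed
qed

text \<open>The Leibniz rule, with \<open>D i\<close> as partial derivatives of the integrand;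
  complex linearity of the derivative is inherited pointwise from the integrand.\<close>

lemma cdifferentiable_integral:
  fixes H :: "complex^'n::finite \<Rightarrow> real \<Rightarrow> complex"
  assumes U: "open U" "convex U" "x0 \<in> U"
    and H: "\<And>x s. x \<in> U \<Longrightarrow> s \<in> cbox 0 1 \<Longrightarrow> ((\<lambda>x. H x s) has_derivative (\<lambda>v. \<Sum>i\<in>UNIV. v $ i * D i x s)) (at x)"
    and contD: "\<And>i. continuous_on (U \<times> cbox 0 1) (\<lambda>p. D i (fst p) (snd p))"
    and contH: "\<And>x. x \<in> U \<Longrightarrow> continuous_on (cbox 0 1) (H x)"
  shows "cdifferentiable (\<lambda>x. integral (cbox 0 1) (H x)) x0"
proof -
  define pr where "pr i = Blinfun (\<lambda>v :: complex^'n. v $ i)" for i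
  have pr: "blinfun_apply (pr i) v = v $ i" for i v
    unfolding pr_def by (simp add: bounded_linear_Blinfun_apply bounded_linear_vec_nth)
  define fx where "fx x s = (\<Sum>i\<in>UNIV. blinfun_mult_left (D i x s) o\<^sub>L pr i)" for x s
  have fx: "blinfun_apply (fx x s) v = (\<Sum>i\<in>UNIV. v $ i * D i x s)" for x s v
    by (simp add: fx_def blinfun.sum_left pr)
  have contfx: "continuous_on (U \<times> cbox 0 1) (\<lambda>(x, t). fx x t)"
    unfolding fx_def split_beta
    by (intro continuous_intros bounded_linear.continuous_on[OF bounded_linear_blinfun_mult_left] contD)
  have "((\<lambda>x. integral (cbox 0 1) (H x)) has_derivative integral (cbox 0 1) (fx x0)) (at x0 within U)"
  proof (rule leibniz_rule[OF _ _ contfx U(3,2)])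
    fix x and t :: real assume "x \<in> U" "t \<in> cbox 0 1"
    then have "((\<lambda>x. H x t) has_derivative (\<lambda>v. \<Sum>i\<in>UNIV. v $ i * D i x t)) (at x within U)"
      using H has_derivative_at_withinI by blast
    then show "((\<lambda>x. H x t) has_derivative blinfun_apply (fx x t)) (at x within U)"
      by (simp add: fx[abs_def])
  next
    fix x assume "x \<in> U"
    then show "H x integrable_on cbox 0 1" by (intro integrable_continuous contH)
  qed
  then have der: "((\<lambda>x. integral (cbox 0 1) (H x)) has_derivative integral (cbox 0 1) (fx x0)) (at x0)"
    by (simp only: at_within_open[OF U(3,1)])
  have "continuous_on (cbox 0 1) (\<lambda>s. case (x0, s) of (x, t) \<Rightarrow> fx x t)"
    by (rule continuous_on_compose2[OF contfx]) (use U(3) in \<open>auto intro!: continuous_intros\<close>)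
  then have "continuous_on (cbox 0 1) (fx x0)" by simp
  then have int: "fx x0 integrable_on cbox 0 1" by (rule integrable_continuous)
  have "blinfun_apply (integral (cbox 0 1) (fx x0)) (c *s v)
      = c * blinfun_apply (integral (cbox 0 1) (fx x0)) v" for c v
  proof -
    have "blinfun_apply (fx x0 s) (c *s v) = c * blinfun_apply (fx x0 s) v" for s
      by (simp add: fx sum_distrib_left mult.assoc)
    then show ?thesis by (simp only: blinfun_apply_integral[OF int] integral_mult_right)
  qed
  then show ?thesis unfolding cdifferentiable_def using der by blast
qed

lemma has_derivative_shift: "((\<lambda>x::'a::real_normed_vector. x + a) has_derivative (\<lambda>v. v)) (at x)"
  by (auto intro!: derivative_eq_intros)

text \<open>Differentiates Cauchy's integral under the integral sign. A point of norm below
  \<open>R/4\<close> and a circle of radius \<open>R/4\<close> around it stay in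
  \<open>ball 0 (R/2)\<close>, where \<open>continuous_on_cpart\<close> makes the partial
  derivatives of \<open>F\<close> continuous.\<close>

lemma cpart_cdifferentiable:
  fixes F :: "complex^'n::finite \<Rightarrow> complex"
  assumes F: "\<And>y. y \<in> ball 0 R \<Longrightarrow> cdifferentiable F y" and R: "R > 0" and x: "x \<in> ball 0 (R/4)"
  shows "cdifferentiable (cpart i F) x"
proof -
  define r where "r = R/4"
  have r: "r > 0" using R by (simp add: r_def)
  let ?g = "\<lambda>x s::real. x + (of_real r * exp (2 * of_real pi * \<i> * of_real s)) *s axis i (1::complex)"
  let ?e = "\<lambda>s::real. exp (- (2 * of_real pi * \<i> * of_real s)) / complex_of_real r"
  have g: "?g x s \<in> ball 0 (R/2)" if "x \<in> ball 0 r" for x :: "complex^'n" and s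
    using norm_circle_point[of x r r s i] that r by (auto simp: r_def)
  have gR: "?g x s \<in> ball 0 R" if "x \<in> ball 0 r" for x :: "complex^'n" and s
    using g[OF that, of s] R by auto
  have cF: "continuous_on (ball 0 R) F"
    using F cdifferentiable_imp_isCont by (metis continuous_at_imp_continuous_on)
  have cp: "continuous_on (ball 0 (R/2)) (cpart j F)" for j
    by (rule continuous_on_cpart[OF F, of R "R/2"]) (use R in auto)
  have conte: "continuous_on A (\<lambda>p. ?e (snd p))" for A :: "((complex^'n) \<times> real) set"
    using r by (intro continuous_intros) auto
  have *: "cdifferentiable (\<lambda>x. integral (cbox 0 1) (\<lambda>s. F (?g x s) * ?e s)) y" if y: "y \<in> ball 0 r" for y
  proof (rule cdifferentiable_integral[OF open_ball convex_ball y])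
    fix x :: "complex^'n" and s :: real assume x: "x \<in> ball 0 r" "s \<in> cbox 0 1"
    have "((\<lambda>x. F (?g x s)) has_derivative (\<lambda>v. \<Sum>j\<in>UNIV. v $ j * cpart j F (?g x s))) (at x)"
      using has_derivative_compose[OF has_derivative_shift cdifferentiable_has_derivative[OF F[OF gR[OF x(1)]]]] .
    then have "((\<lambda>x. F (?g x s) * ?e s) has_derivative (\<lambda>v. (\<Sum>j\<in>UNIV. v $ j * cpart j F (?g x s)) * ?e s)) (at x)"
      by (rule has_derivative_mult_left)
    then show "((\<lambda>x. F (?g x s) * ?e s) has_derivative (\<lambda>v. \<Sum>j\<in>UNIV. v $ j * (cpart j F (?g x s) * ?e s))) (at x)"
      by (simp only: sum_distrib_right mult.assoc)
  next
    fix j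
    show "continuous_on (ball 0 r \<times> cbox 0 1) (\<lambda>p. cpart j F (?g (fst p) (snd p)) * ?e (snd p))"
      by (intro continuous_on_mult conte continuous_on_compose2[OF cp continuous_on_circle_point])
        (use g in \<open>auto simp del: mem_ball\<close>)
  next
    fix x :: "complex^'n" assume x: "x \<in> ball 0 r"
    have "continuous_on (ball 0 r \<times> cbox 0 1) (\<lambda>p. F (?g (fst p) (snd p)) * ?e (snd p))"
      by (intro continuous_on_mult conte continuous_on_compose2[OF cF continuous_on_circle_point])
        (use gR in \<open>auto simp del: mem_ball\<close>)
    moreover have "continuous_on (cbox 0 1) (\<lambda>s. (x, s))" by (intro continuous_intros)
    moreover have "(\<lambda>s. (x, s)) ` cbox 0 1 \<subseteq> ball 0 r \<times> cbox (0::real) 1" using x by blast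
    ultimately have "continuous_on (cbox 0 1) (\<lambda>s. F (?g (fst (x, s)) (snd (x, s))) * ?e (snd (x, s)))"
      by (rule continuous_on_compose2)
    then show "continuous_on (cbox 0 1) (\<lambda>s. F (?g x s) * ?e s)" by simp
  qed
  have eq: "cpart i F y = integral (cbox 0 1) (\<lambda>s. F (?g y s) * ?e s)" if "y \<in> ball 0 r" for y
  proof -
    have "norm y + r < R" using that R by (simp add: r_def)
    then show ?thesis by (intro cpart_integral[where R = R] F r)
  qed
  have x': "x \<in> ball 0 r" using x by (simp add: r_def)
  obtain D where D: "((\<lambda>x. integral (cbox 0 1) (\<lambda>s. F (?g x s) * ?e s)) has_derivative D) (at x)"
    "\<forall>c v. D (c *s v) = c * D v" using *[OF x'] unfolding cdifferentiable_def by blast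
  have "(cpart i F has_derivative D) (at x)"
    by (rule has_derivative_transform_within_open[OF D(1) open_ball x']) (simp add: eq)
  then show ?thesis using D(2) unfolding cdifferentiable_def by blast
qed

lemma sum_scaleR_vec:
  "(\<Sum>j\<in>UNIV. (s *\<^sub>R v) $ j * c j) = (\<Sum>j\<in>UNIV. v $ j * (complex_of_real s * c j))"
  unfolding vector_scaleR_component by (simp add: scaleR_conv_of_real mult_ac)

text \<open>\<open>G i x\<close> is the average of \<open>cpart i F\<close> over the segment from 0
  to \<open>x\<close>. Differentiating it requires continuous second partial derivatives: the first
  ones are holomorphic on \<open>ball 0 (R/4)\<close>, and circles of radius \<open>R/8\<close>
  around points of \<open>ball 0 (R/16)\<close> stay inside that ball.\<close>

lemma hadamard_ball:
  fixes F :: "complex^'n::finite \<Rightarrow> complex"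
  assumes F: "\<And>y. y \<in> ball 0 R \<Longrightarrow> cdifferentiable F y" and R: "R > 0"
  shows "\<exists>G. (\<forall>i. \<forall>x\<in>ball 0 (R/16). cdifferentiable (G i) x)
    \<and> (\<forall>x\<in>ball 0 (R/16). F x = F 0 + (\<Sum>i\<in>UNIV. x $ i * G i x))"
proof -
  define r where "r = R/16"
  have r: "r > 0" using R by (simp add: r_def)
  have rR: "ball 0 r \<subseteq> ball (0::complex^'n) (R/4)" "ball 0 r \<subseteq> ball (0::complex^'n) R"
    using R by (auto simp: r_def)
  have seg: "s *\<^sub>R x \<in> ball 0 r" if "x \<in> ball 0 r" "s \<in> cbox 0 1" for x :: "complex^'n" and s :: real
    using that mult_left_le_one_le[of "norm x" "\<bar>s\<bar>"] by auto
  have cd: "cdifferentiable (cpart i F) x" if "x \<in> ball 0 (R/4)" for x i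
    using cpart_cdifferentiable[OF F R that] .
  have cc: "continuous_on (ball 0 r) (cpart i F)" for i
    using cd rR cdifferentiable_imp_isCont by (metis continuous_at_imp_continuous_on subsetD)
  have ccc: "continuous_on (ball 0 r) (cpart j (cpart i F))" for i j
    by (rule continuous_on_cpart[where R = "R/4" and r = "R/8", OF cd]) (use R in \<open>auto simp: r_def\<close>)
  have csc: "continuous_on A (\<lambda>p. snd p *\<^sub>R fst p)" for A :: "((complex^'n) \<times> real) set"
    by (intro continuous_intros)
  define G where "G i x = integral (cbox 0 1) (\<lambda>s::real. cpart i F (s *\<^sub>R x))" for i x
  have "cdifferentiable (G i) y" if y: "y \<in> ball 0 r" for i y
    unfolding G_def
  proof (rule cdifferentiable_integral[OF open_ball convex_ball y])
    fix x :: "complex^'n" and s :: real assume x: "x \<in> ball 0 r" "s \<in> cbox 0 1"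
    have 1: "((\<lambda>x. s *\<^sub>R x) has_derivative (\<lambda>v. s *\<^sub>R v)) (at x)"
      by (rule bounded_linear.has_derivative[OF bounded_linear_scaleR_right has_derivative_ident])
    have "s *\<^sub>R x \<in> ball 0 (R/4)" using seg[OF x] rR by blast
    from has_derivative_compose[OF 1 cdifferentiable_has_derivative[OF cd[OF this]]]
    show "((\<lambda>x. cpart i F (s *\<^sub>R x)) has_derivative
        (\<lambda>v. \<Sum>j\<in>UNIV. v $ j * (of_real s * cpart j (cpart i F) (s *\<^sub>R x)))) (at x)"
      by (simp only: sum_scaleR_vec)
  next
    fix j
    have "continuous_on (ball 0 r \<times> cbox 0 1) (\<lambda>p. cpart j (cpart i F) (snd p *\<^sub>R fst p))"
      by (rule continuous_on_compose2[OF ccc csc]) (use seg in \<open>auto simp del: mem_ball\<close>)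
    then show "continuous_on (ball 0 r \<times> cbox 0 1) (\<lambda>p. of_real (snd p) * cpart j (cpart i F) (snd p *\<^sub>R fst p))"
      by (intro continuous_intros)
  next
    fix x :: "complex^'n" assume x: "x \<in> ball 0 r"
    show "continuous_on (cbox 0 1) (\<lambda>s. cpart i F (s *\<^sub>R x))"
      by (rule continuous_on_compose2[OF cc]) (use x seg in \<open>auto intro!: continuous_intros simp del: mem_ball\<close>)
  qed
  moreover have "F x = F 0 + (\<Sum>i\<in>UNIV. x $ i * G i x)" if x: "x \<in> ball 0 r" for x
  proof -
    have "((\<lambda>s. \<Sum>i\<in>UNIV. x $ i * cpart i F (s *\<^sub>R x)) has_integral (F (1 *\<^sub>R x) - F (0 *\<^sub>R x))) {0..1}"
    proof (rule fundamental_theorem_of_calculus)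
      fix s :: real assume "s \<in> {0..1}"
      then have "s \<in> cbox 0 1" by simp
      then have "s *\<^sub>R x \<in> ball 0 R" using seg[OF x] rR(2) by blast
      then have 1: "(F has_derivative (\<lambda>v. \<Sum>i\<in>UNIV. v $ i * cpart i F (s *\<^sub>R x))) (at (s *\<^sub>R x))"
        by (intro cdifferentiable_has_derivative F)
      have 2: "((\<lambda>s. s *\<^sub>R x) has_derivative (\<lambda>h. h *\<^sub>R x)) (at s within {0..1})"
        by (rule bounded_linear.has_derivative[OF bounded_linear_scaleR_left has_derivative_ident])
      have "((\<lambda>s. F (s *\<^sub>R x)) has_derivative (\<lambda>h. \<Sum>i\<in>UNIV. (h *\<^sub>R x) $ i * cpart i F (s *\<^sub>R x))) (at s within {0..1})"
        using has_derivative_compose[OF 2 1] .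
      then show "((\<lambda>s. F (s *\<^sub>R x)) has_vector_derivative (\<Sum>i\<in>UNIV. x $ i * cpart i F (s *\<^sub>R x))) (at s within {0..1})"
        by (simp add: has_vector_derivative_def scaleR_sum_right)
    qed simp
    then have "F x - F 0 = integral (cbox 0 1) (\<lambda>s. \<Sum>i\<in>UNIV. x $ i * cpart i F (s *\<^sub>R x))"
      by (simp add: integral_unique)
    also have "\<dots> = (\<Sum>i\<in>UNIV. x $ i * G i x)"
    proof (subst integral_sum)
      fix i
      have "continuous_on (cbox 0 1) (\<lambda>s. cpart i F (s *\<^sub>R x))"
        by (rule continuous_on_compose2[OF cc]) (use x seg in \<open>auto intro!: continuous_intros simp del: mem_ball\<close>)
      then show "(\<lambda>s. x $ i * cpart i F (s *\<^sub>R x)) integrable_on cbox 0 1"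
        by (intro integrable_continuous continuous_intros)
    qed (simp_all add: G_def)
    finally show ?thesis by (simp add: algebra_simps)
  qed
  ultimately show ?thesis unfolding r_def by blast
qed

lemma holo_near_0_iff: "holo_near F 0 \<longleftrightarrow> (\<exists>R>0. \<forall>x\<in>ball 0 R. cdifferentiable F x)"
  unfolding holo_near_def eventually_nhds_metric by (auto simp: dist_commute)

lemma holo_near_cpart: "holo_near F 0 \<Longrightarrow> holo_near (cpart i F) 0"
proof -
  assume "holo_near F 0"
  then obtain R where "R > 0" "\<And>x. x \<in> ball 0 R \<Longrightarrow> cdifferentiable F x"
    unfolding holo_near_0_iff by blast
  then show ?thesis unfolding holo_near_0_iff
    by (intro exI[of _ "R/4"] conjI ballI cpart_cdifferentiable[of R]) auto
qed

lemma hadamard: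
  fixes F :: "complex^'n::finite \<Rightarrow> complex"
  assumes "holo_near F 0"
  obtains G where "\<And>i. holo_near (G i) 0" "\<forall>\<^sub>F x in nhds 0. F x = F 0 + (\<Sum>i\<in>UNIV. x $ i * G i x)"
proof -
  obtain R where R: "R > 0" "\<And>x. x \<in> ball 0 R \<Longrightarrow> cdifferentiable F x"
    using assms unfolding holo_near_0_iff by blast
  obtain G where G: "\<And>i x. x \<in> ball 0 (R/16) \<Longrightarrow> cdifferentiable (G i) x"
    "\<And>x. x \<in> ball 0 (R/16) \<Longrightarrow> F x = F 0 + (\<Sum>i\<in>UNIV. x $ i * G i x)"
    using hadamard_ball[OF R(2,1)] by blast
  show ?thesis
  proof
    show "holo_near (G i) 0" for i
      unfolding holo_near_0_iff using R G(1) by (intro exI[of _ "R/16"]) auto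
    have "\<forall>\<^sub>F x in nhds 0. x \<in> ball (0 :: complex^'n) (R/16)"
      by (rule eventually_nhds_in_open) (use R(1) in auto)
    then show "\<forall>\<^sub>F x in nhds 0. F x = F 0 + (\<Sum>i\<in>UNIV. x $ i * G i x)"
      by (rule eventually_mono) (rule G(2))
  qed
qed

section \<open>Composition, inverses and locality of partial derivatives\<close>

lemma has_derivative_vec_of_components:
  fixes \<Phi> :: "'a::real_normed_vector \<Rightarrow> complex^'n::finite"
  assumes "\<And>l. ((\<lambda>y. \<Phi> y $ l) has_derivative D l) F"
  shows "(\<Phi> has_derivative (\<lambda>v. \<chi> l. D l v)) F"
proof -
  have "((\<lambda>y. \<Sum>l\<in>UNIV. (\<Phi> y $ l) *s axis l 1) has_derivative (\<lambda>v. \<Sum>l\<in>UNIV. (D l v) *s axis l 1)) F"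
    by (intro has_derivative_sum bounded_linear.has_derivative[OF bounded_linear_smult_axis] assms)
  moreover have "(\<Sum>l\<in>UNIV. (D l v) *s axis l 1) = (\<chi> l. D l v)" for v
    using axis_expansion[of "\<chi> l. D l v"] by simp
  ultimately show ?thesis by (simp flip: axis_expansion)
qed

lemma chain_rule_cpart:
  fixes \<Phi> :: "complex^'m::finite \<Rightarrow> complex^'n::finite"
  assumes \<Phi>: "\<And>l. cdifferentiable (\<lambda>y. \<Phi> y $ l) x" and F: "cdifferentiable F (\<Phi> x)"
  shows "((\<lambda>y. F (\<Phi> y)) has_derivative
     (\<lambda>v. \<Sum>i\<in>UNIV. v $ i * (\<Sum>l\<in>UNIV. cpart l F (\<Phi> x) * cpart i (\<lambda>y. \<Phi> y $ l) x))) (at x)"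
proof -
  have "(\<Phi> has_derivative (\<lambda>v. \<chi> l. \<Sum>i\<in>UNIV. v $ i * cpart i (\<lambda>y. \<Phi> y $ l) x)) (at x)"
    by (intro has_derivative_vec_of_components cdifferentiable_has_derivative \<Phi>)
  from has_derivative_compose[OF this cdifferentiable_has_derivative[OF F]]
  have "((\<lambda>y. F (\<Phi> y)) has_derivative
     (\<lambda>v. \<Sum>l\<in>UNIV. (\<Sum>i\<in>UNIV. v $ i * cpart i (\<lambda>y. \<Phi> y $ l) x) * cpart l F (\<Phi> x))) (at x)"
    by simp
  moreover have "(\<Sum>l\<in>UNIV. (\<Sum>i\<in>UNIV. v $ i * cpart i (\<lambda>y. \<Phi> y $ l) x) * cpart l F (\<Phi> x))
     = (\<Sum>i\<in>UNIV. v $ i * (\<Sum>l\<in>UNIV. cpart l F (\<Phi> x) * cpart i (\<lambda>y. \<Phi> y $ l) x))" for v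
    by (simp only: sum_distrib_right sum_distrib_left, subst sum.swap) (simp add: mult_ac)
  ultimately show ?thesis by simp
qed

lemma cdifferentiable_compose:
  fixes \<Phi> :: "complex^'m::finite \<Rightarrow> complex^'n::finite"
  assumes "\<And>l. cdifferentiable (\<lambda>y. \<Phi> y $ l) x" "cdifferentiable F (\<Phi> x)"
  shows "cdifferentiable (\<lambda>y. F (\<Phi> y)) x"
  by (rule cdifferentiableI[OF chain_rule_cpart[OF assms]])

lemma holo_near_isCont: "holo_near F x \<Longrightarrow> isCont F x"
  unfolding holo_near_def using eventually_nhds_x_imp_x cdifferentiable_imp_isCont by blast

lemma tendsto_vec_of_holo_near:
  assumes "\<And>l. holo_near (\<lambda>y. \<Phi> y $ l) x"
  shows "filterlim \<Phi> (nhds (\<Phi> x)) (nhds x)"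
proof -
  have "isCont \<Phi> x"
    unfolding isCont_def using holo_near_isCont[OF assms] by (intro vec_tendstoI) (simp add: isCont_def)
  then show ?thesis by (simp add: tendsto_at_iff_tendsto_nhds isCont_def)
qed

lemma holo_near_compose:
  fixes \<Phi> :: "complex^'m::finite \<Rightarrow> complex^'n::finite"
  assumes \<Phi>: "\<And>l. holo_near (\<lambda>y. \<Phi> y $ l) x" and F: "holo_near F (\<Phi> x)"
  shows "holo_near (\<lambda>y. F (\<Phi> y)) x"
proof -
  have "\<forall>\<^sub>F y in nhds x. \<forall>l. cdifferentiable (\<lambda>y. \<Phi> y $ l) y"
    using \<Phi> unfolding holo_near_def by (simp add: eventually_all_finite)
  moreover have "\<forall>\<^sub>F y in nhds x. cdifferentiable F (\<Phi> y)"
    using eventually_compose_filterlim[OF _ tendsto_vec_of_holo_near[of \<Phi> x, OF \<Phi>]] F unfolding holo_near_def by blast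
  ultimately show ?thesis
    unfolding holo_near_def by eventually_elim (rule cdifferentiable_compose, auto)
qed

lemma cdifferentiable_nth: "cdifferentiable (\<lambda>x. x $ i) x"
  unfolding cdifferentiable_def
  by (intro exI[of _ "\<lambda>v. v $ i"])
    (auto intro: bounded_linear.has_derivative[OF bounded_linear_vec_nth has_derivative_ident])

lemma holo_near_nth: "holo_near (\<lambda>x. x $ i) x"
  unfolding holo_near_def by (intro always_eventually allI cdifferentiable_nth)

lemma holo_near_sum: "(\<And>i. i \<in> A \<Longrightarrow> holo_near (F i) x) \<Longrightarrow> holo_near (\<lambda>x. \<Sum>i\<in>A. F i x) x"
  by (induction A rule: infinite_finite_induct) (auto intro: holo_near_const holo_near_add)

lemma cdifferentiable_inverse:
  assumes "cdifferentiable F x" "F x \<noteq> 0"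
  shows "cdifferentiable (\<lambda>x. inverse (F x)) x"
proof -
  obtain D where D: "(F has_derivative D) (at x)" "\<forall>c v. D (c *s v) = c * D v"
    using assms unfolding cdifferentiable_def by blast
  then show ?thesis unfolding cdifferentiable_def
    by (intro exI[of _ "\<lambda>h. - (inverse (F x) * D h * inverse (F x))"] conjI Deriv.has_derivative_inverse assms(2))
      (auto simp: mult_ac)
qed

lemma holo_near_inverse:
  assumes "holo_near F x" "F x \<noteq> 0"
  shows "holo_near (\<lambda>x. inverse (F x)) x"
proof -
  have "\<forall>\<^sub>F y in nhds x. F y \<noteq> 0"
    using holo_near_isCont[OF assms(1)] assms(2)
    by (metis tendsto_imp_eventually_ne continuous_within tendsto_at_iff_tendsto_nhds)
  then show ?thesis using assms(1) unfolding holo_near_def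
    by (rule eventually_elim2) (rule cdifferentiable_inverse)
qed

lemma cpart_cong:
  assumes "\<forall>\<^sub>F y in nhds x. F y = G y"
  shows "cpart i F x = cpart i G x"
proof -
  have "((\<lambda>t. t *s axis i 1) \<longlongrightarrow> 0 *s axis i 1) (nhds (0::complex))"
    by (rule bounded_linear.tendsto[OF bounded_linear_smult_axis filterlim_ident])
  then have "filterlim (\<lambda>t. x + t *s axis i 1) (nhds (x + 0 *s axis i 1)) (nhds (0::complex))"
    by (intro tendsto_add tendsto_const)
  then have "\<forall>\<^sub>F t in nhds 0. F (x + t *s axis i 1) = G (x + t *s axis i 1)"
    using eventually_compose_filterlim[OF assms] by simp
  then show ?thesis unfolding cpart_def by (intro deriv_cong_ev) auto
qed

lemma cpart_mult:
  assumes "cdifferentiable F x" "cdifferentiable G x"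
  shows "cpart i (\<lambda>x. F x * G x) x = cpart i F x * G x + F x * cpart i G x"
proof (rule cpartI)
  have "((\<lambda>x. F x * G x) has_derivative
     (\<lambda>v. F x * (\<Sum>i\<in>UNIV. v $ i * cpart i G x) + (\<Sum>i\<in>UNIV. v $ i * cpart i F x) * G x)) (at x)"
    by (intro has_derivative_mult cdifferentiable_has_derivative assms)
  moreover have "F x * (\<Sum>i\<in>UNIV. v $ i * cpart i G x) + (\<Sum>i\<in>UNIV. v $ i * cpart i F x) * G x
     = (\<Sum>i\<in>UNIV. v $ i * (cpart i F x * G x + F x * cpart i G x))" for v
    by (simp add: sum_distrib_left sum_distrib_right sum.distrib algebra_simps)
  ultimately show "((\<lambda>x. F x * G x) has_derivative
     (\<lambda>v. \<Sum>i\<in>UNIV. v $ i * (cpart i F x * G x + F x * cpart i G x))) (at x)" by simp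
qed

section \<open>Germs\<close>

lemma holo_near_rep: "holo_near (rep_hol_germ g) 0"
  using Quotient3_rep_reflp[OF Quotient3_hol_germ, of g] by (simp add: germ_rel_def)

lemma germ_rel_refl: "holo_near F 0 \<Longrightarrow> germ_rel F F"
  by (simp add: germ_rel_def)

lemma abs_rep_germ: "abs_hol_germ (rep_hol_germ g) = g"
  by (rule Quotient3_abs_rep[OF Quotient3_hol_germ])

lemma abs_germ_eqI:
  "holo_near F 0 \<Longrightarrow> holo_near G 0 \<Longrightarrow> \<forall>\<^sub>F x in nhds 0. F x = G x \<Longrightarrow> abs_hol_germ F = abs_hol_germ G"
  using Quotient3_rel_abs[OF Quotient3_hol_germ, of F G] by (simp add: germ_rel_def)

lemma abs_germ_eqD:
  assumes "holo_near F 0" "holo_near G 0" "abs_hol_germ F = abs_hol_germ G"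
  shows "\<forall>\<^sub>F x in nhds 0. F x = G x"
  using Quotient3_rel[OF Quotient3_hol_germ, of F G] assms by (auto simp: germ_rel_def)

lemma rep_abs_germ: "holo_near F 0 \<Longrightarrow> \<forall>\<^sub>F x in nhds 0. rep_hol_germ (abs_hol_germ F) x = F x"
  by (rule abs_germ_eqD) (auto simp: holo_near_rep abs_rep_germ)

lemma germ_cases:
  obtains F where "holo_near F 0" "g = abs_hol_germ F"
  using that[of "rep_hol_germ g"] holo_near_rep abs_rep_germ by metis

lemma germ_add: "holo_near F 0 \<Longrightarrow> holo_near G 0 \<Longrightarrow> abs_hol_germ F + abs_hol_germ G = abs_hol_germ (\<lambda>x. F x + G x)"
  by (simp add: plus_hol_germ.abs_eq germ_rel_refl)

lemma germ_mult: "holo_near F 0 \<Longrightarrow> holo_near G 0 \<Longrightarrow> abs_hol_germ F * abs_hol_germ G = abs_hol_germ (\<lambda>x. F x * G x)"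
  by (simp add: times_hol_germ.abs_eq germ_rel_refl)

lemma germ_sum:
  assumes "\<And>i. i \<in> A \<Longrightarrow> holo_near (F i) 0"
  shows "(\<Sum>i\<in>A. abs_hol_germ (F i)) = abs_hol_germ (\<lambda>x. \<Sum>i\<in>A. F i x)"
  using assms
proof (induction A rule: infinite_finite_induct)
  case (insert a A)
  then show ?case by (simp add: germ_add holo_near_sum)
qed (simp_all add: zero_hol_germ_def)

lemma germ_value_abs: "holo_near F 0 \<Longrightarrow> germ_value (abs_hol_germ F) = F 0"
  by (simp add: germ_value.abs_eq germ_rel_refl)

lemma germ_unit:
  assumes "germ_value g \<noteq> 0"
  shows "\<exists>h. h * g = 1"
proof -
  obtain F where F: "holo_near F 0" "g = abs_hol_germ F" by (rule germ_cases)
  have "F 0 \<noteq> 0" using assms F by (simp add: germ_value_abs)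
  have inv: "holo_near (\<lambda>x. inverse (F x)) 0" by (rule holo_near_inverse[OF F(1) \<open>F 0 \<noteq> 0\<close>])
  have "\<forall>\<^sub>F x in nhds 0. F x \<noteq> 0"
    using holo_near_isCont[OF F(1)] \<open>F 0 \<noteq> 0\<close>
    by (metis tendsto_imp_eventually_ne isCont_def tendsto_at_iff_tendsto_nhds)
  then have "\<forall>\<^sub>F x in nhds 0. inverse (F x) * F x = 1" by (rule eventually_mono) simp
  then have "abs_hol_germ (\<lambda>x. inverse (F x) * F x) = abs_hol_germ (\<lambda>x. 1)"
    by (intro abs_germ_eqI holo_near_mult inv F(1) holo_near_const)
  then have "abs_hol_germ (\<lambda>x. inverse (F x)) * g = 1"
    by (simp add: F(2) germ_mult[OF inv F(1)] one_hol_germ_def)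
  then show ?thesis ..
qed

text \<open>Two functions that agree near 0 agree near each nearby point as well, so their partial
  derivatives agree near 0.\<close>

lemma germ_partial_abs:
  assumes "holo_near F 0"
  shows "germ_partial i (abs_hol_germ F) = abs_hol_germ (cpart i F)"
proof -
  let ?R = "rep_hol_germ (abs_hol_germ F)"
  have "\<forall>\<^sub>F x in nhds 0. \<forall>\<^sub>F y in nhds x. ?R y = F y"
    using rep_abs_germ[OF assms] by (simp add: eventually_eventually)
  then have "\<forall>\<^sub>F x in nhds 0. cpart i ?R x = cpart i F x"
    by (rule eventually_mono) (rule cpart_cong)
  then have "abs_hol_germ (cpart i ?R) = abs_hol_germ (cpart i F)"
    by (intro abs_germ_eqI holo_near_cpart holo_near_rep assms)
  then show ?thesis by (simp add: germ_partial_def cpart_def[abs_def])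
qed

lemma germ_partial_mult: "germ_partial i (a * b) = germ_partial i a * b + a * germ_partial i b"
proof -
  obtain F where F: "holo_near F 0" "a = abs_hol_germ F" by (rule germ_cases)
  obtain G where G: "holo_near G 0" "b = abs_hol_germ G" by (rule germ_cases)
  have "\<forall>\<^sub>F x in nhds 0. cpart i (\<lambda>x. F x * G x) x = cpart i F x * G x + F x * cpart i G x"
    using F(1) G(1) unfolding holo_near_def by (rule eventually_elim2) (rule cpart_mult)
  then have "abs_hol_germ (cpart i (\<lambda>x. F x * G x)) = abs_hol_germ (\<lambda>x. cpart i F x * G x + F x * cpart i G x)"
    by (intro abs_germ_eqI holo_near_cpart holo_near_add holo_near_mult F G)
  then show ?thesis
    by (simp add: F(2) G(2) germ_mult germ_add germ_partial_abs holo_near_mult holo_near_cpart F(1) G(1))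
qed

section \<open>Polynomial functions are holomorphic\<close>

lemma poly_eval_has_derivative':
  "(poly_eval P has_derivative (\<lambda>v. \<Sum>j\<in>UNIV. v $ j * poly_eval (poly_partial j P) x)) (at x)"
  using poly_eval_has_derivative[of P x] by (simp only: mult.commute)

lemma cdifferentiable_poly_eval: "cdifferentiable (poly_eval P) x"
  by (rule cdifferentiableI[OF poly_eval_has_derivative'])

lemma cpart_poly_eval: "cpart j (poly_eval P) x = poly_eval (poly_partial j P) x"
  by (rule cpartI[OF poly_eval_has_derivative'])

lemma holo_near_poly_eval: "holo_near (poly_eval P) x"
  unfolding holo_near_def by (intro always_eventually allI cdifferentiable_poly_eval)

section \<open>Powers of a finitely generated ideal\<close>

definition monoms :: "('l::finite \<Rightarrow> 'a::comm_ring_1) \<Rightarrow> nat \<Rightarrow> 'a set" where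
  "monoms \<xi> K = {\<Prod>l\<in>UNIV. \<xi> l ^ \<alpha> l | \<alpha>. (\<Sum>l\<in>UNIV. \<alpha> l) = K}"

lemma mult_monoms:
  fixes \<xi> :: "'l::finite \<Rightarrow> 'a::comm_ring_1"
  assumes "x \<in> monoms \<xi> K"
  shows "\<xi> l * x \<in> monoms \<xi> (Suc K)"
proof -
  obtain \<alpha> where \<alpha>: "x = (\<Prod>l\<in>UNIV. \<xi> l ^ \<alpha> l)" "(\<Sum>l\<in>UNIV. \<alpha> l) = K"
    using assms unfolding monoms_def by blast
  let ?\<beta> = "\<alpha>(l := Suc (\<alpha> l))"
  have "(\<Prod>k\<in>UNIV. \<xi> k ^ ?\<beta> k) = \<xi> l ^ Suc (\<alpha> l) * (\<Prod>k\<in>UNIV - {l}. \<xi> k ^ ?\<beta> k)"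
    by (subst prod.remove[of _ l]) auto
  also have "(\<Prod>k\<in>UNIV - {l}. \<xi> k ^ ?\<beta> k) = (\<Prod>k\<in>UNIV - {l}. \<xi> k ^ \<alpha> k)" by (rule prod.cong) auto
  also have "\<xi> l ^ Suc (\<alpha> l) * (\<Prod>k\<in>UNIV - {l}. \<xi> k ^ \<alpha> k) = \<xi> l * x"
    unfolding \<alpha>(1) by (subst prod.remove[of _ l]) (auto simp: mult.assoc)
  finally have "\<xi> l * x = (\<Prod>k\<in>UNIV. \<xi> k ^ ?\<beta> k)" by simp
  moreover have "(\<Sum>k\<in>UNIV. ?\<beta> k) = Suc K"
  proof -
    have "(\<Sum>k\<in>UNIV. ?\<beta> k) = Suc (\<alpha> l) + (\<Sum>k\<in>UNIV - {l}. ?\<beta> k)" by (subst sum.remove[of _ l]) auto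
    also have "(\<Sum>k\<in>UNIV - {l}. ?\<beta> k) = (\<Sum>k\<in>UNIV - {l}. \<alpha> k)" by (rule sum.cong) auto
    also have "Suc (\<alpha> l) + \<dots> = Suc (\<Sum>k\<in>UNIV. \<alpha> k)" by (subst (2) sum.remove[of _ l]) auto
    finally show ?thesis using \<alpha>(2) by simp
  qed
  ultimately show ?thesis unfolding monoms_def by blast
qed

lemma monoms_SucE:
  fixes \<xi> :: "'l::finite \<Rightarrow> 'a::comm_ring_1"
  assumes "x \<in> monoms \<xi> (Suc K)"
  obtains l y where "x = \<xi> l * y" "y \<in> monoms \<xi> K"
proof -
  obtain \<alpha> where \<alpha>: "x = (\<Prod>l\<in>UNIV. \<xi> l ^ \<alpha> l)" "(\<Sum>l\<in>UNIV. \<alpha> l) = Suc K"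
    using assms unfolding monoms_def by blast
  then obtain l where l: "\<alpha> l \<noteq> 0" by (metis sum.neutral Zero_not_Suc)
  let ?\<beta> = "\<alpha>(l := \<alpha> l - 1)"
  let ?y = "\<Prod>k\<in>UNIV. \<xi> k ^ ?\<beta> k"
  have "(\<Sum>k\<in>UNIV. ?\<beta> k) = (\<alpha> l - 1) + (\<Sum>k\<in>UNIV - {l}. ?\<beta> k)" by (subst sum.remove[of _ l]) auto
  also have "(\<Sum>k\<in>UNIV - {l}. ?\<beta> k) = (\<Sum>k\<in>UNIV - {l}. \<alpha> k)" by (rule sum.cong) auto
  also have "(\<alpha> l - 1) + \<dots> = (\<Sum>k\<in>UNIV. \<alpha> k) - 1" using l by (subst (2) sum.remove[of _ l]) auto
  finally have "?y \<in> monoms \<xi> K" using \<alpha>(2) unfolding monoms_def by fastforce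
  moreover have "x = \<xi> l * ?y"
  proof -
    have "?y = \<xi> l ^ (\<alpha> l - 1) * (\<Prod>k\<in>UNIV - {l}. \<xi> k ^ ?\<beta> k)"
      by (subst prod.remove[of _ l]) auto
    also have "(\<Prod>k\<in>UNIV - {l}. \<xi> k ^ ?\<beta> k) = (\<Prod>k\<in>UNIV - {l}. \<xi> k ^ \<alpha> k)" by (rule prod.cong) auto
    finally have "\<xi> l * ?y = \<xi> l ^ Suc (\<alpha> l - 1) * (\<Prod>k\<in>UNIV - {l}. \<xi> k ^ \<alpha> k)" by (simp add: mult.assoc)
    also have "\<dots> = x" unfolding \<alpha>(1) using l by (subst (2) prod.remove[of _ l]) auto
    finally show ?thesis ..
  qed
  ultimately show ?thesis using that by blast
qed

text \<open>The \<open>K\<close>-th power of the ideal generated by the family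
  \<open>\<xi>\<close>.\<close>

abbreviation ipow :: "('l::finite \<Rightarrow> 'a::comm_ring_1) \<Rightarrow> nat \<Rightarrow> 'a set" where
  "ipow \<xi> K \<equiv> ideal.span (monoms \<xi> K)"

lemma ipow_0: "x \<in> ipow \<xi> 0"
proof -
  have "1 \<in> monoms \<xi> 0" unfolding monoms_def by (auto intro!: exI[of _ "\<lambda>_. 0"])
  then have "x * 1 \<in> ipow \<xi> 0" by (intro ideal.span_scale ideal.span_base)
  then show ?thesis by simp
qed

lemma mult_ipow:
  assumes "x \<in> ipow \<xi> K"
  shows "\<xi> l * x \<in> ipow \<xi> (Suc K)"
  using assms
proof (induction rule: ideal.span_induct_alt)
  case (step c x y)
  have eq: "\<xi> l * (c * x + y) = c * (\<xi> l * x) + \<xi> l * y" by (simp add: algebra_simps)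
  show ?case
    unfolding eq by (intro ideal.span_add ideal.span_scale ideal.span_base[OF mult_monoms] step)
qed (simp add: ideal.span_zero)

lemma ipow_Suc_subset: "ipow \<xi> (Suc K) \<subseteq> ipow \<xi> K"
proof (rule ideal.span_minimal)
  show "monoms \<xi> (Suc K) \<subseteq> ipow \<xi> K"
    by (auto elim!: monoms_SucE intro: ideal.span_scale ideal.span_base)
qed simp

lemma finite_exponents: "finite {\<alpha> :: 'l::finite \<Rightarrow> nat. (\<Sum>l\<in>UNIV. \<alpha> l) = K}"
proof (rule finite_subset)
  show "{\<alpha> :: 'l \<Rightarrow> nat. (\<Sum>l\<in>UNIV. \<alpha> l) = K} \<subseteq> UNIV \<rightarrow>\<^sub>E {..K}"
    by (auto intro: member_le_sum)
qed (simp add: finite_PiE)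

section \<open>Local analytic charts\<close>

text \<open>Fixes the chart that \<open>local_equation\<close> hides under existential quantifiers,
  together with the inverse \<open>\<Psi>\<close> of the coordinate change.\<close>

locale germ_chart =
  fixes i :: "'k::finite" and \<sigma> :: "'n::finite \<Rightarrow> 'k" and \<Phi> \<Psi> :: "complex^'n \<Rightarrow> complex^'n"
  assumes \<sigma>: "bij_betw \<sigma> UNIV (UNIV - {i})"
    and holo_\<Phi>: "\<And>l. holo_near (\<lambda>y. \<Phi> y $ l) 0"
    and holo_\<Psi>: "\<And>l. holo_near (\<lambda>z. \<Psi> z $ l) (\<Phi> 0)"
    and \<Psi>\<Phi>: "\<forall>\<^sub>F y in nhds 0. \<Psi> (\<Phi> y) = y"
    and \<Phi>\<Psi>: "\<forall>\<^sub>F z in nhds (\<Phi> 0). \<Phi> (\<Psi> z) = z"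
begin

definition chart :: "complex^'n \<Rightarrow> complex^'k" where
  "chart z = affine_chart i \<sigma> (\<Phi> z)"

definition ev :: "'k mpoly \<Rightarrow> 'n hol_germ" where
  "ev P = abs_hol_germ (\<lambda>z. poly_eval P (chart z))"

text \<open>Affine coordinates centred at the base point \<open>chart 0\<close>. By
  \<open>germ_hadamard\<close> their images under \<open>ev\<close> generate the maximal ideal of
  germs.\<close>

definition loc :: "'n \<Rightarrow> 'k mpoly" where
  "loc l = X (\<sigma> l) - Cst (chart 0 $ \<sigma> l)"

section \<open>Coordinates of the chart and the ring homomorphism \<open>ev\<close> to germs\<close>

lemma \<sigma>_neq: "\<sigma> l \<noteq> i"
  using \<sigma> by (auto simp: bij_betw_def)

lemma \<sigma>_eq: "\<sigma> l = \<sigma> l' \<longleftrightarrow> l = l'"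
  using \<sigma> by (auto simp: bij_betw_def inj_on_def)

lemma index_cases: obtains "k = i" | l where "k = \<sigma> l"
  using \<sigma> by (auto simp: bij_betw_def)

lemma sum_split: "(\<Sum>k\<in>UNIV. h k) = h i + (\<Sum>l\<in>UNIV. h (\<sigma> l))"
proof -
  have "(\<Sum>k\<in>UNIV. h k) = h i + (\<Sum>k\<in>UNIV - {i}. h k)" by (rule sum.remove) auto
  also have "(\<Sum>k\<in>UNIV - {i}. h k) = (\<Sum>l\<in>UNIV. h (\<sigma> l))" by (rule sum.reindex_bij_betw[OF \<sigma>, symmetric])
  finally show ?thesis .
qed

lemma chart_i: "chart z $ i = 1"
  by (simp add: chart_def affine_chart_def sum_component axis_def \<sigma>_neq \<sigma>_neq[symmetric])

lemma chart_\<sigma>: "chart z $ \<sigma> l = \<Phi> z $ l"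
  by (auto simp: chart_def affine_chart_def sum_component axis_def \<sigma>_eq \<sigma>_neq \<sigma>_neq[symmetric] if_distrib cong: if_cong)

lemma holo_chart: "holo_near (\<lambda>z. chart z $ k) 0"
  by (rule index_cases[of k]) (auto simp: chart_i chart_\<sigma> holo_\<Phi> holo_near_const)

lemma holo_ev: "holo_near (\<lambda>z. poly_eval P (chart z)) 0"
  by (rule holo_near_compose) (auto simp: holo_chart holo_near_poly_eval)

lemma ev_add: "ev (P + Q) = ev P + ev Q"
  by (simp add: ev_def germ_add holo_ev)

lemma ev_mult: "ev (P * Q) = ev P * ev Q"
  by (simp add: ev_def germ_mult holo_ev)

lemma ev_0 [simp]: "ev 0 = 0"
  by (simp add: ev_def zero_hol_germ_def)

lemma ev_1 [simp]: "ev 1 = 1"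
  by (simp add: ev_def one_hol_germ_def)

lemma ev_diff: "ev (P - Q) = ev P - ev Q"
  using ev_add[of "P - Q" Q] by (simp add: algebra_simps)

lemma ev_sum: "ev (\<Sum>a\<in>A. P a) = (\<Sum>a\<in>A. ev (P a))"
  by (induction A rule: infinite_finite_induct) (auto simp: ev_add)

lemma ev_power: "ev (P ^ n) = ev P ^ n"
  by (induction n) (auto simp: ev_mult)

lemma ev_prod: "ev (\<Prod>a\<in>A. P a) = (\<Prod>a\<in>A. ev (P a))"
  by (induction A rule: infinite_finite_induct) (auto simp: ev_mult)

lemma ev_Xi: "ev (X i) = 1"
  by (simp add: ev_def one_hol_germ_def chart_i)

lemma germ_value_ev: "germ_value (ev P) = poly_eval P (chart 0)"
  by (simp add: ev_def germ_value_abs holo_ev)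

lemma loc_eval: "poly_eval (loc l) (chart z) = \<Phi> z $ l - \<Phi> 0 $ l"
  by (simp add: loc_def chart_\<sigma>)

lemma holo_\<Theta>: "holo_near (\<lambda>z. (\<Phi> z - \<Phi> 0) $ l) 0"
  by (simp add: holo_near_diff holo_\<Phi> holo_near_const)

lemma holo_\<Psi>': "holo_near (\<lambda>w. \<Psi> (\<Phi> 0 + w) $ l) 0"
proof -
  have "holo_near (\<lambda>w. (\<Phi> 0 + w) $ l) 0" for l
    by (simp add: holo_near_add holo_near_const holo_near_nth)
  then show ?thesis using holo_near_compose[of "\<lambda>w. \<Phi> 0 + w" 0 "\<lambda>z. \<Psi> z $ l"] holo_\<Psi> by simp
qed

lemma \<Psi>_\<Phi>0: "\<Psi> (\<Phi> 0) = 0"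
  using eventually_nhds_x_imp_x[OF \<Psi>\<Phi>] .

lemma \<Theta>_lim: "filterlim (\<lambda>z. \<Phi> z - \<Phi> 0) (nhds 0) (nhds 0)"
  using tendsto_vec_of_holo_near[of "\<lambda>z. \<Phi> z - \<Phi> 0" 0, OF holo_\<Theta>] by simp

lemma \<Psi>'_lim: "filterlim (\<lambda>w. \<Psi> (\<Phi> 0 + w)) (nhds 0) (nhds 0)"
  using tendsto_vec_of_holo_near[of "\<lambda>w. \<Psi> (\<Phi> 0 + w)" 0, OF holo_\<Psi>'] by (simp add: \<Psi>_\<Phi>0)

lemma \<Phi>\<Psi>': "\<forall>\<^sub>F w in nhds 0. \<Phi> (\<Psi> (\<Phi> 0 + w)) = \<Phi> 0 + w"
proof -
  have "filterlim (\<lambda>w. \<Phi> 0 + w) (nhds (\<Phi> 0 + 0)) (nhds 0)"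
    by (intro tendsto_add tendsto_const filterlim_ident)
  then show ?thesis using eventually_compose_filterlim[OF \<Phi>\<Psi>] by simp
qed

text \<open>\<open>hadamard\<close> is applied to \<open>F\<close> in the affine coordinates
  \<open>w = \<Phi> z - \<Phi> 0\<close>, that is, after composition with \<open>\<Psi>\<close>, and
  the result is pulled back. The factors are thus germs of polynomials although
  \<open>\<Phi>\<close> is only analytic.\<close>

lemma germ_hadamard:
  obtains H where "h = abs_hol_germ (\<lambda>_. germ_value h) + (\<Sum>l\<in>UNIV. ev (loc l) * H l)"
proof -
  obtain F where F: "holo_near F 0" "h = abs_hol_germ F" by (rule germ_cases)
  have "holo_near (\<lambda>w. F (\<Psi> (\<Phi> 0 + w))) 0"
    using holo_near_compose[of "\<lambda>w. \<Psi> (\<Phi> 0 + w)" 0 F, OF holo_\<Psi>'] F(1) by (simp add: \<Psi>_\<Phi>0)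
  then obtain G where G: "\<And>l. holo_near (G l) 0"
    and eq: "\<forall>\<^sub>F w in nhds 0. F (\<Psi> (\<Phi> 0 + w)) = F (\<Psi> (\<Phi> 0 + 0)) + (\<Sum>l\<in>UNIV. w $ l * G l w)"
    by (rule hadamard) blast
  have holoG: "holo_near (\<lambda>z. G l (\<Phi> z - \<Phi> 0)) 0" for l
    using holo_near_compose[of "\<lambda>z. \<Phi> z - \<Phi> 0" 0 "G l", OF holo_\<Theta>] G by simp
  have "\<forall>\<^sub>F z in nhds 0. F (\<Psi> (\<Phi> 0 + (\<Phi> z - \<Phi> 0))) = F (\<Psi> (\<Phi> 0 + 0))
      + (\<Sum>l\<in>UNIV. (\<Phi> z - \<Phi> 0) $ l * G l (\<Phi> z - \<Phi> 0))"
    using eventually_compose_filterlim[OF eq \<Theta>_lim] .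
  with \<Psi>\<Phi> have ev: "\<forall>\<^sub>F z in nhds 0. F z = F 0 + (\<Sum>l\<in>UNIV. (\<Phi> z $ l - \<Phi> 0 $ l) * G l (\<Phi> z - \<Phi> 0))"
    by eventually_elim (simp add: \<Psi>_\<Phi>0)
  have holo_term: "holo_near (\<lambda>z. (\<Phi> z $ l - \<Phi> 0 $ l) * G l (\<Phi> z - \<Phi> 0)) 0" for l
    by (intro holo_near_mult holoG holo_near_diff holo_\<Phi> holo_near_const)
  have "h = abs_hol_germ (\<lambda>z. F 0 + (\<Sum>l\<in>UNIV. (\<Phi> z $ l - \<Phi> 0 $ l) * G l (\<Phi> z - \<Phi> 0)))"
    unfolding F(2) by (intro abs_germ_eqI F(1) ev holo_near_add holo_near_const holo_near_sum holo_term)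
  also have "\<dots> = abs_hol_germ (\<lambda>_. F 0) + abs_hol_germ (\<lambda>z. \<Sum>l\<in>UNIV. (\<Phi> z $ l - \<Phi> 0 $ l) * G l (\<Phi> z - \<Phi> 0))"
    by (intro germ_add[symmetric] holo_near_const holo_near_sum holo_term)
  also have "abs_hol_germ (\<lambda>z. \<Sum>l\<in>UNIV. (\<Phi> z $ l - \<Phi> 0 $ l) * G l (\<Phi> z - \<Phi> 0))
     = (\<Sum>l\<in>UNIV. abs_hol_germ (\<lambda>z. (\<Phi> z $ l - \<Phi> 0 $ l) * G l (\<Phi> z - \<Phi> 0)))"
    by (intro germ_sum[symmetric] holo_term)
  also have "\<dots> = (\<Sum>l\<in>UNIV. ev (loc l) * abs_hol_germ (\<lambda>z. G l (\<Phi> z - \<Phi> 0)))"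
    unfolding ev_def loc_eval
    by (intro sum.cong refl germ_mult[symmetric] holoG holo_near_diff holo_\<Phi> holo_near_const)
  finally have "h = abs_hol_germ (\<lambda>_. F 0) + (\<Sum>l\<in>UNIV. ev (loc l) * abs_hol_germ (\<lambda>z. G l (\<Phi> z - \<Phi> 0)))" .
  moreover have gv: "germ_value h = F 0" by (simp add: F germ_value_abs)
  ultimately show ?thesis by (intro that) (simp only: gv)
qed

text \<open>Taylor polynomials in the affine coordinates, obtained by applying
  \<open>germ_hadamard\<close> repeatedly to the coefficients.\<close>

lemma germ_taylor: "\<exists>T. h - ev T \<in> ipow (\<lambda>l. ev (loc l)) K"
proof (induction K arbitrary: h)
  case 0
  show ?case using ipow_0 by blast
next
  case (Suc K)
  obtain H where H: "h = abs_hol_germ (\<lambda>_. germ_value h) + (\<Sum>l\<in>UNIV. ev (loc l) * H l)"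
    by (rule germ_hadamard)
  have "\<forall>l. \<exists>T. H l - ev T \<in> ipow (\<lambda>l. ev (loc l)) K" using Suc by blast
  then obtain T where T: "\<And>l. H l - ev (T l) \<in> ipow (\<lambda>l. ev (loc l)) K"
    using choice[of "\<lambda>l T. H l - ev T \<in> ipow (\<lambda>l. ev (loc l)) K"] by blast
  have c: "ev (Cst (germ_value h)) = abs_hol_germ (\<lambda>_. germ_value h)" by (simp add: ev_def)
  have "h - ev (Cst (germ_value h) + (\<Sum>l\<in>UNIV. loc l * T l)) = (\<Sum>l\<in>UNIV. ev (loc l) * (H l - ev (T l)))"
    by (subst H) (simp add: ev_add ev_sum ev_mult c sum_subtractf right_diff_distrib)
  also have "\<dots> \<in> ipow (\<lambda>l. ev (loc l)) (Suc K)"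
    by (intro ideal.span_sum mult_ipow[where \<xi> = "\<lambda>l. ev (loc l)"] T)
  finally show ?case by blast
qed

section \<open>Powers of the maximal ideal: germs compared with polynomials\<close>

lemma ideal_power_max_subset: "ideal_power max_ideal K \<subseteq> ipow (\<lambda>l. ev (loc l)) K"
  unfolding ideal_power_def germ_ideal_def
proof (rule ideal.span_minimal)
  have "(\<Prod>k<K. h k) \<in> ipow (\<lambda>l. ev (loc l)) K" if "\<forall>k<K. h k \<in> max_ideal" for h
    using that
  proof (induction K)
    case 0
    show ?case by (rule ipow_0)
  next
    case (Suc K)
    obtain H where "h K = abs_hol_germ (\<lambda>_. germ_value (h K)) + (\<Sum>l\<in>UNIV. ev (loc l) * H l)"
      by (rule germ_hadamard)
    moreover have "germ_value (h K) = 0" using Suc(2) by (simp add: max_ideal_def)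
    ultimately have hK: "h K = (\<Sum>l\<in>UNIV. ev (loc l) * H l)" by (simp flip: zero_hol_germ_def)
    have "(\<Prod>k<Suc K. h k) = (\<Sum>l\<in>UNIV. ev (loc l) * (H l * (\<Prod>k<K. h k)))"
      by (simp add: hK sum_distrib_left mult_ac)
    also have "\<dots> \<in> ipow (\<lambda>l. ev (loc l)) (Suc K)"
      using Suc by (intro ideal.span_sum mult_ipow[where \<xi> = "\<lambda>l. ev (loc l)"] ideal.span_scale) auto
    finally show ?case .
  qed
  then show "{\<Prod>k<K. h k |h. \<forall>k<K. h k \<in> max_ideal} \<subseteq> ipow (\<lambda>l. ev (loc l)) K" by blast
qed simp

text \<open>Translates algebraic membership into an order of vanishing, which can be compared with
  the homogeneity of a form.\<close>

lemma ipow_growth: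
  assumes "g \<in> ipow (\<lambda>l. ev (loc l)) K"
  shows "\<exists>B. \<forall>\<^sub>F z in nhds 0. norm (rep_hol_germ g z) \<le> B * norm (\<Phi> z - \<Phi> 0) ^ K"
  using assms
proof (induction rule: ideal.span_induct_alt)
  case base
  have "\<forall>\<^sub>F z in nhds 0. rep_hol_germ (0::'n hol_germ) z = 0"
    unfolding zero_hol_germ_def by (rule rep_abs_germ) (rule holo_near_const)
  then show ?case by (intro exI[of _ 0]) (auto elim: eventually_mono)
next
  case (step c x y)
  then obtain B where B: "\<forall>\<^sub>F z in nhds 0. norm (rep_hol_germ y z) \<le> B * norm (\<Phi> z - \<Phi> 0) ^ K" by blast
  obtain \<alpha> where \<alpha>: "x = (\<Prod>l\<in>UNIV. ev (loc l) ^ \<alpha> l)" "(\<Sum>l\<in>UNIV. \<alpha> l) = K"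
    using step(1) unfolding monoms_def by blast
  have x: "x = abs_hol_germ (\<lambda>z. \<Prod>l\<in>UNIV. (\<Phi> z $ l - \<Phi> 0 $ l) ^ \<alpha> l)"
  proof -
    have "x = ev (\<Prod>l\<in>UNIV. loc l ^ \<alpha> l)" by (simp add: \<alpha> ev_prod ev_power)
    then show ?thesis by (simp add: ev_def loc_eval)
  qed
  have holo_x: "holo_near (\<lambda>z. \<Prod>l\<in>UNIV. (\<Phi> z $ l - \<Phi> 0 $ l) ^ \<alpha> l) 0"
    using holo_ev[of "\<Prod>l\<in>UNIV. loc l ^ \<alpha> l"] by (simp add: loc_eval)
  let ?c = "rep_hol_germ c"
  have "c * x + y = abs_hol_germ (\<lambda>z. ?c z * (\<Prod>l\<in>UNIV. (\<Phi> z $ l - \<Phi> 0 $ l) ^ \<alpha> l) + rep_hol_germ y z)"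
    by (simp add: x holo_x holo_near_rep holo_near_mult abs_rep_germ flip: germ_add germ_mult)
  then have rep: "\<forall>\<^sub>F z in nhds 0. rep_hol_germ (c * x + y) z
      = ?c z * (\<Prod>l\<in>UNIV. (\<Phi> z $ l - \<Phi> 0 $ l) ^ \<alpha> l) + rep_hol_germ y z"
    using rep_abs_germ[of "\<lambda>z. ?c z * (\<Prod>l\<in>UNIV. (\<Phi> z $ l - \<Phi> 0 $ l) ^ \<alpha> l) + rep_hol_germ y z"]
    by (simp add: holo_near_add holo_near_mult holo_near_rep holo_x)
  have "(?c \<longlongrightarrow> ?c 0) (nhds 0)"
    using holo_near_isCont[OF holo_near_rep] by (simp add: isCont_def tendsto_at_iff_tendsto_nhds)
  then have "((\<lambda>z. norm (?c z)) \<longlongrightarrow> norm (?c 0)) (nhds 0)" by (rule tendsto_norm)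
  then have cb: "\<forall>\<^sub>F z in nhds 0. norm (?c z) < norm (?c 0) + 1" by (rule order_tendstoD) simp
  have xb: "norm (\<Prod>l\<in>UNIV. (\<Phi> z $ l - \<Phi> 0 $ l) ^ \<alpha> l) \<le> norm (\<Phi> z - \<Phi> 0) ^ K" for z
  proof -
    have "norm (\<Prod>l\<in>UNIV. (\<Phi> z $ l - \<Phi> 0 $ l) ^ \<alpha> l) = (\<Prod>l\<in>UNIV. norm ((\<Phi> z - \<Phi> 0) $ l) ^ \<alpha> l)"
      by (simp add: norm_power flip: prod_norm)
    also have "\<dots> \<le> (\<Prod>l\<in>UNIV. norm (\<Phi> z - \<Phi> 0) ^ \<alpha> l)"
      by (intro prod_mono conjI power_mono Finite_Cartesian_Product.norm_nth_le zero_le_power norm_ge_zero)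
    also have "\<dots> = norm (\<Phi> z - \<Phi> 0) ^ K" by (simp add: \<alpha>(2) flip: power_sum)
    finally show ?thesis .
  qed
  from rep B cb have "\<forall>\<^sub>F z in nhds 0. norm (rep_hol_germ (c * x + y) z)
      \<le> (norm (?c 0) + 1 + B) * norm (\<Phi> z - \<Phi> 0) ^ K"
  proof eventually_elim
    case (elim z)
    have "norm (rep_hol_germ (c * x + y) z)
       \<le> norm (?c z) * norm (\<Prod>l\<in>UNIV. (\<Phi> z $ l - \<Phi> 0 $ l) ^ \<alpha> l) + norm (rep_hol_germ y z)"
      unfolding elim(1) by (rule order_trans[OF norm_triangle_ineq]) (simp add: norm_mult)
    also have "\<dots> \<le> (norm (?c 0) + 1) * norm (\<Phi> z - \<Phi> 0) ^ K + B * norm (\<Phi> z - \<Phi> 0) ^ K"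
      using elim by (intro add_mono mult_mono xb) auto
    finally show ?case by (simp add: algebra_simps)
  qed
  then show ?case by blast
qed

text \<open>In the coordinates \<open>w = \<Phi> z - \<Phi> 0\<close> the polynomial
  \<open>Q\<close> is a form \<open>q\<close> of degree \<open>K\<close>, whereas membership bounds
  it near 0 by a multiple of \<open>norm w ^ Suc K\<close>. Along the ray \<open>t * w\<close>,
  division by \<open>t ^ K\<close> and \<open>t \<longlongrightarrow> 0\<close> from the right give
  \<open>q w = 0\<close>.\<close>

lemma form_in_ipow_vanishes:
  assumes Q: "Q = (\<Sum>\<alpha> | (\<Sum>l\<in>UNIV. \<alpha> l) = K. Cst (a \<alpha>) * (\<Prod>l\<in>UNIV. loc l ^ \<alpha> l))"
    and mem: "ev Q \<in> ipow (\<lambda>l. ev (loc l)) (Suc K)"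
  shows "Q = 0"
proof (rule poly_eval_eq_0_imp)
  define q where "q w = (\<Sum>\<alpha> | (\<Sum>l\<in>UNIV. \<alpha> l) = K. a \<alpha> * (\<Prod>l\<in>UNIV. (w $ l) ^ \<alpha> l))" for w :: "complex^'n"
  have q_scale: "q (t *s w) = t ^ K * q w" for t w
    unfolding q_def sum_distrib_left
    by (intro sum.cong) (auto simp: power_mult_distrib prod.distrib simp flip: power_sum)
  have evalQ: "poly_eval Q (chart z) = q (\<Phi> z - \<Phi> 0)" for z
    by (simp add: Q q_def loc_eval)
  obtain B where "\<forall>\<^sub>F z in nhds 0. norm (rep_hol_germ (ev Q) z) \<le> B * norm (\<Phi> z - \<Phi> 0) ^ Suc K"
    using ipow_growth[OF mem] by blast
  moreover have "\<forall>\<^sub>F z in nhds 0. rep_hol_germ (ev Q) z = q (\<Phi> z - \<Phi> 0)"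
    using rep_abs_germ[OF holo_ev[of Q]] unfolding ev_def evalQ .
  ultimately have "\<forall>\<^sub>F z in nhds 0. norm (q (\<Phi> z - \<Phi> 0)) \<le> B * norm (\<Phi> z - \<Phi> 0) ^ Suc K"
    by eventually_elim simp
  then have "\<forall>\<^sub>F w in nhds 0. norm (q (\<Phi> (\<Psi> (\<Phi> 0 + w)) - \<Phi> 0)) \<le> B * norm (\<Phi> (\<Psi> (\<Phi> 0 + w)) - \<Phi> 0) ^ Suc K"
    by (rule eventually_compose_filterlim[OF _ \<Psi>'_lim])
  with \<Phi>\<Psi>' have growth: "\<forall>\<^sub>F w in nhds 0. norm (q w) \<le> B * norm w ^ Suc K"
    by eventually_elim simp
  have q0: "q w = 0" for w
  proof -
    have "((\<lambda>t::real. complex_of_real t *s w) \<longlongrightarrow> 0) (at_right 0)"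
    proof (rule vec_tendstoI)
      fix l
      have "((\<lambda>t. complex_of_real t * w $ l) \<longlongrightarrow> complex_of_real 0 * w $ l) (at_right 0)"
        by (intro tendsto_intros)
      then show "((\<lambda>t. (complex_of_real t *s w) $ l) \<longlongrightarrow> 0 $ l) (at_right 0)" by simp
    qed
    then have "\<forall>\<^sub>F t in at_right 0. norm (q (complex_of_real t *s w)) \<le> B * norm (complex_of_real t *s w) ^ Suc K"
      by (rule eventually_compose_filterlim[OF growth])
    moreover have "\<forall>\<^sub>F t in at_right 0. (0::real) < t" by (simp add: eventually_at_right_less)
    ultimately have "\<forall>\<^sub>F t in at_right 0. norm (q w) \<le> B * norm w ^ Suc K * t"
    proof eventually_elim
      case (elim t)
      have n: "norm (complex_of_real t *s w) = t * norm w"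
      proof -
        have "complex_of_real t *s w = t *\<^sub>R w" by (simp add: vec_eq_iff scaleR_conv_of_real[of t "w $ _"])
        then show ?thesis using elim by simp
      qed
      have "t ^ K * norm (q w) \<le> B * (t * norm w) ^ Suc K"
        using elim unfolding q_scale n by (simp add: norm_mult norm_power)
      also have "\<dots> = t ^ K * (B * norm w ^ Suc K * t)" by (simp add: power_mult_distrib mult_ac)
      finally show ?case using elim by simp
    qed
    moreover have "((\<lambda>t. B * norm w ^ Suc K * t) \<longlongrightarrow> B * norm w ^ Suc K * 0) (at_right 0)"
      by (intro tendsto_intros)
    ultimately have "norm (q w) \<le> B * norm w ^ Suc K * 0"
      by (intro tendsto_lowerbound[where f = "\<lambda>t. B * norm w ^ Suc K * t" and F = "at_right 0"]) auto
    then show ?thesis by simp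
  qed
  fix x
  have "poly_eval Q x = q (\<chi> l. x $ \<sigma> l - chart 0 $ \<sigma> l)"
    by (simp add: Q q_def loc_def)
  then show "poly_eval Q x = 0" by (simp add: q0)
qed

lemma ev_ipow:
  assumes "P \<in> ideal.span (insert (X i - 1) (monoms loc K))"
  shows "ev P \<in> ipow (\<lambda>l. ev (loc l)) K"
  using assms
proof (induction rule: ideal.span_induct_alt)
  case (step c x y)
  have "ev x \<in> ipow (\<lambda>l. ev (loc l)) K"
  proof (cases "x = X i - 1")
    case True
    then show ?thesis by (simp add: ev_diff ev_Xi ideal.span_zero)
  next
    case False
    then have "x \<in> monoms loc K" using step(1) by blast
    then have "ev x \<in> monoms (\<lambda>l. ev (loc l)) K"
      unfolding monoms_def by (auto simp: ev_prod ev_power)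
    then show ?thesis by (rule ideal.span_base)
  qed
  then show ?case using step by (auto simp: ev_add ev_mult intro: ideal.span_add ideal.span_scale)
qed (simp add: ideal.span_zero)

text \<open>Modulo the next power each coefficient may be replaced by its value at the base point,
  because the difference lies in the ideal of that point.\<close>

lemma leading_form:
  assumes "P \<in> ideal.span (insert (X i - 1) (monoms loc K))"
  shows "\<exists>a. P - (\<Sum>\<alpha> | (\<Sum>l\<in>UNIV. \<alpha> l) = K. Cst (a \<alpha>) * (\<Prod>l\<in>UNIV. loc l ^ \<alpha> l))
     \<in> ideal.span (insert (X i - 1) (monoms loc (Suc K)))"
  using assms
proof (induction rule: ideal.span_induct_alt)
  case base
  show ?case by (rule exI[of _ "\<lambda>_. 0"]) (simp add: ideal.span_zero)
next
  case (step c x y)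
  let ?J = "ideal.span (insert (X i - 1) (monoms loc (Suc K)))"
  let ?Q = "\<lambda>a. \<Sum>\<alpha> | (\<Sum>l\<in>UNIV. \<alpha> l) = K. Cst (a \<alpha>) * (\<Prod>l\<in>UNIV. loc l ^ \<alpha> l)"
  obtain a where a: "y - ?Q a \<in> ?J" using step by blast
  show ?case
  proof (cases "x = X i - 1")
    case True
    have "c * x + y - ?Q a = c * x + (y - ?Q a)" by simp
    also have "\<dots> \<in> ?J" by (intro ideal.span_add a ideal.span_scale ideal.span_base) (simp add: True)
    finally show ?thesis by blast
  next
    case False
    then obtain \<beta> where \<beta>: "x = (\<Prod>l\<in>UNIV. loc l ^ \<beta> l)" "(\<Sum>l\<in>UNIV. \<beta> l) = K"
      using step(1) unfolding monoms_def by blast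
    have x: "x \<in> monoms loc K" using step(1) False by blast
    let ?v = "poly_eval c (chart 0)"
    have "c - Cst ?v \<in> ideal.span (insert (X i - 1) (range loc))"
    proof (rule congruent_value[OF ideal.subspace_span])
      fix j
      show "X j - Cst (chart 0 $ j) \<in> ideal.span (insert (X i - 1) (range loc))"
      proof (rule index_cases[of j])
        assume "j = i"
        then show ?thesis by (simp add: chart_i ideal.span_base)
      next
        fix l assume "j = \<sigma> l"
        then show ?thesis using ideal.span_base[of "loc l"] by (simp add: loc_def)
      qed
    qed
    then have cx: "(c - Cst ?v) * x \<in> ?J"
    proof (induction rule: ideal.span_induct_alt)
      case (step b p r)
      have "p * x \<in> ?J"
        using step(1) mult_monoms[OF x] ideal.span_base[of "X i - 1"] ideal.span_scale[of "X i - 1" _ x]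
        by (auto intro: ideal.span_base simp: mult.commute)
      moreover have "(b * p + r) * x = b * (p * x) + r * x" by (simp add: algebra_simps)
      ultimately show ?case using step by (auto intro: ideal.span_add ideal.span_scale)
    qed (simp add: ideal.span_zero)
    have eq: "?Q (a(\<beta> := a \<beta> + ?v)) = ?Q a + Cst ?v * x"
    proof -
      have "?Q (a(\<beta> := a \<beta> + ?v))
          = (\<Sum>\<alpha> | (\<Sum>l\<in>UNIV. \<alpha> l) = K. Cst (a \<alpha>) * (\<Prod>l\<in>UNIV. loc l ^ \<alpha> l) + (if \<alpha> = \<beta> then Cst ?v * x else 0))"
        by (intro sum.cong refl) (auto simp: single_add distrib_right \<beta>(1))
      then show ?thesis using \<beta>(2) by (simp add: sum.distrib finite_exponents sum.delta)
    qed
    have "(c - Cst ?v) * x + (y - ?Q a) = c * x + y - ?Q (a(\<beta> := a \<beta> + ?v))"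
      unfolding eq by (simp add: left_diff_distrib)
    then have "c * x + y - ?Q (a(\<beta> := a \<beta> + ?v)) \<in> ?J" using ideal.span_add[OF cx a] by (simp only:)
    then show ?thesis by blast
  qed
qed

text \<open>
  A polynomial that lies in a power of the maximal ideal of germs lies in that power of the ideal of the
  point: its leading form would otherwise decay faster than homogeneity permits.
\<close>

lemma ipow_algebraic:
  assumes "ev P \<in> ipow (\<lambda>l. ev (loc l)) K"
  shows "P \<in> ideal.span (insert (X i - 1) (monoms loc K))"
  using assms
proof (induction K)
  case 0
  have "ipow loc 0 \<subseteq> ideal.span (insert (X i - 1) (monoms loc 0))" by (rule ideal.span_mono) blast
  then show ?case using ipow_0 by blast
next
  case (Suc K)
  then have "P \<in> ideal.span (insert (X i - 1) (monoms loc K))" using ipow_Suc_subset by blast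
  then obtain a where "P - (\<Sum>\<alpha> | (\<Sum>l\<in>UNIV. \<alpha> l) = K. Cst (a \<alpha>) * (\<Prod>l\<in>UNIV. loc l ^ \<alpha> l))
     \<in> ideal.span (insert (X i - 1) (monoms loc (Suc K)))"
    using leading_form by blast
  moreover define Q where "Q = (\<Sum>\<alpha> | (\<Sum>l\<in>UNIV. \<alpha> l) = K. Cst (a \<alpha>) * (\<Prod>l\<in>UNIV. loc l ^ \<alpha> l))"
  ultimately have a: "P - Q \<in> ideal.span (insert (X i - 1) (monoms loc (Suc K)))" by simp
  have "ev Q = ev P - ev (P - Q)" by (simp add: ev_diff)
  also have "\<dots> \<in> ipow (\<lambda>l. ev (loc l)) (Suc K)" by (intro ideal.span_diff Suc(2) ev_ipow a)
  finally have "Q = 0" by (rule form_in_ipow_vanishes[OF Q_def])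
  then show ?case using a by simp
qed

text \<open>The analytic coefficients of \<open>L\<close> are replaced by Taylor polynomials. The
  error \<open>P\<close> is a polynomial in the \<open>K\<close>-th power of the maximal ideal of
  germs, hence by \<open>ipow_algebraic\<close> in the corresponding power of the ideal of the
  point, and \<open>e\<close> multiplies that power into the target ideal.\<close>

lemma local_membership:
  fixes F :: "'j::finite \<Rightarrow> 'k mpoly"
  assumes L: "ev L \<in> germ_ideal (range (\<lambda>j. ev (F j)))"
    and e: "\<And>x. x \<in> monoms loc K \<Longrightarrow> e * x \<in> ideal.span (insert (X i - 1) (range F))"
  shows "e * L \<in> ideal.span (insert (X i - 1) (range F))"
proof -
  let ?I = "ideal.span (insert (X i - 1) (range F))"
  obtain c where c: "ev L = (\<Sum>j\<in>UNIV. c j * ev (F j))"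
    using L in_span_image_iff[of UNIV "ev L" "\<lambda>j. ev (F j)"] unfolding germ_ideal_def by auto
  obtain T where T: "\<And>j. c j - ev (T j) \<in> ipow (\<lambda>l. ev (loc l)) K"
    using choice[of "\<lambda>j T. c j - ev T \<in> ipow (\<lambda>l. ev (loc l)) K"] germ_taylor by blast
  define P where "P = L - (\<Sum>j\<in>UNIV. T j * F j)"
  have "ev P = (\<Sum>j\<in>UNIV. ev (F j) * (c j - ev (T j)))"
    by (simp add: P_def ev_diff ev_sum ev_mult c sum_subtractf algebra_simps)
  also have "\<dots> \<in> ipow (\<lambda>l. ev (loc l)) K" by (intro ideal.span_sum ideal.span_scale T)
  finally have "P \<in> ideal.span (insert (X i - 1) (monoms loc K))" by (rule ipow_algebraic)
  then have "e * P \<in> ?I"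
  proof (induction rule: ideal.span_induct_alt)
    case (step c x y)
    have "e * x \<in> ?I"
      using step(1) e by (auto intro: ideal.span_scale ideal.span_base)
    moreover have "e * (c * x + y) = c * (e * x) + e * y" by (simp add: algebra_simps)
    ultimately show ?case using step by (auto intro: ideal.span_add ideal.span_scale)
  qed (simp add: ideal.span_zero)
  moreover have "(\<Sum>j\<in>UNIV. (e * T j) * F j) \<in> ?I"
    by (intro ideal.span_sum ideal.span_scale ideal.span_base) blast
  ultimately have "e * P + (\<Sum>j\<in>UNIV. (e * T j) * F j) \<in> ?I" by (rule ideal.span_add)
  moreover have "e * P + (\<Sum>j\<in>UNIV. (e * T j) * F j) = e * L"
    by (simp add: P_def algebra_simps sum_distrib_left)
  ultimately show ?thesis by (simp only:)
qed

text \<open>\<open>ev e\<close> is a unit, since \<open>e\<close> does not vanish at the base point.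
  The exponent \<open>K\<close> obtained this way shows that the \<open>LEAST\<close> in
  \<open>a_inv\<close> is attained.\<close>

lemma ideal_power_subset:
  fixes F :: "'j::finite \<Rightarrow> 'k mpoly"
  assumes e: "\<And>x. x \<in> monoms loc K \<Longrightarrow> e * x \<in> ideal.span (insert (X i - 1) (range F))"
    and ne: "poly_eval e (chart 0) \<noteq> 0"
  shows "ideal_power max_ideal K \<subseteq> germ_ideal (range (\<lambda>j. ev (F j)))"
proof -
  obtain h where h: "h * ev e = 1" using germ_unit[of "ev e"] ne by (auto simp: germ_value_ev)
  have evI: "ev P \<in> germ_ideal (range (\<lambda>j. ev (F j)))" if "P \<in> ideal.span (insert (X i - 1) (range F))" for P
    using that unfolding germ_ideal_def
  proof (induction rule: ideal.span_induct_alt)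
    case (step c x y)
    have "ev x \<in> ideal.span (range (\<lambda>j. ev (F j)))"
      using step(1) by (auto simp: ev_diff ev_Xi ideal.span_zero intro: ideal.span_base)
    then show ?case using step by (auto simp: ev_add ev_mult intro: ideal.span_add ideal.span_scale)
  qed (simp add: ideal.span_zero)
  have "ipow (\<lambda>l. ev (loc l)) K \<subseteq> germ_ideal (range (\<lambda>j. ev (F j)))"
    unfolding germ_ideal_def
  proof (rule ideal.span_minimal, rule subsetI)
    fix x assume "x \<in> monoms (\<lambda>l. ev (loc l)) K"
    then obtain \<alpha> where \<alpha>: "x = ev (\<Prod>l\<in>UNIV. loc l ^ \<alpha> l)" "(\<Sum>l\<in>UNIV. \<alpha> l) = K"
      unfolding monoms_def by (auto simp: ev_prod ev_power)
    then have "ev (e * (\<Prod>l\<in>UNIV. loc l ^ \<alpha> l)) \<in> germ_ideal (range (\<lambda>j. ev (F j)))"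
      by (intro evI e) (auto simp: monoms_def)
    then have "h * (ev e * x) \<in> germ_ideal (range (\<lambda>j. ev (F j)))"
      unfolding germ_ideal_def \<alpha>(1) ev_mult by (rule ideal.span_scale)
    then show "x \<in> ideal.span (range (\<lambda>j. ev (F j)))"
      unfolding germ_ideal_def by (simp add: h flip: mult.assoc)
  qed simp
  then show ?thesis using ideal_power_max_subset by blast
qed

section \<open>Coordinate changes and the Tjurina ideal\<close>

definition jac :: "'n \<Rightarrow> 'n \<Rightarrow> 'n hol_germ" where
  "jac m l = abs_hol_germ (cpart m (\<lambda>z. \<Phi> z $ l))"

text \<open>The derivative of \<open>\<Psi>\<close> is pulled back along \<open>\<Phi>\<close>, so
  that the entries of both matrices are germs in the same variable \<open>z\<close> and can be
  multiplied.\<close>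

definition jac_inv :: "'n \<Rightarrow> 'n \<Rightarrow> 'n hol_germ" where
  "jac_inv l m = abs_hol_germ (\<lambda>z. cpart l (\<lambda>w. \<Psi> (\<Phi> 0 + w) $ m) (\<Phi> z - \<Phi> 0))"

lemma germ_partial_ev: "germ_partial m (ev P) = (\<Sum>l\<in>UNIV. ev (poly_partial (\<sigma> l) P) * jac m l)"
proof -
  have "\<forall>\<^sub>F z in nhds 0. \<forall>l. cdifferentiable (\<lambda>y. \<Phi> y $ l) z"
    using holo_\<Phi> unfolding holo_near_def by (simp add: eventually_all_finite)
  then have "\<forall>\<^sub>F z in nhds 0. cpart m (\<lambda>z. poly_eval P (chart z)) z
      = (\<Sum>l\<in>UNIV. poly_eval (poly_partial (\<sigma> l) P) (chart z) * cpart m (\<lambda>z. \<Phi> z $ l) z)"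
  proof eventually_elim
    case (elim z)
    have "cdifferentiable (\<lambda>z. chart z $ k) z" for k
      by (rule index_cases[of k]) (use elim in \<open>auto simp: chart_i chart_\<sigma> cdifferentiable_const\<close>)
    then have "cpart m (\<lambda>z. poly_eval P (chart z)) z
        = (\<Sum>k\<in>UNIV. cpart k (poly_eval P) (chart z) * cpart m (\<lambda>z. chart z $ k) z)"
      by (intro cpartI[OF chain_rule_cpart] cdifferentiable_poly_eval)
    also have "\<dots> = cpart i (poly_eval P) (chart z) * cpart m (\<lambda>z. 1) z
        + (\<Sum>l\<in>UNIV. cpart (\<sigma> l) (poly_eval P) (chart z) * cpart m (\<lambda>z. \<Phi> z $ l) z)"
      by (simp add: sum_split chart_i chart_\<sigma>)
    also have "cpart m (\<lambda>z. 1) z = 0" by (simp add: cpart_def)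
    finally show ?case by (simp add: cpart_poly_eval)
  qed
  then have "abs_hol_germ (cpart m (\<lambda>z. poly_eval P (chart z)))
     = abs_hol_germ (\<lambda>z. \<Sum>l\<in>UNIV. poly_eval (poly_partial (\<sigma> l) P) (chart z) * cpart m (\<lambda>z. \<Phi> z $ l) z)"
    by (intro abs_germ_eqI holo_near_cpart holo_ev holo_near_sum holo_near_mult holo_\<Phi>)
  also have "\<dots> = (\<Sum>l\<in>UNIV. abs_hol_germ (\<lambda>z. poly_eval (poly_partial (\<sigma> l) P) (chart z) * cpart m (\<lambda>z. \<Phi> z $ l) z))"
    by (intro germ_sum[symmetric] holo_near_mult holo_near_cpart holo_ev holo_\<Phi>)
  also have "\<dots> = (\<Sum>l\<in>UNIV. ev (poly_partial (\<sigma> l) P) * jac m l)"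
    unfolding ev_def jac_def by (intro sum.cong refl germ_mult[symmetric] holo_near_cpart holo_ev holo_\<Phi>)
  finally show ?thesis by (simp add: ev_def germ_partial_abs holo_ev)
qed

text \<open>The chain rule for \<open>\<Phi> (\<Psi> (\<Phi> 0 + w)) = \<Phi> 0 + w\<close>, pulled
  back along \<open>\<Phi>\<close>.\<close>

lemma jac_inv_jac: "(\<Sum>m\<in>UNIV. jac_inv l' m * jac m l) = (if l = l' then 1 else 0)"
proof -
  have "\<forall>\<^sub>F z in nhds 0. \<forall>l. cdifferentiable (\<lambda>y. \<Phi> y $ l) z"
    using holo_\<Phi> unfolding holo_near_def by (simp add: eventually_all_finite)
  then have 1: "\<forall>\<^sub>F w in nhds 0. \<forall>l. cdifferentiable (\<lambda>y. \<Phi> y $ l) (\<Psi> (\<Phi> 0 + w))"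
    by (rule eventually_compose_filterlim[OF _ \<Psi>'_lim])
  have 2: "\<forall>\<^sub>F w in nhds 0. \<forall>m. cdifferentiable (\<lambda>w. \<Psi> (\<Phi> 0 + w) $ m) w"
    using holo_\<Psi>' unfolding holo_near_def by (simp add: eventually_all_finite)
  have 3: "\<forall>\<^sub>F w in nhds 0. \<forall>\<^sub>F w' in nhds w. \<Phi> (\<Psi> (\<Phi> 0 + w')) = \<Phi> 0 + w'"
    using \<Phi>\<Psi>' by (simp add: eventually_eventually)
  from 1 2 3 have "\<forall>\<^sub>F w in nhds 0. (\<Sum>m\<in>UNIV. cpart m (\<lambda>z. \<Phi> z $ l) (\<Psi> (\<Phi> 0 + w)) * cpart l' (\<lambda>w. \<Psi> (\<Phi> 0 + w) $ m) w)
      = (if l = l' then 1 else 0)"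
  proof eventually_elim
    case (elim w)
    have "cpart l' (\<lambda>w. \<Phi> (\<Psi> (\<Phi> 0 + w)) $ l) w
      = (\<Sum>m\<in>UNIV. cpart m (\<lambda>z. \<Phi> z $ l) (\<Psi> (\<Phi> 0 + w)) * cpart l' (\<lambda>w. \<Psi> (\<Phi> 0 + w) $ m) w)"
      by (rule cpartI, rule chain_rule_cpart) (use elim in auto)
    moreover have "cpart l' (\<lambda>w. \<Phi> (\<Psi> (\<Phi> 0 + w)) $ l) w = cpart l' (\<lambda>w. \<Phi> 0 $ l + w $ l) w"
      using elim(3) by (intro cpart_cong) (auto elim: eventually_mono)
    moreover have "cpart l' (\<lambda>w. \<Phi> 0 $ l + w $ l) w = (if l = l' then 1 else 0)"
    proof -
      have "((\<lambda>w. \<Phi> 0 $ l + w $ l) has_derivative (\<lambda>v. 0 + v $ l)) (at w)"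
        by (intro has_derivative_add has_derivative_const bounded_linear_imp_has_derivative bounded_linear_vec_nth)
      then have "((\<lambda>w. \<Phi> 0 $ l + w $ l) has_derivative (\<lambda>v. \<Sum>j\<in>UNIV. v $ j * (if l = j then 1 else 0))) (at w)"
        by (simp add: if_distrib cong: if_cong)
      then show ?thesis by (rule cpartI)
    qed
    ultimately show ?case by simp
  qed
  then have "\<forall>\<^sub>F z in nhds 0. (\<Sum>m\<in>UNIV. cpart m (\<lambda>z. \<Phi> z $ l) (\<Psi> (\<Phi> 0 + (\<Phi> z - \<Phi> 0)))
       * cpart l' (\<lambda>w. \<Psi> (\<Phi> 0 + w) $ m) (\<Phi> z - \<Phi> 0)) = (if l = l' then 1 else 0)"
    by (rule eventually_compose_filterlim[OF _ \<Theta>_lim])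
  with \<Psi>\<Phi> have ev: "\<forall>\<^sub>F z in nhds 0. (\<Sum>m\<in>UNIV. cpart l' (\<lambda>w. \<Psi> (\<Phi> 0 + w) $ m) (\<Phi> z - \<Phi> 0) * cpart m (\<lambda>z. \<Phi> z $ l) z)
      = (if l = l' then 1 else 0)"
    by eventually_elim (simp add: mult.commute)
  have holo: "holo_near (\<lambda>z. cpart l' (\<lambda>w. \<Psi> (\<Phi> 0 + w) $ m) (\<Phi> z - \<Phi> 0)) 0" for m
    using holo_near_compose[of "\<lambda>z. \<Phi> z - \<Phi> 0" 0 "cpart l' (\<lambda>w. \<Psi> (\<Phi> 0 + w) $ m)", OF holo_\<Theta>]
      holo_near_cpart[OF holo_\<Psi>'] by simp
  have "(\<Sum>m\<in>UNIV. jac_inv l' m * jac m l)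
      = (\<Sum>m\<in>UNIV. abs_hol_germ (\<lambda>z. cpart l' (\<lambda>w. \<Psi> (\<Phi> 0 + w) $ m) (\<Phi> z - \<Phi> 0) * cpart m (\<lambda>z. \<Phi> z $ l) z))"
    unfolding jac_def jac_inv_def by (intro sum.cong refl germ_mult holo holo_near_cpart holo_\<Phi>)
  also have "\<dots> = abs_hol_germ (\<lambda>z. \<Sum>m\<in>UNIV. cpart l' (\<lambda>w. \<Psi> (\<Phi> 0 + w) $ m) (\<Phi> z - \<Phi> 0) * cpart m (\<lambda>z. \<Phi> z $ l) z)"
    by (intro germ_sum holo_near_mult holo holo_near_cpart holo_\<Phi>)
  also have "\<dots> = abs_hol_germ (\<lambda>z. if l = l' then 1 else 0)"
    by (intro abs_germ_eqI ev holo_near_sum holo_near_mult holo holo_near_cpart holo_\<Phi> holo_near_const)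
  also have "\<dots> = (if l = l' then 1 else 0)" by (simp add: one_hol_germ_def zero_hol_germ_def)
  finally show ?thesis .
qed

text \<open>The unit \<open>u\<close> and the invertible Jacobian matrix do not change the ideal.
  Euler's identity with \<open>x_i = 1\<close> puts \<open>f\<close> into the ideal of its partial
  derivatives and, conversely, recovers the partial derivative in direction \<open>i\<close>, which
  the chart does not see, from \<open>f\<close> and the other ones.\<close>

lemma tjurina_ideal_eq:
  assumes f: "f \<in> homog_part (int N)" and N: "N > 0" and u: "u dvd 1" and ug: "ev f = u * g"
  shows "tjurina_ideal g = germ_ideal (range (\<lambda>j. ev (poly_partial j f)))"
proof
  let ?J = "ideal.span (range (\<lambda>j. ev (poly_partial j f)))"
  let ?T = "ideal.span (insert g (range (\<lambda>m. germ_partial m g)))"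
  obtain u' where u': "u * u' = 1" using u by (metis dvdE)
  have g: "g = u' * ev f" unfolding ug using u' by (simp add: mult.commute mult.left_commute)
  have "ev (Cst (of_nat N)) * ev f = (\<Sum>j\<in>UNIV. ev (X j) * ev (poly_partial j f))"
    using arg_cong[OF Euler_identity[OF f], of ev] by (simp only: ev_mult ev_sum)
  note euler = this
  have "Cst (1 / of_nat N) * Cst (of_nat N) = (1 :: 'k mpoly)"
    unfolding mult_single using N by simp
  then have "ev (Cst (1 / of_nat N)) * ev (Cst (of_nat N)) = 1"
    by (simp only: ev_1 flip: ev_mult)
  then have "ev f = ev (Cst (1 / of_nat N)) * (\<Sum>j\<in>UNIV. ev (X j) * ev (poly_partial j f))"
    by (simp only: mult_1_left flip: euler mult.assoc)
  also have "\<dots> \<in> ?J" by (intro ideal.span_scale ideal.span_sum ideal.span_base) blast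
  finally have fJ: "ev f \<in> ?J" .
  have "?T \<subseteq> ?J"
  proof (rule ideal.span_minimal)
    have t: "ev (poly_partial (\<sigma> l) f) * jac m l \<in> ?J" for l m
      by (subst mult.commute, intro ideal.span_scale ideal.span_base) blast
    have "germ_partial m g \<in> ?J" for m
      unfolding g germ_partial_mult germ_partial_ev
      by (intro ideal.span_add ideal.span_scale[OF fJ] ideal.span_scale ideal.span_sum t)
    moreover have "g \<in> ?J" unfolding g by (rule ideal.span_scale[OF fJ])
    ultimately show "insert g (range (\<lambda>m. germ_partial m g)) \<subseteq> ?J" by blast
  qed simp
  then show "tjurina_ideal g \<subseteq> germ_ideal (range (\<lambda>j. ev (poly_partial j f)))"
    by (simp add: tjurina_ideal_def germ_ideal_def)
  have fT: "ev f \<in> ?T" unfolding ug by (intro ideal.span_scale ideal.span_base) simp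
  have pT: "germ_partial m (ev f) \<in> ?T" for m
  proof -
    have "germ_partial m (ev f) = germ_partial m u * g + u * germ_partial m g"
      by (simp only: ug germ_partial_mult)
    also have "\<dots> \<in> ?T" by (intro ideal.span_add ideal.span_scale ideal.span_base) auto
    finally show ?thesis .
  qed
  have \<sigma>T: "ev (poly_partial (\<sigma> l') f) \<in> ?T" for l'
  proof -
    have "(\<Sum>m\<in>UNIV. jac_inv l' m * germ_partial m (ev f))
      = (\<Sum>m\<in>UNIV. \<Sum>l\<in>UNIV. ev (poly_partial (\<sigma> l) f) * (jac_inv l' m * jac m l))"
      unfolding germ_partial_ev sum_distrib_left by (intro sum.cong refl) (simp add: mult_ac)
    also have "\<dots> = (\<Sum>l\<in>UNIV. ev (poly_partial (\<sigma> l) f) * (\<Sum>m\<in>UNIV. jac_inv l' m * jac m l))"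
      by (subst sum.swap) (simp add: sum_distrib_left)
    also have "\<dots> = ev (poly_partial (\<sigma> l') f)" by (simp add: jac_inv_jac if_distrib cong: if_cong)
    finally have "ev (poly_partial (\<sigma> l') f) = (\<Sum>m\<in>UNIV. jac_inv l' m * germ_partial m (ev f))" ..
    also have "\<dots> \<in> ?T" by (intro ideal.span_sum ideal.span_scale pT)
    finally show ?thesis .
  qed
  have "ev (poly_partial i f) = ev (Cst (of_nat N)) * ev f - (\<Sum>l\<in>UNIV. ev (X (\<sigma> l)) * ev (poly_partial (\<sigma> l) f))"
    unfolding euler by (simp add: sum_split ev_Xi)
  also have "\<dots> \<in> ?T" by (intro ideal.span_diff ideal.span_scale fT ideal.span_sum \<sigma>T)
  finally have iT: "ev (poly_partial i f) \<in> ?T" .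
  have "ev (poly_partial j f) \<in> ?T" for j
    by (rule index_cases[of j]) (use iT \<sigma>T in auto)
  then have "?J \<subseteq> ?T" by (intro ideal.span_minimal) auto
  then show "germ_ideal (range (\<lambda>j. ev (poly_partial j f))) \<subseteq> tjurina_ideal g"
    by (simp add: tjurina_ideal_def germ_ideal_def)
qed

end

section \<open>The Jacobian ideal at a singular point\<close>

text \<open>All components of \<open>p - b * (X i - 1)\<close> lie in \<open>?I\<close>. Below
  degree \<open>m\<close> this puts the components of \<open>b\<close> into \<open>?I\<close>; from
  degree \<open>m\<close> on it makes the component of degree \<open>m + j\<close> congruent to
  \<open>- X i ^ j * p\<close>. Since \<open>b\<close> has only finitely many nonzero components,
  some \<open>X i ^ j * p\<close> lies in \<open>?I\<close>.\<close>

lemma dehomogenize: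
  fixes F :: "'j \<Rightarrow> 'k::finite mpoly"
  assumes F: "\<And>j. F j \<in> homog_part d" and p: "p \<in> homog_part (int m)"
    and mem: "p \<in> ideal.span (insert (X i - 1) (range F))"
  shows "\<exists>k. X i ^ k * p \<in> ideal.span (range F)"
proof -
  let ?I = "ideal.span (range F)"
  have homF: "\<And>q. q \<in> range F \<Longrightarrow> \<exists>d. q \<in> homog_part d" using F by blast
  obtain b where "p - b * (X i - 1) \<in> ?I" using mem by (auto simp: ideal.span_breakdown_eq)
  then have "homog_comp k (p - b * (X i - 1)) \<in> ?I" for k by (rule homog_comp_in_span[rotated]) (rule homF)
  moreover have "homog_comp k (p - b * (X i - 1)) = homog_comp k p - homog_comp (k - 1) b * X i + homog_comp k b" for k
    by (simp add: homog_comp_diff right_diff_distrib homog_comp_mult_homog[OF homog_X])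
  ultimately have A: "homog_comp k p - homog_comp (k - 1) b * X i + homog_comp k b \<in> ?I" for k by simp
  have low: "homog_comp (int k) b \<in> ?I" if "k < m" for k
    using that
  proof (induction k)
    case 0
    then show ?case using A[of 0] p by (simp add: homog_comp_of_homog homog_comp_neg)
  next
    case (Suc k)
    have "homog_comp (int (Suc k)) b = (homog_comp (int (Suc k)) p - homog_comp (int (Suc k) - 1) b * X i + homog_comp (int (Suc k)) b)
        + X i * homog_comp (int k) b"
      using p Suc(2) by (simp add: homog_comp_of_homog mult.commute)
    also have "\<dots> \<in> ?I" using Suc by (intro ideal.span_add A ideal.span_scale) auto
    finally show ?case .
  qed
  have high: "homog_comp (int m + int j) b + X i ^ j * p \<in> ?I" for j
  proof (induction j)
    case 0
    have prev: "homog_comp (int m - 1) b \<in> ?I"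
      using low[of "m - 1"] by (cases m) (auto simp: homog_comp_neg ideal.span_zero)
    have "homog_comp (int m) b + p = (homog_comp (int m) p - homog_comp (int m - 1) b * X i + homog_comp (int m) b) + X i * homog_comp (int m - 1) b"
      using p by (simp add: homog_comp_of_homog mult.commute)
    also have "\<dots> \<in> ?I" by (intro ideal.span_add A ideal.span_scale prev)
    finally show ?case by simp
  next
    case (Suc j)
    let ?k = "int m + int (Suc j)"
    have "homog_comp ?k b + X i ^ Suc j * p = (homog_comp ?k p - homog_comp (?k - 1) b * X i + homog_comp ?k b)
        + X i * (homog_comp (int m + int j) b + X i ^ j * p)"
      using p by (simp add: homog_comp_of_homog algebra_simps)
    also have "\<dots> \<in> ?I" by (intro ideal.span_add A ideal.span_scale Suc)
    finally show ?case .
  qed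
  obtain K where "\<forall>k\<ge>K. homog_comp k b = 0" using homog_comp_eventually_zero by blast
  then have "homog_comp (int m + int (nat K)) b = 0" by auto
  then show ?thesis using high[of "nat K"] by auto
qed

context germ_chart
begin

text \<open>\<open>E\<close> is a product of linear forms through the other points that avoid the
  base point. Then \<open>loc l * E\<close> vanishes at every common zero on the chart: at the base
  point by \<open>loc l\<close>, elsewhere by \<open>E\<close>. The Nullstellensatz gives a common
  exponent \<open>M\<close>, and \<open>K = CARD('n) * M\<close> ensures that every monomial of
  degree \<open>K\<close> contains some \<open>loc l ^ M\<close>.\<close>

lemma exists_denominator:
  fixes F :: "'j::finite \<Rightarrow> 'k mpoly"
  assumes V: "finite V" and cover: "\<And>w. w \<noteq> 0 \<Longrightarrow> (\<And>j. poly_eval (F j) w = 0) \<Longrightarrow> \<exists>q\<in>V. \<exists>c. w = c *s q"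
  obtains e a K where "e \<in> homog_part (int a)" "poly_eval e (chart 0) \<noteq> 0"
    "\<And>x. x \<in> monoms loc K \<Longrightarrow> e * x \<in> ideal.span (insert (X i - 1) (range F))"
proof -
  let ?v = "chart 0"
  let ?I = "ideal.span (insert (X i - 1) (range F))"
  define V' where "V' = {q \<in> V. \<forall>c. q \<noteq> c *s ?v}"
  have finV': "finite V'" using V by (simp add: V'_def)
  have "\<exists>r\<in>homog_part 1. poly_eval r q = 0 \<and> poly_eval r ?v \<noteq> 0" if q: "q \<in> V'" for q
  proof -
    have "q \<noteq> (q $ i) *s ?v" using q by (simp add: V'_def)
    then obtain j where j: "q $ j \<noteq> q $ i * ?v $ j" by (auto simp: vec_eq_iff)
    have "Cst (q $ i) * X j - Cst (q $ j) * X i \<in> homog_part 1"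
      by (intro homog_diff homog_Cst_mult homog_X)
    moreover have "poly_eval (Cst (q $ i) * X j - Cst (q $ j) * X i) q = 0" by simp
    moreover have "poly_eval (Cst (q $ i) * X j - Cst (q $ j) * X i) ?v \<noteq> 0"
      using j by (simp add: chart_i)
    ultimately show ?thesis by blast
  qed
  then obtain r where r: "\<And>q. q \<in> V' \<Longrightarrow> r q \<in> homog_part 1"
    "\<And>q. q \<in> V' \<Longrightarrow> poly_eval (r q) q = 0" "\<And>q. q \<in> V' \<Longrightarrow> poly_eval (r q) ?v \<noteq> 0" by metis
  define E where "E = (\<Prod>q\<in>V'. r q)"
  have homE: "E \<in> homog_part (int (card V'))"
    unfolding E_def using homog_prod[of V' r "\<lambda>_. 1"] r(1) by simp
  have Ev: "poly_eval E ?v \<noteq> 0" using finV' r(3) by (simp add: E_def)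
  have "\<exists>k. (loc l * E) ^ k \<in> ?I" for l
  proof (rule power_in_span_of_zeros)
    fix w assume w: "\<And>p. p \<in> insert (X i - 1) (range F) \<Longrightarrow> poly_eval p w = 0"
    have wi: "w $ i = 1" using w[of "X i - 1"] by simp
    then have "w \<noteq> 0" by auto
    then obtain q c where q: "q \<in> V" "w = c *s q" using cover[of w] w by blast
    show "poly_eval (loc l * E) w = 0"
    proof (cases "q \<in> V'")
      case True
      then have "poly_eval (r q) w = 0"
        using r(1)[OF True] r(2)[OF True] q(2) poly_eval_homog_scale[of "r q" 1 c q] by simp
      then have "poly_eval E w = 0" using True finV' by (auto simp: E_def)
      then show ?thesis by simp
    next
      case False
      then obtain b where "q = b *s ?v" using q(1) by (auto simp: V'_def)
      then have "w = (c * b) *s ?v" using q(2) by simp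
      moreover from this have "c * b = 1" using wi by (simp add: chart_i)
      ultimately have "w = ?v" by simp
      then show ?thesis by (simp add: loc_eval)
    qed
  qed
  then obtain k where k: "\<And>l. (loc l * E) ^ k l \<in> ?I" by metis
  define M where "M = (\<Sum>l\<in>UNIV. k l)"
  have kM: "(loc l * E) ^ M \<in> ?I" for l
  proof -
    have "k l \<le> M" unfolding M_def by (rule member_le_sum) auto
    then have "(loc l * E) ^ M = (loc l * E) ^ (M - k l) * (loc l * E) ^ k l" by (simp flip: power_add)
    then show ?thesis using ideal.span_scale[OF k[of l], of "(loc l * E) ^ (M - k l)"] by simp
  qed
  show ?thesis
  proof (rule that)
    show "E ^ M \<in> homog_part (int (M * card V'))" using homog_power[OF homE, of M] by simp
    show "poly_eval (E ^ M) ?v \<noteq> 0" using Ev by simp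
    fix x assume "x \<in> monoms loc (CARD('n) * M)"
    then obtain \<alpha> where \<alpha>: "x = (\<Prod>l\<in>UNIV. loc l ^ \<alpha> l)" "(\<Sum>l\<in>UNIV. \<alpha> l) = CARD('n) * M"
      unfolding monoms_def by blast
    have "\<exists>l. \<alpha> l \<ge> M"
    proof (rule ccontr)
      assume "\<not> ?thesis"
      then have "(\<Sum>l\<in>UNIV. \<alpha> l) < (\<Sum>l\<in>(UNIV::'n set). M)"
        by (intro sum_strict_mono) (auto simp: not_le)
      then show False using \<alpha>(2) by simp
    qed
    then obtain l where l: "\<alpha> l \<ge> M" by blast
    have "x = loc l ^ \<alpha> l * (\<Prod>l\<in>UNIV - {l}. loc l ^ \<alpha> l)" unfolding \<alpha>(1) by (rule prod.remove) auto
    also have "loc l ^ \<alpha> l = loc l ^ (\<alpha> l - M) * loc l ^ M" using l by (simp flip: power_add)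
    finally have "E ^ M * x = (loc l ^ (\<alpha> l - M) * (\<Prod>l\<in>UNIV - {l}. loc l ^ \<alpha> l)) * (loc l * E) ^ M"
      by (simp add: power_mult_distrib mult_ac)
    then show "E ^ M * x \<in> ?I" using ideal.span_scale[OF kM[of l]] by simp
  qed
qed

text \<open>The product of \<open>a_inv g\<close> forms through the point lies in the Tjurina ideal,
  hence analytically in the Jacobian ideal. \<open>local_membership\<close> makes this algebraic on
  \<open>x_i = 1\<close> and \<open>dehomogenize\<close> removes \<open>X i - 1\<close> at the cost
  of a power of \<open>X i\<close>, which takes the value 1 at the point.\<close>

lemma jacobian_denominator:
  assumes f: "f \<in> homog_part (int N)" and N: "N > 0" and u: "u dvd 1" and ug: "ev f = u * g"
    and V: "finite V"
    and cover: "\<And>w. w \<noteq> 0 \<Longrightarrow> (\<And>j. poly_eval (poly_partial j f) w = 0) \<Longrightarrow> \<exists>q\<in>V. \<exists>c. w = c *s q"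
    and l: "\<And>r. r < a_inv g \<Longrightarrow> poly_eval (l r) (chart 0) = 0"
    and L: "L = (\<Prod>r<a_inv g. l r) * R" "L \<in> homog_part (int b)"
  shows "\<exists>e a. e \<in> homog_part (int a) \<and> poly_eval e (chart 0) \<noteq> 0
    \<and> e * L \<in> ideal.span (range (\<lambda>j. poly_partial j f))"
proof -
  let ?F = "\<lambda>j. poly_partial j f"
  obtain e a K where e: "e \<in> homog_part (int a)" "poly_eval e (chart 0) \<noteq> 0"
    "\<And>x. x \<in> monoms loc K \<Longrightarrow> e * x \<in> ideal.span (insert (X i - 1) (range ?F))"
    using exists_denominator[where F = ?F, OF V cover] by metis
  note T = tjurina_ideal_eq[OF f N u ug]
  have "ideal_power max_ideal K \<subseteq> tjurina_ideal g"
    unfolding T by (rule ideal_power_subset[OF e(3,2)])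
  then have aT: "ideal_power max_ideal (a_inv g) \<subseteq> tjurina_ideal g"
    unfolding a_inv_def by (rule LeastI)
  have "\<forall>r<a_inv g. ev (l r) \<in> max_ideal" using l by (simp add: max_ideal_def germ_value_ev)
  then have "(\<Prod>r<a_inv g. ev (l r)) \<in> ideal_power max_ideal (a_inv g)"
    unfolding ideal_power_def germ_ideal_def
    by (intro ideal.span_base CollectI exI[of _ "\<lambda>r. ev (l r)"]) simp
  then have "(\<Prod>r<a_inv g. ev (l r)) \<in> germ_ideal (range (\<lambda>j. ev (?F j)))" using aT T by blast
  then have "ev R * (\<Prod>r<a_inv g. ev (l r)) \<in> germ_ideal (range (\<lambda>j. ev (?F j)))"
    unfolding germ_ideal_def by (rule ideal.span_scale)
  then have "ev L \<in> germ_ideal (range (\<lambda>j. ev (?F j)))" by (simp add: L(1) ev_mult ev_prod mult.commute)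
  then have "e * L \<in> ideal.span (insert (X i - 1) (range ?F))" by (rule local_membership[OF _ e(3)])
  moreover have "e * L \<in> homog_part (int (a + b))" using homog_mult[OF e(1) L(2)] by simp
  ultimately obtain k where k: "X i ^ k * (e * L) \<in> ideal.span (range ?F)"
    using dehomogenize[of ?F "int N - 1", OF homog_partial[OF f]] by blast
  have "X i ^ k * e \<in> homog_part (int (k + a))"
    using homog_mult[OF homog_power[OF homog_X[of i], of k] e(1)] by simp
  moreover have "poly_eval (X i ^ k * e) (chart 0) \<noteq> 0" using e(2) by (simp add: chart_i)
  moreover have "(X i ^ k * e) * L \<in> ideal.span (range ?F)" using k by (simp add: mult.assoc)
  ultimately show ?thesis by blast
qed

end

section \<open>The singular locus\<close>

lemma line_of_cases:
  obtains v where "v \<noteq> 0" "line_of p = vec.span {v}"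
  using line_of[of p] by blast

lemma line_of_proj_pt: "v \<noteq> 0 \<Longrightarrow> line_of (proj_pt v) = vec.span {v}"
  unfolding proj_pt_def by (rule Proj_inverse) blast

lemma span_scaled:
  fixes v :: "complex^'k"
  assumes "c \<noteq> 0"
  shows "vec.span {c *s v} = vec.span {v}"
proof -
  have "(1 / c) *s (c *s v) = v" using assms by (simp add: vec_eq_iff)
  moreover have "(1 / c) *s (c *s v) \<in> vec.span {c *s v}" by (intro vec.span_scale vec.span_base) simp
  ultimately have "v \<in> vec.span {c *s v}" by simp
  moreover have "c *s v \<in> vec.span {v}" by (intro vec.span_scale vec.span_base) simp
  ultimately show ?thesis unfolding vec.span_eq by blast
qed

lemma proj_pt_of_line:
  assumes "w \<noteq> 0" "w \<in> line_of p"
  shows "proj_pt w = p" "line_of p = vec.span {w}"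
proof -
  obtain v where v: "v \<noteq> 0" "line_of p = vec.span {v}" by (rule line_of_cases)
  then obtain c where c: "w = c *s v" using assms(2) by (auto simp: vec.span_singleton)
  then have "c \<noteq> 0" using assms(1) by auto
  show *: "line_of p = vec.span {w}" unfolding v(2) c span_scaled[OF \<open>c \<noteq> 0\<close>] ..
  have "line_of (proj_pt w) = line_of p" unfolding * by (rule line_of_proj_pt[OF assms(1)])
  then show "proj_pt w = p" by (simp only: line_of_inject)
qed

text \<open>Homogeneity allows testing a single representative, and Euler's identity yields the
  vanishing of \<open>f\<close> from that of its partial derivatives.\<close>

lemma sing_points_iff:
  assumes f: "f \<in> homog_part (int N)" and N: "N > 1" and w: "w \<noteq> 0" "w \<in> line_of p"
  shows "p \<in> sing_points f \<longleftrightarrow> (\<forall>j. poly_eval (poly_partial j f) w = 0)"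
proof
  assume "p \<in> sing_points f"
  then show "\<forall>j. poly_eval (poly_partial j f) w = 0" using w by (auto simp: sing_points_def)
next
  assume 0: "\<forall>j. poly_eval (poly_partial j f) w = 0"
  have homF: "poly_partial j f \<in> homog_part (int (N - 1))" for j
    using homog_partial[OF f] N by (simp add: of_nat_diff)
  have "poly_eval f v = 0 \<and> (\<forall>j. poly_eval (poly_partial j f) v = 0)" if v: "v \<in> line_of p" for v
  proof -
    obtain c where "v = c *s w"
      using v proj_pt_of_line(2)[OF w] by (auto simp: vec.span_singleton)
    then have F0: "poly_eval (poly_partial j f) v = 0" for j
      using poly_eval_homog_scale[OF homF] 0 by simp
    have "of_nat N * poly_eval f v = poly_eval (\<Sum>j\<in>UNIV. X j * poly_partial j f) v"
      unfolding Euler_identity[OF f] by (simp only: poly_eval_mult poly_eval_Cst)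
    also have "\<dots> = 0" by (simp add: F0)
    finally show ?thesis using F0 N by simp
  qed
  then show "p \<in> sing_points f" by (simp add: sing_points_def)
qed

text \<open>The singular vectors on the unit sphere form a compact set, covered by the preimages of
  open sets that contain one singular point each.\<close>

lemma finite_sing_points:
  fixes f :: "'k::finite mpoly"
  assumes f: "f \<in> homog_part (int N)" and N: "N > 1"
    and iso: "\<forall>p\<in>sing_points f. p isolated_in sing_points f"
  shows "finite (sing_points f)"
proof -
  let ?S = "sing_points f"
  have "\<forall>p\<in>?S. \<exists>T. open T \<and> T \<inter> ?S = {p}" using iso by (auto simp: isolated_in_def)
  then obtain T where T: "\<And>p. p \<in> ?S \<Longrightarrow> open (T p)" "\<And>p. p \<in> ?S \<Longrightarrow> T p \<inter> ?S = {p}" by metis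
  define U where "U p = {v :: complex^'k. v \<noteq> 0 \<and> proj_pt v \<in> T p}" for p
  define K where "K = sphere 0 1 \<inter> (\<Inter>j. {v :: complex^'k. poly_eval (poly_partial j f) v = 0})"
  have "closed {v. poly_eval (poly_partial j f) v = 0}" for j
    by (intro closed_Collect_eq continuous_on_poly_eval continuous_on_const)
  then have "compact K" unfolding K_def by (intro compact_Int_closed compact_sphere closed_INT) auto
  moreover have "open (U p)" if "p \<in> ?S" for p using T(1)[OF that] by (simp add: U_def open_proj_def)
  moreover have "K \<subseteq> (\<Union>p\<in>?S. U p)"
  proof
    fix v assume v: "v \<in> K"
    then have "v \<noteq> 0" by (auto simp: K_def)
    moreover have "proj_pt v \<in> ?S"
      using sing_points_iff[OF f N \<open>v \<noteq> 0\<close>, of "proj_pt v"] v \<open>v \<noteq> 0\<close>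
      by (simp add: line_of_proj_pt K_def vec.span_base)
    ultimately show "v \<in> (\<Union>p\<in>?S. U p)" using T(2) unfolding U_def by blast
  qed
  ultimately obtain C where C: "C \<subseteq> ?S" "finite C" "K \<subseteq> (\<Union>p\<in>C. U p)" by (rule compactE_image)
  have "p \<in> C" if p: "p \<in> ?S" for p
  proof -
    obtain v where v: "v \<noteq> 0" "line_of p = vec.span {v}" by (rule line_of_cases)
    define w where "w = complex_of_real (1 / norm v) *s v"
    have "w = (1 / norm v) *\<^sub>R v" by (simp add: w_def vec_eq_iff scaleR_conv_of_real[of _ "v $ _"])
    then have nw: "norm w = 1" using v(1) by simp
    then have "w \<noteq> 0" by auto
    have wp: "w \<in> line_of p" unfolding v(2) w_def by (intro vec.span_scale vec.span_base) simp
    then have "w \<in> K" using p nw sing_points_iff[OF f N \<open>w \<noteq> 0\<close> wp] by (simp add: K_def)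
    then obtain p' where "p' \<in> C" "proj_pt w \<in> T p'" using C(3) by (auto simp: U_def)
    then have "p \<in> T p' \<inter> ?S" using p proj_pt_of_line(1)[OF \<open>w \<noteq> 0\<close> wp] by simp
    moreover have "T p' \<inter> ?S = {p'}" using T(2) \<open>p' \<in> C\<close> C(1) by blast
    ultimately have "p \<in> {p'}" by (simp only:)
    then show ?thesis using \<open>p' \<in> C\<close> by simp
  qed
  then have "?S \<subseteq> C" by (rule subsetI)
  then show ?thesis by (rule finite_subset[OF _ C(2)])
qed

text \<open>The chart in \<open>local_equation\<close> has its own base point, which is only
  proportional to \<open>w\<close>; homogeneity carries the vanishing of \<open>l r\<close> and the
  nonvanishing of \<open>e\<close> from one to the other.\<close>

lemma denominator_at_singular_point:
  fixes f :: "'k::finite mpoly" and g :: "'n::finite hol_germ"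
  assumes f: "f \<in> homog_part (int N)" and N: "N > 1" and fin: "finite (sing_points f)"
    and eqn: "local_equation f p g" and w: "w \<noteq> 0" "w \<in> line_of p"
    and l: "\<And>r. r < a_inv g \<Longrightarrow> l r \<in> homog_part 1" "\<And>r. r < a_inv g \<Longrightarrow> poly_eval (l r) w = 0"
    and L: "L = (\<Prod>r<a_inv g. l r) * R" "L \<in> homog_part (int b)"
  shows "\<exists>e. poly_eval e w \<noteq> 0 \<and> e * L \<in> ideal.span (range (\<lambda>j. poly_partial j f))"
proof -
  obtain i and \<sigma> :: "'n \<Rightarrow> 'k" and \<Phi> u where *: "bij_betw \<sigma> UNIV (UNIV - {i})"
    "biholo_at_0 \<Phi>" "proj_pt (affine_chart i \<sigma> (\<Phi> 0)) = p" "u dvd 1"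
    "\<forall>\<^sub>F y in nhds 0. poly_eval f (affine_chart i \<sigma> (\<Phi> y)) = rep_hol_germ (u * g) y"
    using eqn unfolding local_equation_def by blast
  obtain \<Psi> where \<Psi>: "\<forall>l. holo_near (\<lambda>z. \<Psi> z $ l) (\<Phi> 0)" "\<forall>\<^sub>F y in nhds 0. \<Psi> (\<Phi> y) = y"
    "\<forall>\<^sub>F z in nhds (\<Phi> 0). \<Phi> (\<Psi> z) = z"
    using *(2) unfolding biholo_at_0_def by blast
  interpret germ_chart i \<sigma> \<Phi> \<Psi>
  proof
    show "bij_betw \<sigma> UNIV (UNIV - {i})" by (rule *(1))
    show "holo_near (\<lambda>y. \<Phi> y $ l) 0" for l using *(2) unfolding biholo_at_0_def by blast
    show "holo_near (\<lambda>z. \<Psi> z $ l) (\<Phi> 0)" for l using \<Psi>(1) by blast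
    show "\<forall>\<^sub>F y in nhds 0. \<Psi> (\<Phi> y) = y" by (rule \<Psi>(2))
    show "\<forall>\<^sub>F z in nhds (\<Phi> 0). \<Phi> (\<Psi> z) = z" by (rule \<Psi>(3))
  qed
  have c0: "chart 0 \<noteq> 0" using chart_i[of 0] by auto
  have "line_of p = vec.span {chart 0}" using *(3) line_of_proj_pt[OF c0] by (simp add: chart_def)
  then obtain c where c: "w = c *s chart 0" using w(2) by (auto simp: vec.span_singleton)
  then have "c \<noteq> 0" using w(1) by auto
  have "ev f = u * g"
    using abs_germ_eqI[OF holo_ev holo_near_rep] *(5) unfolding ev_def chart_def[symmetric]
    by (simp add: abs_rep_germ)
  define rp where "rp p = (SOME v. v \<noteq> 0 \<and> line_of p = vec.span {v})" for p :: "'k proj"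
  have rp: "line_of p = vec.span {rp p}" for p
    unfolding rp_def by (rule someI2_ex) (use line_of_cases in blast)+
  have cover: "\<exists>q\<in>rp ` sing_points f. \<exists>c. x = c *s q"
    if x: "x \<noteq> 0" "\<And>j. poly_eval (poly_partial j f) x = 0" for x
  proof -
    have xl: "x \<in> line_of (proj_pt x)" by (simp add: line_of_proj_pt x(1) vec.span_base)
    then have "proj_pt x \<in> sing_points f" using sing_points_iff[OF f N x(1)] x(2) by blast
    moreover have "\<exists>c. x = c *s rp (proj_pt x)" using xl rp by (auto simp: vec.span_singleton)
    ultimately show ?thesis by blast
  qed
  have "poly_eval (l r) (chart 0) = 0" if "r < a_inv g" for r
    using l(2)[OF that] l(1)[OF that] poly_eval_homog_scale[of "l r" 1 c "chart 0"] c \<open>c \<noteq> 0\<close> by simp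
  then have "\<exists>e a. e \<in> homog_part (int a) \<and> poly_eval e (chart 0) \<noteq> 0
    \<and> e * L \<in> ideal.span (range (\<lambda>j. poly_partial j f))"
    using N by (intro jacobian_denominator[OF f _ *(4) \<open>ev f = u * g\<close> finite_imageI[OF fin, of rp] _ _ L] cover) auto
  then obtain e a where e: "e \<in> homog_part (int a)" "poly_eval e (chart 0) \<noteq> 0"
    "e * L \<in> ideal.span (range (\<lambda>j. poly_partial j f))" by blast
  moreover have "poly_eval e w \<noteq> 0" unfolding c using e(1,2) \<open>c \<noteq> 0\<close> by (simp add: poly_eval_homog_scale)
  ultimately show ?thesis by blast
qed

text \<open>Saturation: the Nullstellensatz applied to the colon ideal of \<open>L\<close>.\<close>

lemma power_times_product_in_jacobian:
  fixes f :: "'k::finite mpoly" and g :: "'k proj \<Rightarrow> 'n::finite hol_germ"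
  assumes f: "f \<in> homog_part (int N)" and N: "N > 1" and fin: "finite (sing_points f)"
    and eqn: "\<forall>p\<in>sing_points f. local_equation f p (g p)"
    and v: "\<And>p. v p \<noteq> 0" "\<And>p. line_of p = vec.span {v p}"
    and l: "\<And>p r. p \<in> sing_points f \<Longrightarrow> r < a_inv (g p) \<Longrightarrow> l p r \<in> homog_part 1 \<and> poly_eval (l p r) (v p) = 0"
    and h: "h \<in> homog_part 1"
  shows "\<exists>k. h ^ k * (\<Prod>p\<in>sing_points f. \<Prod>r<a_inv (g p). l p r) \<in> ideal.span (range (\<lambda>j. poly_partial j f))"
proof -
  let ?J = "ideal.span (range (\<lambda>j. poly_partial j f))"
  let ?L = "\<Prod>p\<in>sing_points f. \<Prod>r<a_inv (g p). l p r"
  have "?L \<in> homog_part (\<Sum>p\<in>sing_points f. \<Sum>r<a_inv (g p). 1)"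
    by (intro homog_prod) (use l in auto)
  then have homL: "?L \<in> homog_part (int (\<Sum>p\<in>sing_points f. a_inv (g p)))" by simp
  have "\<exists>k. h ^ k \<in> {e. e * ?L \<in> ?J}"
  proof (rule nullstellensatz)
    show "ideal.subspace {e. e * ?L \<in> ?J}"
      by (rule ideal.subspaceI)
        (auto simp: ideal.span_zero distrib_right mult.assoc intro: ideal.span_add ideal.span_scale)
  next
    fix w assume w: "\<And>e. e \<in> {e. e * ?L \<in> ?J} \<Longrightarrow> poly_eval e w = 0"
    show "poly_eval h w = 0"
    proof (cases "w = 0")
      case True
      then show ?thesis using poly_eval_homog_zero[OF h] by simp
    next
      case False
      let ?p = "proj_pt w"
      have wl: "w \<in> line_of ?p" by (simp add: line_of_proj_pt False vec.span_base)
      \<comment> \<open>The partial derivatives lie in the colon ideal, so a nonzero common zero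
        \<open>w\<close> would be singular. There \<open>denominator_at_singular_point\<close>
        provides a member of the colon ideal that does not vanish at \<open>w\<close>.\<close>
      have "poly_eval (poly_partial j f) w = 0" for j
      proof (rule w)
        have "?L * poly_partial j f \<in> ?J" by (intro ideal.span_scale ideal.span_base) blast
        then show "poly_partial j f \<in> {e. e * ?L \<in> ?J}" by (simp add: mult.commute)
      qed
      then have p: "?p \<in> sing_points f" using sing_points_iff[OF f N False wl] by blast
      obtain c where c: "w = c *s v ?p" using wl unfolding v(2) by (auto simp: vec.span_singleton)
      have lw: "poly_eval (l ?p r) w = 0" if "r < a_inv (g ?p)" for r
        using l[OF p that] poly_eval_homog_scale[of "l ?p r" 1 c "v ?p"] c by simp
      have "?L = (\<Prod>r<a_inv (g ?p). l ?p r) * (\<Prod>p\<in>sing_points f - {?p}. \<Prod>r<a_inv (g p). l p r)"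
        by (rule prod.remove[OF fin p])
      then obtain e where "poly_eval e w \<noteq> 0" "e * ?L \<in> ?J"
        using denominator_at_singular_point[OF f N fin _ False wl, of "g ?p" "l ?p"] l[OF p] lw eqn p homL by blast
      then show ?thesis using w by blast
    qed
  qed
  then show ?thesis by blast
qed

section \<open>Vanishing of the syzygies\<close>

lemma Cst_sum_mult: "Cst (\<Sum>i\<in>A. x i * y i) = (\<Sum>i\<in>A. Cst (x i) * Cst (y i))"
  by (induction A rule: infinite_finite_induct) (auto simp: mult_single single_add)

text \<open>If the form for \<open>V\<close> vanishes at \<open>v\<close>, a multiple of a
  coordinate that is nonzero at \<open>v\<close> is added; each vector excludes at most one
  multiplier \<open>t\<close>.\<close>

lemma exists_nonvanishing_linear_form:
  fixes V :: "(complex^'k::finite) set"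
  assumes "finite V" "0 \<notin> V"
  shows "\<exists>l\<in>homog_part 1. \<forall>v\<in>V. poly_eval l v \<noteq> 0"
  using assms
proof (induction V rule: finite_induct)
  case empty
  show ?case using homog_zero by blast
next
  case (insert v V)
  then obtain l where l: "l \<in> homog_part 1" "\<forall>v\<in>V. poly_eval l v \<noteq> 0" by auto
  obtain j where j: "v $ j \<noteq> 0" using insert.prems by (metis insertI1 vec_eq_iff zero_index)
  show ?case
  proof (cases "poly_eval l v = 0")
    case False
    then show ?thesis using l by blast
  next
    case True
    have "finite ((\<lambda>w. - (poly_eval l w / w $ j)) ` insert v V \<union> {0})" using insert(1) by blast
    then obtain t where t: "t \<notin> (\<lambda>w. - (poly_eval l w / w $ j)) ` insert v V \<union> {0}"
      using ex_new_if_finite[OF infinite_UNIV_char_0] by blast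
    have "l + Cst t * X j \<in> homog_part 1" by (intro homog_add l homog_Cst_mult homog_X)
    moreover have "poly_eval (l + Cst t * X j) w \<noteq> 0" if w: "w \<in> insert v V" for w
    proof (cases "w $ j = 0")
      case wj: True
      then have "w \<in> V" using w j by auto
      then show ?thesis using wj l(2) by simp
    next
      case wj: False
      have "t \<noteq> - (poly_eval l w / w $ j)" using t w by blast
      then have "poly_eval l w + t * w $ j \<noteq> 0"
        using wj by (simp add: field_simps add_eq_0_iff)
      then show ?thesis by simp
    qed
    ultimately show ?thesis by blast
  qed
qed

text \<open>For a suitable constant \<open>?c\<close> the form \<open>X j - Cst ?c * l\<close>
  passes through \<open>v\<close>. If all forms through \<open>v\<close> carried \<open>h\<close>
  into the ideal, so would every \<open>X j\<close>, and \<open>h\<close> would be a socle element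
  in degree below \<open>s\<close>.\<close>

lemma socle_step:
  fixes \<theta> :: "'i \<Rightarrow> 'k::finite mpoly"
  assumes soc: "socle_from s \<theta>" and l: "l \<in> homog_part 1" "l \<in> ideal.span (range \<theta>)" "poly_eval l v \<noteq> 0"
    and h: "h \<in> homog_part k" "k < s" "h \<notin> ideal.span (range \<theta>)"
  shows "\<exists>r\<in>homog_part 1. poly_eval r v = 0 \<and> r * h \<notin> ideal.span (range \<theta>)"
proof (rule ccontr)
  assume neg: "\<not> ?thesis"
  have "X j * h \<in> ideal.span (range \<theta>)" for j
  proof -
    let ?c = "v $ j / poly_eval l v"
    have "X j - Cst ?c * l \<in> homog_part 1" by (intro homog_diff homog_X homog_Cst_mult l)
    moreover have "poly_eval (X j - Cst ?c * l) v = 0" using l(3) by simp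
    ultimately have 1: "(X j - Cst ?c * l) * h \<in> ideal.span (range \<theta>)" using neg by blast
    have "(Cst ?c * h) * l \<in> ideal.span (range \<theta>)" by (rule ideal.span_scale[OF l(2)])
    from ideal.span_add[OF 1 this] show ?thesis by (simp add: algebra_simps)
  qed
  then show False using soc h unfolding socle_from_def by blast
qed

text \<open>Each new factor is chosen while the degree is still below \<open>s\<close>; the finished
  product may have degree \<open>s\<close>, which is why \<open>\<le>\<close> suffices in the
  hypothesis.\<close>

lemma socle_power:
  fixes \<theta> :: "'i \<Rightarrow> 'k::finite mpoly"
  assumes soc: "socle_from s \<theta>" and l: "l \<in> homog_part 1" "l \<in> ideal.span (range \<theta>)" "poly_eval l v \<noteq> 0"
    and h: "h \<in> homog_part k" "k + int a \<le> s" "h \<notin> ideal.span (range \<theta>)"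
  shows "\<exists>q. (\<forall>r<a. q r \<in> homog_part 1 \<and> poly_eval (q r) v = 0) \<and> (\<Prod>r<a. q r) * h \<notin> ideal.span (range \<theta>)"
  using h(2)
proof (induction a)
  case 0
  then show ?case using h(3) by simp
next
  case (Suc a)
  then obtain q where q: "\<forall>r<a. q r \<in> homog_part 1 \<and> poly_eval (q r) v = 0"
    "(\<Prod>r<a. q r) * h \<notin> ideal.span (range \<theta>)" by auto
  have "(\<Prod>r<a. q r) \<in> homog_part (\<Sum>r<a. 1)" by (intro homog_prod) (use q in auto)
  then have "(\<Prod>r<a. q r) * h \<in> homog_part (int a + k)" using homog_mult h(1) by fastforce
  moreover have "int a + k < s" using Suc(2) by simp
  ultimately obtain r where r: "r \<in> homog_part 1" "poly_eval r v = 0"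
    "r * ((\<Prod>r<a. q r) * h) \<notin> ideal.span (range \<theta>)"
    using socle_step[OF soc l _ _ q(2)] by blast
  have "(\<Prod>i<Suc a. (q(a := r)) i) = (\<Prod>i<a. q i) * r" by simp
  then have "(\<Prod>i<Suc a. (q(a := r)) i) * h = r * ((\<Prod>r<a. q r) * h)" by (simp only: mult_ac)
  then have "(\<Prod>i<Suc a. (q(a := r)) i) * h \<notin> ideal.span (range \<theta>)" using r(3) by (simp only: not_False_eq_True)
  moreover have "\<forall>i<Suc a. (q(a := r)) i \<in> homog_part 1 \<and> poly_eval ((q(a := r)) i) v = 0"
    using q(1) r by (auto simp: less_Suc_eq)
  ultimately show ?case by blast
qed

lemma socle_product:
  fixes \<theta> :: "'i \<Rightarrow> 'k::finite mpoly"
  assumes "finite A" and soc: "socle_from s \<theta>" and l: "l \<in> homog_part 1" "l \<in> ideal.span (range \<theta>)"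
    and lv: "\<And>p. p \<in> A \<Longrightarrow> poly_eval l (v p) \<noteq> 0"
    and h: "h \<in> homog_part k" "k + int (\<Sum>p\<in>A. a p) \<le> s" "h \<notin> ideal.span (range \<theta>)"
  shows "\<exists>q. (\<forall>p\<in>A. \<forall>r<a p. q p r \<in> homog_part 1 \<and> poly_eval (q p r) (v p) = 0)
     \<and> (\<Prod>p\<in>A. \<Prod>r<a p. q p r) * h \<notin> ideal.span (range \<theta>)"
  using assms(1) lv h(2)
proof (induction A rule: finite_induct)
  case empty
  then show ?case using h(3) by simp
next
  case (insert p A)
  then obtain q where q: "\<forall>p\<in>A. \<forall>r<a p. q p r \<in> homog_part 1 \<and> poly_eval (q p r) (v p) = 0"
    "(\<Prod>p\<in>A. \<Prod>r<a p. q p r) * h \<notin> ideal.span (range \<theta>)" by auto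
  let ?P = "\<Prod>p\<in>A. \<Prod>r<a p. q p r"
  have "?P \<in> homog_part (\<Sum>p\<in>A. \<Sum>r<a p. 1)" by (intro homog_prod) (use q in auto)
  then have "?P * h \<in> homog_part (int (\<Sum>p\<in>A. a p) + k)" using homog_mult h(1) by fastforce
  moreover have "int (\<Sum>p\<in>A. a p) + k + int (a p) \<le> s" using insert by simp
  moreover have "poly_eval l (v p) \<noteq> 0" using insert by simp
  ultimately obtain q' where q': "\<forall>r<a p. q' r \<in> homog_part 1 \<and> poly_eval (q' r) (v p) = 0"
    "(\<Prod>r<a p. q' r) * (?P * h) \<notin> ideal.span (range \<theta>)"
    using socle_power[OF soc l _ _ _ q(2)] by blast
  have "(\<Prod>p'\<in>A. \<Prod>r<a p'. (q(p := q')) p' r) = ?P"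
    using insert(2) by (intro prod.cong) auto
  then have "(\<Prod>p'\<in>insert p A. \<Prod>r<a p'. (q(p := q')) p' r) = (\<Prod>r<a p. q' r) * ?P"
    using insert(1,2) by simp
  then have "(\<Prod>p'\<in>insert p A. \<Prod>r<a p'. (q(p := q')) p' r) * h \<notin> ideal.span (range \<theta>)"
    using q'(2) by (simp add: mult.assoc)
  then show ?case using q(1) q'(1) insert(2) by (intro exI[of _ "q(p := q')"]) auto
qed

text \<open>The \<open>n\<close> rows cannot span a space of dimension \<open>n + 1\<close>, and any
  row outside their span keeps the family independent.\<close>

lemma exists_invertible_completion:
  fixes C :: "'n::finite \<Rightarrow> complex^'n option"
  assumes ind: "\<And>x. (\<Sum>i\<in>UNIV. x i *s C i) = 0 \<Longrightarrow> \<forall>i. x i = 0"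
  obtains c0 and B :: "complex^'n option^'n option"
  where "B ** (\<chi> k. case k of None \<Rightarrow> c0 | Some i \<Rightarrow> C i) = mat 1"
proof -
  have "vec.dim (range C) \<le> card (range C)" by (rule vec.dim_le_card) (auto intro: vec.span_base)
  also have "\<dots> \<le> CARD('n)" by (rule card_image_le) simp
  also have "\<dots> < CARD('n option)" by simp
  finally have lt: "vec.dim (range C) < CARD('n option)" .
  have "vec.span (range C) \<noteq> UNIV"
  proof
    assume eq: "vec.span (range C) = UNIV"
    have "vec.dim (vec.span (range C)) = CARD('n option)" unfolding eq by (rule vec_dim_card)
    then show False using lt by (simp only: vec.dim_span)
  qed
  then obtain c0 where c0: "c0 \<notin> vec.span (range C)" by blast
  define M where "M = (\<chi> k. case k of None \<Rightarrow> c0 | Some i \<Rightarrow> C i)"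
  have row: "row k M = (case k of None \<Rightarrow> c0 | Some i \<Rightarrow> C i)" for k by (simp add: row_def M_def)
  have split: "(\<Sum>k\<in>UNIV. h k) = h None + (\<Sum>i\<in>UNIV. h (Some i))" for h :: "'n option \<Rightarrow> complex^'n option"
    by (simp add: UNIV_option_conv sum.reindex)
  have "\<forall>x. (\<Sum>k\<in>UNIV. x k *s row k M) = 0 \<longrightarrow> (\<forall>k. x k = 0)"
  proof (intro allI impI)
    fix x :: "'n option \<Rightarrow> complex" and k
    assume "(\<Sum>k\<in>UNIV. x k *s row k M) = 0"
    then have eq: "x None *s c0 + (\<Sum>i\<in>UNIV. x (Some i) *s C i) = 0" by (simp add: split row)
    have "x None = 0"
    proof (rule ccontr)
      assume nz: "x None \<noteq> 0"
      have "x None *s c0 = - (\<Sum>i\<in>UNIV. x (Some i) *s C i)" using eq by (simp add: add_eq_0_iff2)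
      also have "\<dots> \<in> vec.span (range C)" by (intro vec.span_neg vec.span_sum vec.span_scale vec.span_base) auto
      finally have "(1 / x None) *s (x None *s c0) \<in> vec.span (range C)" by (rule vec.span_scale)
      moreover have "(1 / x None) *s (x None *s c0) = c0" using nz by (simp add: vec_eq_iff)
      ultimately show False using c0 by simp
    qed
    then have "(\<Sum>i\<in>UNIV. x (Some i) *s C i) = 0" using eq by simp
    then have "\<forall>i. x (Some i) = 0" by (rule ind)
    then show "x k = 0" using \<open>x None = 0\<close> by (cases k) auto
  qed
  then obtain B where "M ** B = mat 1" using matrix_right_invertible_independent_rows[of M] by blast
  then have "B ** M = mat 1" by (simp add: matrix_left_right_inverse)
  then show ?thesis using that unfolding M_def by blast
qed

text \<open>A change of generators turns the coefficient matrix \<open>s\<close> into the product of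
  \<open>M\<close> transposed, \<open>s\<close> and \<open>M\<close>. Antisymmetry gives a zero
  diagonal because the coefficients are complex numbers.\<close>

lemma alternating_congruence:
  fixes s :: "'o::finite \<Rightarrow> 'o \<Rightarrow> 'k::finite mpoly" and M :: "'o \<Rightarrow> 'j \<Rightarrow> 'k mpoly"
  assumes "alternating s"
  shows "alternating (\<lambda>j j'. \<Sum>o1\<in>UNIV. \<Sum>o2\<in>UNIV. M o1 j * s o1 o2 * M o2 j')"
proof -
  let ?t = "\<lambda>j j'. \<Sum>o1\<in>UNIV. \<Sum>o2\<in>UNIV. M o1 j * s o1 o2 * M o2 j'"
  have anti: "?t j j' = - ?t j' j" for j j'
  proof -
    have "?t j j' = (\<Sum>o2\<in>UNIV. \<Sum>o1\<in>UNIV. M o1 j * s o1 o2 * M o2 j')" by (rule sum.swap)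
    also have "\<dots> = (\<Sum>o2\<in>UNIV. \<Sum>o1\<in>UNIV. - (M o2 j' * s o2 o1 * M o1 j))"
    proof (intro sum.cong refl)
      fix o1 o2
      have "s o1 o2 = - s o2 o1" using assms unfolding alternating_def by blast
      then show "M o1 j * s o1 o2 * M o2 j' = - (M o2 j' * s o2 o1 * M o1 j)" by (simp add: mult_ac)
    qed
    finally show ?thesis by (simp add: sum_negf)
  qed
  moreover have "?t j j = 0" for j
  proof (rule poly_mapping_eqI)
    fix \<mu>
    have "Poly_Mapping.lookup (?t j j) \<mu> = - Poly_Mapping.lookup (?t j j) \<mu>"
      using arg_cong[OF anti[of j j], of "\<lambda>p. Poly_Mapping.lookup p \<mu>"] by (simp only: lookup_uminus)
    then show "Poly_Mapping.lookup (?t j j) \<mu> = Poly_Mapping.lookup 0 \<mu>" by simp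
  qed
  ultimately show ?thesis unfolding alternating_def by blast
qed

text \<open>Descent on the degree. If \<open>h\<close> lies in the ideal of all
  \<open>\<theta>\<close>, write \<open>h = c * \<theta> None\<close> modulo \<open>?G\<close>;
  cancelling \<open>\<theta> None\<close> shows that \<open>c\<close> satisfies the same hypotheses
  in degree \<open>m - 1\<close>. Otherwise \<open>socle_product\<close> gives a multiple of
  \<open>h\<close> outside that ideal, whereas \<open>power_times_product_in_jacobian\<close> and
  the cancellation of powers of \<open>\<theta> None\<close> put the same multiple into
  \<open>?G\<close>.\<close>

lemma annihilated_by_jacobian:
  fixes f :: "'n::finite option mpoly" and g :: "'n option proj \<Rightarrow> 'n hol_germ"
    and \<theta> :: "'n option \<Rightarrow> 'n option mpoly"
  assumes f: "f \<in> homog_part (int N)" and N: "N > 1" and fin: "finite (sing_points f)"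
    and eqn: "\<forall>p\<in>sing_points f. local_equation f p (g p)"
    and v: "\<And>p. v p \<noteq> 0" "\<And>p. line_of p = vec.span {v p}"
    and lv: "\<And>p. p \<in> sing_points f \<Longrightarrow> poly_eval (\<theta> None) (v p) \<noteq> 0"
    and \<theta>: "\<theta> None \<in> homog_part 1" "\<And>i. \<theta> (Some i) \<in> homog_part d"
    and reg: "regular \<theta>" and soc: "socle_from s \<theta>"
    and h: "h \<in> homog_part m" and m: "m + int (\<Sum>p\<in>sing_points f. a_inv (g p)) \<le> s"
    and hF: "\<And>j. h * poly_partial j f \<in> ideal.span (\<theta> ` range Some)"
  shows "h \<in> ideal.span (\<theta> ` range Some)"
  using h m hF
proof (induction "nat (m + 1)" arbitrary: m h rule: less_induct)
  case less
  let ?G = "ideal.span (\<theta> ` range Some)"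
  have hom: "\<exists>d. p \<in> homog_part d" if "p \<in> \<theta> ` range Some" for p using that \<theta>(2) by blast
  have homF: "poly_partial j f \<in> homog_part (int N - 1)" for j by (rule homog_partial[OF f])
  have range\<theta>: "range \<theta> = insert (\<theta> None) (\<theta> ` range Some)"
    by (auto simp: UNIV_option_conv)
  have nzd: "b \<in> ?G" if "b \<in> homog_part k" "\<theta> None * b \<in> ?G" for b k
    using regularD[OF reg _ that(1)] that(2) by blast
  show ?case
  proof (cases "m < 0")
    case True
    then show ?thesis using less(2) homog_neg ideal.span_zero by metis
  next
    case False
    show ?thesis
    proof (cases "h \<in> ideal.span (range \<theta>)")
      case True
      then obtain c where c: "c \<in> homog_part (m - 1)" "h - c * \<theta> None \<in> ?G"
        using homog_breakdown[OF hom \<theta>(1) less(2)] unfolding range\<theta> by metis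
      have "c * poly_partial j f \<in> ?G" for j
      proof (rule nzd[OF homog_mult[OF c(1) homF]])
        have "\<theta> None * (c * poly_partial j f) = h * poly_partial j f - poly_partial j f * (h - c * \<theta> None)"
          by (simp add: algebra_simps)
        also have "\<dots> \<in> ?G" by (intro ideal.span_diff less(4) ideal.span_scale c(2))
        finally show "\<theta> None * (c * poly_partial j f) \<in> ?G" .
      qed
      moreover have "m - 1 + int (\<Sum>p\<in>sing_points f. a_inv (g p)) \<le> s" using less(3) by simp
      ultimately have "c \<in> ?G" using less(1)[OF _ c(1)] False by simp
      then have "\<theta> None * c + (h - c * \<theta> None) \<in> ?G" by (intro ideal.span_add ideal.span_scale c(2))
      then show ?thesis by (simp add: mult.commute)
    next
      case False
      have "\<theta> None \<in> ideal.span (range \<theta>)" by (intro ideal.span_base) simp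
      then obtain q where q: "\<And>p r. p \<in> sing_points f \<Longrightarrow> r < a_inv (g p) \<Longrightarrow> q p r \<in> homog_part 1 \<and> poly_eval (q p r) (v p) = 0"
        "(\<Prod>p\<in>sing_points f. \<Prod>r<a_inv (g p). q p r) * h \<notin> ideal.span (range \<theta>)"
        using socle_product[where v = v, OF fin soc \<theta>(1) _ lv less(2,3) False] by blast
      let ?L = "\<Prod>p\<in>sing_points f. \<Prod>r<a_inv (g p). q p r"
      obtain k where "\<theta> None ^ k * ?L \<in> ideal.span (range (\<lambda>j. poly_partial j f))"
        using power_times_product_in_jacobian[where l = q, OF f N fin eqn v q(1) \<theta>(1)] by blast
      then have "(\<theta> None ^ k * ?L) * h \<in> ?G"
      proof (induction rule: ideal.span_induct_alt)
        case (step c x y)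
        have "x * h \<in> ?G" using step(1) less(4) by (auto simp: mult.commute)
        moreover have "(c * x + y) * h = c * (x * h) + y * h" by (simp add: algebra_simps)
        ultimately show ?case using step(2) by (auto intro: ideal.span_add ideal.span_scale)
      qed (simp add: ideal.span_zero)
      then have "\<theta> None ^ k * (?L * h) \<in> ?G" by (simp only: mult.assoc)
      moreover have "?L \<in> homog_part (\<Sum>p\<in>sing_points f. \<Sum>r<a_inv (g p). 1)"
        by (intro homog_prod) (use q(1) in auto)
      note homL = homog_mult[OF this less(2)]
      ultimately have "?L * h \<in> ?G"
      proof (induction k)
        case (Suc k)
        have "\<theta> None ^ k * (?L * h) \<in> ?G"
          by (rule nzd[OF homog_mult[OF homog_power[OF \<theta>(1)] homL]]) (use Suc(2) in \<open>simp add: mult.assoc\<close>)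
        then show ?case by (rule Suc.IH[OF _ Suc(3)])
      qed simp
      then have "?L * h \<in> ideal.span (range \<theta>)"
        unfolding range\<theta> using ideal.span_mono[of "\<theta> ` range Some" "insert (\<theta> None) (\<theta> ` range Some)"] by blast
      then show ?thesis using q(2) by blast
    qed
  qed
qed

theorem syzygies_are_koszul:
  fixes f :: "'n::finite option mpoly" and g :: "'n option proj \<Rightarrow> 'n hol_germ"
  assumes f: "f \<in> homog_part (int N)" and N: "N > 1" and fin: "finite (sing_points f)"
    and eqn: "\<forall>p\<in>sing_points f. local_equation f p (g p)"
    and m: "m \<le> int CARD('n) * (int N - 2) - (\<Sum>p\<in>sing_points f. int (a_inv (g p)))"
    and a: "a \<in> AR f m"
  shows "a \<in> KR f"
proof -
  let ?F = "\<lambda>j. poly_partial j f"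
  define d where "d = N - 1"
  have d: "d > 0" "int d = int N - 1" using N by (auto simp: d_def)
  have homF: "?F j \<in> homog_part (int d)" for j using homog_partial[OF f] d(2) by simp
  obtain v where v: "\<And>p :: 'n option proj. v p \<noteq> 0" "\<And>p. line_of p = vec.span {v p}"
    using line_of_cases by metis
  have "finite (insert (axis None 1) (v ` sing_points f))" using fin by simp
  moreover have "0 \<notin> insert (axis None 1) (v ` sing_points f)"
    using v(1) by (auto simp: axis_eq_0_iff eq_commute[of 0])
  ultimately obtain l where l: "l \<in> homog_part 1" "poly_eval l (axis None 1) \<noteq> 0"
    and lv: "\<And>p. p \<in> sing_points f \<Longrightarrow> poly_eval l (v p) \<noteq> 0"
    using exists_nonvanishing_linear_form by (metis imageI insert_iff)
  have lF: "z = 0" if z: "poly_eval l z = 0" "\<And>j. poly_eval (?F j) z = 0" for z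
  proof (rule ccontr)
    assume nz: "z \<noteq> 0"
    have zl: "z \<in> line_of (proj_pt z)" by (simp add: line_of_proj_pt nz vec.span_base)
    then have p: "proj_pt z \<in> sing_points f" using sing_points_iff[OF f N nz] z(2) by blast
    obtain c where c: "z = c *s v (proj_pt z)" using zl unfolding v(2) by (auto simp: vec.span_singleton)
    have "poly_eval l z = c * poly_eval l (v (proj_pt z))"
      by (subst c) (use poly_eval_homog_scale[of l 1] l(1) in simp)
    then have "c = 0" using z(1) lv[OF p] by simp
    then show False using c nz by simp
  qed
  obtain C :: "'n \<Rightarrow> 'n option \<Rightarrow> complex" where
    reg: "regular (case_option l (\<lambda>i. \<Sum>j\<in>UNIV. Cst (C i j) * ?F j))" and
    soc: "socle_from (int CARD('n) * (int d - 1)) (case_option l (\<lambda>i. \<Sum>j\<in>UNIV. Cst (C i j) * ?F j))"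
    by (rule exists_parameters[of ?F d l, OF homF d(1) l(1) lF l(2)])
  define \<theta> where "\<theta> = case_option l (\<lambda>i. \<Sum>j\<in>UNIV. Cst (C i j) * ?F j)"
  have \<theta>S: "\<theta> (Some i) = (\<Sum>j\<in>UNIV. Cst (C i j) * ?F j)" for i by (simp add: \<theta>_def)
  have hom\<theta>S: "\<theta> (Some i) \<in> homog_part (int d)" for i
    unfolding \<theta>S by (intro homog_sum homog_Cst_mult homF)
  note reg = reg[folded \<theta>_def] and soc = soc[folded \<theta>_def]
  let ?G = "ideal.span (\<theta> ` range Some)"
  \<comment> \<open>A linear relation among the rows would, by regularity, put a nonzero constant
    into an ideal generated by forms of positive degree, all of which vanish at 0.\<close>
  have "\<forall>i. x i = 0" if x: "(\<Sum>i\<in>UNIV. x i *s (\<chi> j. C i j)) = 0" for x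
  proof (rule ccontr)
    assume "\<not> ?thesis"
    then obtain r where r: "x r \<noteq> 0" by blast
    let ?A = "Some ` (UNIV - {r})"
    have "(\<Sum>i\<in>UNIV. x i * C i j) = 0" for j
      using arg_cong[OF x, of "\<lambda>w. w $ j"] by (simp add: sum_component)
    then have "(\<Sum>j\<in>UNIV. Cst (\<Sum>i\<in>UNIV. x i * C i j) * ?F j) = 0" by simp
    then have "(\<Sum>j\<in>UNIV. \<Sum>i\<in>UNIV. Cst (x i) * (Cst (C i j) * ?F j)) = 0"
      by (simp only: Cst_sum_mult sum_distrib_right mult.assoc)
    then have "(\<Sum>i\<in>UNIV. Cst (x i) * \<theta> (Some i)) = 0"
      by (subst (asm) sum.swap) (simp only: \<theta>S sum_distrib_left)
    then have "Cst (x r) * \<theta> (Some r) + (\<Sum>i\<in>UNIV - {r}. Cst (x i) * \<theta> (Some i)) = 0"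
      by (subst (asm) sum.remove[of _ r]) auto
    then have "\<theta> (Some r) * Cst (x r) = - (\<Sum>i\<in>UNIV - {r}. Cst (x i) * \<theta> (Some i))"
      by (simp add: add_eq_0_iff2 mult.commute)
    also have "\<dots> \<in> ideal.span (\<theta> ` ?A)"
      by (intro ideal.span_neg ideal.span_sum ideal.span_scale ideal.span_base) auto
    finally have "Cst (x r) \<in> ideal.span (\<theta> ` ?A)"
      by (intro regularD[OF reg _ homog_Cst]) auto
    moreover have "poly_eval p 0 = 0" if "p \<in> \<theta> ` ?A" for p
      using that poly_eval_homog_zero[OF hom\<theta>S] d(1) by auto
    ultimately have "poly_eval (Cst (x r)) (0 :: complex^'n option) = 0" using zeros_of_span by blast
    then show False using r by simp
  qed
  then obtain c0 and B :: "complex^'n option^'n option" where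
    B: "B ** (\<chi> k. case k of None \<Rightarrow> c0 | Some i \<Rightarrow> (\<chi> j. C i j)) = mat 1"
    by (rule exists_invertible_completion[of "\<lambda>i. \<chi> j. C i j"]) blast
  define M where "M k j = (case k of None \<Rightarrow> c0 $ j | Some i \<Rightarrow> C i j)" for k j
  have BM: "(\<Sum>k\<in>UNIV. B $ j $ k * M k j') = (if j = j' then 1 else 0)" for j j'
  proof -
    have "(\<Sum>k\<in>UNIV. B $ j $ k * M k j') = (B ** (\<chi> k. case k of None \<Rightarrow> c0 | Some i \<Rightarrow> (\<chi> j. C i j))) $ j $ j'"
      unfolding matrix_matrix_mult_def by (simp add: M_def) (intro sum.cong refl, simp split: option.split)
    then show ?thesis by (simp add: B mat_def)
  qed
  have BM': "(\<Sum>k\<in>UNIV. Cst (B $ j $ k) * Cst (M k j')) = (if j = j' then 1 else 0 :: 'n option mpoly)" for j j'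
    by (simp add: BM flip: Cst_sum_mult)
  \<comment> \<open>\<open>\<tau>\<close> agrees with \<open>\<theta>\<close> on
    \<open>Some i\<close>, but at \<open>None\<close> it has the completing combination of partial
    derivatives in place of \<open>l\<close>. By invertibility the \<open>\<tau> k\<close> and the
    partial derivatives generate each other with constant coefficients.\<close>
  define \<tau> where "\<tau> k = (\<Sum>j\<in>UNIV. Cst (M k j) * ?F j)" for k
  have \<tau>S: "\<tau> (Some i) = \<theta> (Some i)" for i by (simp add: \<tau>_def \<theta>S M_def)
  have \<tau>im: "\<tau> ` range Some = \<theta> ` range Some" using \<tau>S by (auto simp: image_iff)
  have hom\<tau>: "\<tau> k \<in> homog_part (int d)" for k unfolding \<tau>_def by (intro homog_sum homog_Cst_mult homF)
  have F\<tau>: "?F j = (\<Sum>k\<in>UNIV. Cst (B $ j $ k) * \<tau> k)" for j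
  proof -
    have "(\<Sum>k\<in>UNIV. Cst (B $ j $ k) * \<tau> k) = (\<Sum>k\<in>UNIV. \<Sum>j'\<in>UNIV. (Cst (B $ j $ k) * Cst (M k j')) * ?F j')"
      by (simp only: \<tau>_def sum_distrib_left mult.assoc)
    also have "\<dots> = (\<Sum>j'\<in>UNIV. (\<Sum>k\<in>UNIV. Cst (B $ j $ k) * Cst (M k j')) * ?F j')"
      by (subst sum.swap) (simp only: sum_distrib_right)
    also have "\<dots> = ?F j" by (simp add: BM' if_distrib if_distribR cong: if_cong)
    finally show ?thesis ..
  qed
  have aj: "a $ j \<in> homog_part m" for j using a by (simp add: AR_def)
  have asum: "(\<Sum>j\<in>UNIV. a $ j * ?F j) = 0" using a by (simp add: AR_def)
  \<comment> \<open>The coordinates of the syzygy with respect to the generators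
    \<open>\<tau> k\<close>; the matrix is the transposed inverse of the one that defines
    \<open>\<tau>\<close>.\<close>
  define b where "b k = (\<Sum>j\<in>UNIV. Cst (B $ j $ k) * a $ j)" for k
  have homb: "b k \<in> homog_part m" for k unfolding b_def by (intro homog_sum homog_Cst_mult aj)
  have ab: "a $ j' = (\<Sum>k\<in>UNIV. Cst (M k j') * b k)" for j'
  proof -
    have "(\<Sum>k\<in>UNIV. Cst (M k j') * b k) = (\<Sum>k\<in>UNIV. \<Sum>j\<in>UNIV. (Cst (B $ j $ k) * Cst (M k j')) * a $ j)"
      by (simp only: b_def sum_distrib_left mult_ac)
    also have "\<dots> = (\<Sum>j\<in>UNIV. (\<Sum>k\<in>UNIV. Cst (B $ j $ k) * Cst (M k j')) * a $ j)"
      by (subst sum.swap) (simp only: sum_distrib_right)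
    also have "\<dots> = a $ j'" by (simp add: BM' if_distrib if_distribR cong: if_cong)
    finally show ?thesis ..
  qed
  have syz: "(\<Sum>k\<in>UNIV. b k * \<tau> k) = 0"
  proof -
    have "(\<Sum>k\<in>UNIV. b k * \<tau> k) = (\<Sum>k\<in>UNIV. \<Sum>j\<in>UNIV. a $ j * (Cst (B $ j $ k) * \<tau> k))"
      unfolding b_def sum_distrib_right by (intro sum.cong refl) (simp only: mult_ac)
    also have "\<dots> = (\<Sum>j\<in>UNIV. a $ j * ?F j)"
      by (subst sum.swap) (simp only: F\<tau> flip: sum_distrib_left)
    finally show ?thesis using asum by simp
  qed
  have split: "(\<Sum>k\<in>UNIV. h k) = h None + (\<Sum>k\<in>range Some. h k)" for h :: "'n option \<Rightarrow> 'n option mpoly"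
    by (simp add: UNIV_option_conv)
  have \<tau>G: "\<tau> (Some i) \<in> ?G" for i unfolding \<tau>S by (intro ideal.span_base) blast
  have b0: "b None * \<tau> None \<in> ?G"
  proof -
    have "b None * \<tau> None = - (\<Sum>k\<in>range Some. b k * \<tau> k)"
      using syz unfolding split by (simp only: add_eq_0_iff2)
    also have "\<dots> \<in> ?G" using \<tau>G by (intro ideal.span_neg ideal.span_sum ideal.span_scale) auto
    finally show ?thesis .
  qed
  \<comment> \<open>The syzygy shows that \<open>b None\<close> carries \<open>\<tau> None\<close>
    into \<open>?G\<close>. Every partial derivative is a combination of \<open>\<tau> None\<close>
    and generators of \<open>?G\<close>.\<close>
  have "b None * ?F j \<in> ?G" for j
  proof -
    have "b None * ?F j = Cst (B $ j $ None) * (b None * \<tau> None) + (\<Sum>k\<in>range Some. (b None * Cst (B $ j $ k)) * \<tau> k)"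
      unfolding F\<tau> split distrib_left sum_distrib_left by (simp only: mult_ac)
    also have "\<dots> \<in> ?G" using \<tau>G by (intro ideal.span_add ideal.span_scale b0 ideal.span_sum) auto
    finally show ?thesis .
  qed
  moreover have "m + int (\<Sum>p\<in>sing_points f. a_inv (g p)) \<le> int CARD('n) * (int d - 1)"
    using m d(2) by simp
  ultimately have "b None \<in> ?G"
    using lv l(1)
    by (intro annihilated_by_jacobian[OF f N fin eqn v _ _ hom\<theta>S reg soc homb]) (simp_all add: \<theta>_def)
  then have bG: "b None \<in> ideal.span (\<tau> ` range Some)" by (simp only: \<tau>im)
  \<comment> \<open>\<open>\<tau> None\<close> may be a zero divisor modulo \<open>?G\<close>; the
    membership \<open>bG\<close> covers this index, and regularity of \<open>\<theta>\<close>
    handles the remaining ones.\<close>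
  have "\<exists>s. alternating s \<and> (\<forall>k\<in>insert None (range Some). b k = (\<Sum>k'\<in>insert None (range Some). s k k' * \<tau> k'))"
  proof (rule koszul_insert[where d = "int d" and m = m])
    show "(\<Sum>k\<in>insert None (range Some). b k * \<tau> k) = 0" using syz by (simp only: UNIV_option_conv)
    fix b' assume b': "\<And>k. k \<in> range Some \<Longrightarrow> b' k \<in> homog_part m" "(\<Sum>k\<in>range Some. b' k * \<tau> k) = 0"
    have "(\<Sum>k\<in>range Some. b' k * \<theta> k) = (\<Sum>k\<in>range Some. b' k * \<tau> k)"
      by (rule sum.cong) (auto simp: \<tau>S)
    then obtain s where s: "alternating s" "\<forall>k\<in>range Some. b' k = (\<Sum>k'\<in>range Some. s k k' * \<theta> k')"
      using koszul_of_regular[OF reg, of "range Some" "int d" b' m] b' hom\<theta>S by auto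
    have "(\<Sum>k'\<in>range Some. s k k' * \<theta> k') = (\<Sum>k'\<in>range Some. s k k' * \<tau> k')" for k
      by (rule sum.cong) (auto simp: \<tau>S)
    then show "\<exists>s. alternating s \<and> (\<forall>k\<in>range Some. b' k = (\<Sum>k'\<in>range Some. s k k' * \<tau> k'))"
      using s by metis
  qed (use hom\<tau> homb bG in auto)
  then obtain s where s: "alternating s" "\<And>k. b k = (\<Sum>k'\<in>UNIV. s k k' * \<tau> k')"
    unfolding UNIV_option_conv[symmetric] by blast
  have "a $ j = (\<Sum>j'\<in>UNIV. (\<Sum>k\<in>UNIV. \<Sum>k'\<in>UNIV. Cst (M k j) * s k k' * Cst (M k' j')) * ?F j')" for j
  proof -
    have "a $ j = (\<Sum>k\<in>UNIV. \<Sum>k'\<in>UNIV. \<Sum>j'\<in>UNIV. Cst (M k j) * s k k' * Cst (M k' j') * ?F j')"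
      unfolding ab s(2) \<tau>_def sum_distrib_left by (simp only: mult.assoc)
    also have "\<dots> = (\<Sum>k\<in>UNIV. \<Sum>j'\<in>UNIV. \<Sum>k'\<in>UNIV. Cst (M k j) * s k k' * Cst (M k' j') * ?F j')"
      by (intro sum.cong refl sum.swap)
    also have "\<dots> = (\<Sum>j'\<in>UNIV. \<Sum>k\<in>UNIV. \<Sum>k'\<in>UNIV. Cst (M k j) * s k k' * Cst (M k' j') * ?F j')"
      by (rule sum.swap)
    finally show ?thesis by (simp only: sum_distrib_right)
  qed
  then show ?thesis
    by (rule alternating_in_KR[OF alternating_congruence[OF s(1), of "\<lambda>k j. Cst (M k j)"]])
qed

theorem theorem2p4:
  fixes f :: "('n::finite) option mpoly"
    and N :: nat
    and g :: "'n option proj \<Rightarrow> 'n hol_germ"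
    and m :: int
  assumes "f \<in> homog_part (int N)" and "f \<noteq> 0" and "N > 1"
    and "\<forall>p\<in>sing_points f. p isolated_in sing_points f"
    and "\<forall>p\<in>sing_points f. local_equation f p (g p)"
    and "m \<le> int CARD('n) * (int N - 2) - (\<Sum>p\<in>sing_points f. int (a_inv (g p)))"
  shows "ER f m = {KR f}"
proof -
  have fin: "finite (sing_points f)" by (rule finite_sing_points[OF assms(1,3,4)])
  have sub: "AR f m \<subseteq> KR f" using syzygies_are_koszul[OF assms(1,3) fin assms(5,6)] by blast
  \<comment> \<open>This makes the set of cosets nonempty, so that it is \<open>{KR f}\<close> and
    not the empty set.\<close>
  have "0 \<in> AR f m" by (simp add: AR_def)
  have "{(a, b). a - b \<in> KR f} `` {a} = KR f" if "a \<in> AR f m" for a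
  proof -
    have a: "a \<in> KR f" using that sub by blast
    have "a - b \<in> KR f \<longleftrightarrow> b \<in> KR f" for b
    proof
      assume "a - b \<in> KR f"
      then have "a - (a - b) \<in> KR f" using a unfolding KR_def by (rule vmod.span_diff[rotated])
      then show "b \<in> KR f" by simp
    next
      assume "b \<in> KR f"
      then show "a - b \<in> KR f" using a unfolding KR_def by (rule vmod.span_diff[rotated])
    qed
    then show ?thesis by auto
  qed
  then show ?thesis using \<open>0 \<in> AR f m\<close> unfolding ER_def quotient_def by blast
qed

end
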